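(* Let $(X_n)_{n\in\mathbb{N}_0}$ be a transient random walk on a regular language which is weakly symmetric and suffix-irreducible, let $\pi_n$ be the distribution of $X_n$ and let $h=\lim_{n\to\infty}-\frac1n\mathbb{E}[\log\pi_n(X_n)]$ be its asymptotic entropy. Then: (1) for almost every trajectory of $(X_n)_{n\in\mathbb{N}_0}$, $h=\liminf_{n\to\infty}-\frac1n\log\pi_n(X_n)$; (2) $-\frac1n\log\pi_n(X_n)\to h$ in probability; (3) $-\frac1n\log\pi_n(X_n)\to h$ in $L_1$.
   Context: $\mathcal{A}$ is a finite alphabet, $\mathcal{A}^n$ the set of words with exactly $n$ letters, $\mathcal{A}^*$ the set of all finite words including the empty word $o$, and $|w|$ the length of $w$. A random walk on a regular language is a time-homogeneous Markov chain $(X_n)_{n\ge0}$ on $\mathcal{A}^*$ with $X_0=o$ whose only possible one-step transitions are (for $w\in\mathcal{A}^*$ and letters $a_i,b_i\in\mathcal{A}$): from $wa_1a_2$ to $wb_1$, $wb_1b_2$, $wb_1b_2b_3$ with probabilities $p(a_1a_2,b_1)$, $p(a_1a_2,b_1b_2)$, $p(a_1a_2,b_1b_2b_3)$ not depending on $w$; from $a_1$ to $o$, $b_1$, $b_1b_2$ with probabilities $p(a_1,o)$, $p(a_1,b_1)$, $p(a_1,b_1b_2)$; from $o$ to $o$, $b_1$ with probabilities $p(o,o)$, $p(o,b_1)$. $\mathbb{P}_w$ is the law started at $w$ and $\mathcal{L}=\{w:\exists n\in\mathbb{N},\ \mathbb{P}[X_n=w]>0\}$. Weakly symmetric: for all $u,v\in\mathcal{A}^*$,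 $\mathbb{P}_u[X_1=v]>0$ implies $\mathbb{P}_v[X_1=u]>0$. Suffix-irreducible: for every $w=w_0a_0b_0\in\mathcal{L}$ ($w_0\in\mathcal{A}^*$, $a_0b_0\in\mathcal{A}^2$) and every $ab\in\mathcal{A}^2$ there are $n\in\mathbb{N}$, $w_1\in\mathcal{A}^*$ with $\mathbb{P}_w[X_n=w_0w_1ab,\ \forall k\le n:|X_k|\ge|w|]>0$. Under these assumptions and transience the limit $h$ exists. Here $\pi_n(X_n)$ is the random variable obtained by evaluating $w\mapsto\mathbb{P}[X_n=w]$ at $X_n$. *)

theory Defs
  imports "HOL-Probability.Probability"
begin

section \<open>Markov chains on a countable state space\<close>

text \<open>
  The defining equation is the time-homogeneous Markov property
  \<open>\<P>(X (n+1) = v | X 0 = x 0, \<dots>, X n = x n) = q (x n) v\<close> multiplied by the probability of the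
  conditioning event, so that conditioning on null events imposes nothing.
\<close>

definition markov_chain ::
  "'b measure \<Rightarrow> (nat \<Rightarrow> 'b \<Rightarrow> 's) \<Rightarrow> ('s \<Rightarrow> 's \<Rightarrow> real) \<Rightarrow> 's \<Rightarrow> bool" where
  "markov_chain M X q s \<longleftrightarrow>
     prob_space M \<and>
     (\<forall>n. X n \<in> M \<rightarrow>\<^sub>M count_space UNIV) \<and>
     \<P>(\<omega> in M. X 0 \<omega> = s) = 1 \<and>
     (\<forall>n x v. \<P>(\<omega> in M. (\<forall>i\<le>n. X i \<omega> = x i) \<and> X (Suc n) \<omega> = v)
        = \<P>(\<omega> in M. \<forall>i\<le>n. X i \<omega> = x i) * q (x n) v)"


section \<open>Random walks on regular languages\<close>

text \<open>
  \<open>p x y\<close> is the probability of replacing the suffix \<open>x\<close> by \<open>y\<close>, where \<open>x\<close> consists of the last two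
  letters, or of the whole word if this has fewer than two letters. As subtraction on \<open>nat\<close>
  truncates, \<open>m\<close> below is the length of the untouched prefix in both cases, and the bounds on
  \<open>length v\<close> leave exactly the replacements \<open>a\<^sub>1a\<^sub>2 \<rightarrow> b\<^sub>1, b\<^sub>1b\<^sub>2, b\<^sub>1b\<^sub>2b\<^sub>3\<close>, \<open>a\<^sub>1 \<rightarrow> o, b\<^sub>1, b\<^sub>1b\<^sub>2\<close> and
  \<open>o \<rightarrow> o, b\<^sub>1\<close>; other values of \<open>p\<close> are irrelevant.
\<close>

definition step_prob :: "('a list \<Rightarrow> 'a list \<Rightarrow> real) \<Rightarrow> 'a list \<Rightarrow> 'a list \<Rightarrow> real" where
  "step_prob p u v =
     (let m = length u - 2 in
      if length u - 1 \<le> length v \<and> length v \<le> length u + 1 \<and> take m v = take m u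
      then p (drop m u) (drop m v) else 0)"

text \<open>
  The walk is a process \<open>X\<close> together with its laws \<open>P w\<close>, one for each starting word \<open>w\<close>; the walk
  of interest has the law \<open>P []\<close>. That the relevant values of \<open>p\<close> are nonnegative and sum to one
  is a consequence, since \<open>P w\<close> is a probability measure for every \<open>w\<close>.
\<close>

definition regular_language_walk ::
  "('a::finite list \<Rightarrow> 'b measure) \<Rightarrow> (nat \<Rightarrow> 'b \<Rightarrow> 'a list) \<Rightarrow> ('a list \<Rightarrow> 'a list \<Rightarrow> real) \<Rightarrow> bool" where
  "regular_language_walk P X p \<longleftrightarrow> (\<forall>w. markov_chain (P w) X (step_prob p) w)"

definition accessible_words ::
  "('a list \<Rightarrow> 'b measure) \<Rightarrow> (nat \<Rightarrow> 'b \<Rightarrow> 'a list) \<Rightarrow> 'a list set" where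
  "accessible_words P X = {w. \<exists>n. \<P>(\<omega> in P []. X n \<omega> = w) > 0}"

text \<open>
  Transience refers to the chain on its accessible states: from each of them the probability of
  ever returning is less than one.
\<close>

definition transient ::
  "('a list \<Rightarrow> 'b measure) \<Rightarrow> (nat \<Rightarrow> 'b \<Rightarrow> 'a list) \<Rightarrow> bool" where
  "transient P X \<longleftrightarrow>
     (\<forall>w\<in>accessible_words P X. \<P>(\<omega> in P w. \<exists>n\<ge>1. X n \<omega> = w) < 1)"

definition weakly_symmetric ::
  "('a list \<Rightarrow> 'b measure) \<Rightarrow> (nat \<Rightarrow> 'b \<Rightarrow> 'a list) \<Rightarrow> bool" where
  "weakly_symmetric P X \<longleftrightarrow>
     (\<forall>u v. \<P>(\<omega> in P u. X 1 \<omega> = v) > 0 \<longrightarrow> \<P>(\<omega> in P v. X 1 \<omega> = u) > 0)"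

definition suffix_irreducible ::
  "('a list \<Rightarrow> 'b measure) \<Rightarrow> (nat \<Rightarrow> 'b \<Rightarrow> 'a list) \<Rightarrow> bool" where
  "suffix_irreducible P X \<longleftrightarrow>
     (\<forall>w w\<^sub>0 a\<^sub>0 b\<^sub>0 a b. w \<in> accessible_words P X \<and> w = w\<^sub>0 @ [a\<^sub>0, b\<^sub>0] \<longrightarrow>
        (\<exists>n w\<^sub>1. \<P>(\<omega> in P w. X n \<omega> = w\<^sub>0 @ w\<^sub>1 @ [a, b] \<and>
                     (\<forall>k\<le>n. length (X k \<omega>) \<ge> length w)) > 0))"


section \<open>Entropy\<close>

definition walk_distr ::
  "('a list \<Rightarrow> 'b measure) \<Rightarrow> (nat \<Rightarrow> 'b \<Rightarrow> 'a list) \<Rightarrow> nat \<Rightarrow> 'a list \<Rightarrow> real" where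
  "walk_distr P X n w = \<P>(\<omega> in P []. X n \<omega> = w)"

text \<open>The value at \<open>n = 0\<close> is \<open>0\<close> because of \<open>1 / 0 = 0\<close>; it plays no role in the limits.\<close>

definition information_rate ::
  "('a list \<Rightarrow> 'b measure) \<Rightarrow> (nat \<Rightarrow> 'b \<Rightarrow> 'a list) \<Rightarrow> nat \<Rightarrow> 'b \<Rightarrow> real" where
  "information_rate P X n \<omega> = - (1 / real n) * ln (walk_distr P X n (X n \<omega>))"

definition asymptotic_entropy ::
  "('a list \<Rightarrow> 'b measure) \<Rightarrow> (nat \<Rightarrow> 'b \<Rightarrow> 'a list) \<Rightarrow> real" where
  "asymptotic_entropy P X =
     lim (\<lambda>n. - (1 / real n) * (\<integral>\<omega>. ln (walk_distr P X n (X n \<omega>)) \<partial>P []))"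


section \<open>Modes of convergence to a constant\<close>

definition converges_in_probability :: "'b measure \<Rightarrow> (nat \<Rightarrow> 'b \<Rightarrow> real) \<Rightarrow> real \<Rightarrow> bool" where
  "converges_in_probability M Y c \<longleftrightarrow>
     (\<forall>\<epsilon>>0. (\<lambda>n. \<P>(\<omega> in M. \<bar>Y n \<omega> - c\<bar> > \<epsilon>)) \<longlonglongrightarrow> 0)"

text \<open>Integrability is required explicitly because the integral of a non-integrable function is \<open>0\<close>.\<close>

definition converges_in_L1 :: "'b measure \<Rightarrow> (nat \<Rightarrow> 'b \<Rightarrow> real) \<Rightarrow> real \<Rightarrow> bool" where
  "converges_in_L1 M Y c \<longleftrightarrow>
     (\<forall>n. integrable M (Y n)) \<and> (\<lambda>n. \<integral>\<omega>. \<bar>Y n \<omega> - c\<bar> \<partial>M) \<longlonglongrightarrow> 0"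

end

theory Submission
  imports Defs "HOL-Library.Discrete_Functions"
begin

text \<open>
  Let \<open>G\<close> be the Green function of the walk and \<open>\<delta>(w) = - ln G(o, w)\<close>. As
  \<open>\<pi>\<^sub>n(w) \<le> G(o, w)\<close>, always \<open>- ln \<pi>\<^sub>n(X\<^sub>n) \<ge> \<delta>(X\<^sub>n)\<close>. Conversely \<open>\<pi>\<^sub>n\<close> decays exponentially fast, so
  \<open>G(o, X\<^sub>n)\<close> is at most twice the sum of \<open>\<pi>\<^sub>k(X\<^sub>n)\<close> over \<open>k \<le> K n\<close>, and Gibbs' inequality gives
  \<open>\<E>[- ln \<pi>\<^sub>n(X\<^sub>n)] \<le> \<E>[\<delta>(X\<^sub>n)] + O(log n)\<close>. Hence it suffices that \<open>\<delta>(X\<^sub>n) / n\<close> converges to a constant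
  almost surely and in \<open>L\<^sub>1\<close>.

  The key estimate is that \<open>\<E>\<^sub>w[\<delta>(X\<^sub>m)] - \<delta>(w)\<close> is independent of \<open>w\<close> up to a constant that does not
  depend on \<open>m\<close>. From every \<open>w\<close> the walk reaches in boundedly many steps a word of one fixed cone type
  and then stays in that cone with probability at least \<open>1/2\<close>; inside a cone the increments of
  \<open>\<delta>\<close> depend on the prefix only up to a constant, and the time of leaving it has bounded mean on the
  event that the cone is left. So the oscillation \<open>b\<close> of the left-hand side satisfies
  \<open>b \<le> (1 - \<theta>) b + C\<close>. Consequently \<open>\<E>[\<delta>(X\<^sub>n)]\<close> is additive up to a constant, hence \<open>n h + O(1)\<close>, and
  \<open>\<delta>(X\<^sub>n) - n h\<close> is a martingale up to a bounded correction. Its second moment is \<open>O(n)\<close>, which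
  yields both modes of convergence.

  Exponential decay comes from the positive superharmonic function \<open>w \<mapsto> G(w, o)\<close>: every word has
  another one at bounded distance where this function is four times smaller, so that its square root
  is strictly contracted by the transition operator.
\<close>

section \<open>The transition operator on words\<close>

lemma finite_length_le: "finite {y :: 'a::finite list. length y \<le> n}"
  using finite_lists_length_le[of "UNIV :: 'a set" n] by simp

text \<open>The features of the one-step kernel on which the analysis rests: finite range,
  indifference to a prefix as long as two letters remain, and symmetry of the possible steps, though
  not of their probabilities.\<close>

locale word_kernel =
  fixes q :: "'a::finite list \<Rightarrow> 'a list \<Rightarrow> real"
  assumes q_nonneg: "0 \<le> q x y"
    and q_length: "q x y > 0 \<Longrightarrow> length y \<le> Suc (length x)"
    and q_sum: "(\<Sum>y | q x y > 0. q x y) = 1"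
    and q_shift: "2 \<le> length x \<Longrightarrow> q (w @ x) (w @ y) = q x y"
    and q_prefix: "2 \<le> length x \<Longrightarrow> q (w @ x) z > 0 \<Longrightarrow> \<exists>y. z = w @ y"
    and q_sym: "q x y > 0 \<Longrightarrow> q y x > 0"
begin

abbreviation step :: "'a list \<Rightarrow> 'a list \<Rightarrow> bool" where
  "step x y \<equiv> q x y > 0"

text \<open>Summing over the finitely many successors makes the operator available for every real
  function, without integrability conditions.\<close>

definition T :: "('a list \<Rightarrow> real) \<Rightarrow> 'a list \<Rightarrow> real" where
  "T \<phi> x = (\<Sum>y | step x y. q x y * \<phi> y)"

lemma finite_step [simp]: "finite {y. step x y}"
  by (rule finite_subset[OF _ finite_length_le[of "Suc (length x)"]]) (use q_length in auto)

lemma step_length: "step x y \<Longrightarrow> length y \<le> Suc (length x) \<and> length x \<le> Suc (length y)"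
  using q_length q_sym by blast

lemma T_mono: "(\<And>y. step x y \<Longrightarrow> \<phi> y \<le> \<psi> y) \<Longrightarrow> T \<phi> x \<le> T \<psi> x"
  unfolding T_def by (intro sum_mono mult_left_mono) (auto simp: q_nonneg)

lemma T_cong: "(\<And>y. step x y \<Longrightarrow> \<phi> y = \<psi> y) \<Longrightarrow> T \<phi> x = T \<psi> x"
  unfolding T_def by (intro sum.cong) auto

lemma T_add: "T (\<lambda>y. \<phi> y + \<psi> y) x = T \<phi> x + T \<psi> x"
  unfolding T_def by (simp add: distrib_left sum.distrib)

lemma T_diff: "T (\<lambda>y. \<phi> y - \<psi> y) x = T \<phi> x - T \<psi> x"
  unfolding T_def by (simp add: right_diff_distrib sum_subtractf)

lemma T_cmult: "T (\<lambda>y. c * \<phi> y) x = c * T \<phi> x"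
  unfolding T_def by (simp add: sum_distrib_left mult.left_commute)

lemma T_const [simp]: "T (\<lambda>y. c) x = c"
  unfolding T_def using q_sum[of x] by (simp add: sum_distrib_right[symmetric])

lemma T_sum: "T (\<lambda>y. \<Sum>i\<in>I. \<phi> i y) x = (\<Sum>i\<in>I. T (\<phi> i) x)"
  unfolding T_def by (subst sum.swap) (simp add: sum_distrib_left)

lemma T_abs: "\<bar>T \<phi> x\<bar> \<le> T (\<lambda>y. \<bar>\<phi> y\<bar>) x"
  unfolding T_def by (rule order.trans[OF sum_abs]) (simp add: abs_mult q_nonneg)

lemma T_ge_term:
  assumes "\<And>y. step x y \<Longrightarrow> 0 \<le> \<phi> y" "step x y"
  shows "q x y * \<phi> y \<le> T \<phi> x"
  unfolding T_def by (rule member_le_sum) (use assms q_nonneg in auto)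

lemma T_tendsto:
  assumes "\<And>y. step x y \<Longrightarrow> (\<lambda>n. \<phi> n y) \<longlonglongrightarrow> \<psi> y"
  shows "(\<lambda>n. T (\<phi> n) x) \<longlonglongrightarrow> T \<psi> x"
  unfolding T_def by (intro tendsto_sum tendsto_mult_left) (use assms in auto)

lemma step_shift: "2 \<le> length x \<Longrightarrow> {z. step (w @ x) z} = (@) w ` {y. step x y}"
proof safe
  fix z assume x: "2 \<le> length x" and z: "step (w @ x) z"
  then obtain y where "z = w @ y" using q_prefix by blast
  then show "z \<in> (@) w ` {y. step x y}" using z q_shift[OF x, of w y] by auto
qed (simp add: q_shift)

lemma T_shift:
  assumes "2 \<le> length V"
  shows "T \<phi> (W @ V) = T (\<lambda>U. \<phi> (W @ U)) V"
  unfolding T_def step_shift[OF assms] using assms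
  by (subst sum.reindex) (auto simp: inj_on_def q_shift)

section \<open>Iterates of the transition operator\<close>

definition step_closed :: "'a list set \<Rightarrow> bool" where
  "step_closed S \<longleftrightarrow> (\<forall>x\<in>S. \<forall>y. step x y \<longrightarrow> y \<in> S)"

lemma step_closedD: "step_closed S \<Longrightarrow> x \<in> S \<Longrightarrow> step x y \<Longrightarrow> y \<in> S"
  unfolding step_closed_def by blast

lemma step_closed_UNIV [simp]: "step_closed UNIV"
  by (simp add: step_closed_def)

text \<open>Stated relative to a closed set because most later estimates hold on accessible words
  only.\<close>

lemma Tn_mono:
  assumes "step_closed S" "\<And>y. y \<in> S \<Longrightarrow> \<phi> y \<le> \<psi> y" "x \<in> S"
  shows "(T ^^ n) \<phi> x \<le> (T ^^ n) \<psi> x"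
  using assms(3)
proof (induction n arbitrary: x)
  case (Suc n)
  show ?case unfolding funpow.simps o_apply
    by (rule T_mono, rule Suc.IH) (rule step_closedD[OF assms(1) Suc.prems])
qed (simp add: assms(2))

lemma Tn_cong:
  assumes "step_closed S" "\<And>y. y \<in> S \<Longrightarrow> \<phi> y = \<psi> y" "x \<in> S"
  shows "(T ^^ n) \<phi> x = (T ^^ n) \<psi> x"
  using assms by (intro antisym Tn_mono[of S]) auto

lemma Tn_add: "(T ^^ n) (\<lambda>y. \<phi> y + \<psi> y) x = (T ^^ n) \<phi> x + (T ^^ n) \<psi> x"
  by (induction n arbitrary: x) (auto simp: T_add[symmetric] intro: T_cong)

lemma Tn_diff: "(T ^^ n) (\<lambda>y. \<phi> y - \<psi> y) x = (T ^^ n) \<phi> x - (T ^^ n) \<psi> x"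
  by (induction n arbitrary: x) (auto simp: T_diff[symmetric] intro: T_cong)

lemma Tn_cmult: "(T ^^ n) (\<lambda>y. c * \<phi> y) x = c * (T ^^ n) \<phi> x"
  by (induction n arbitrary: x) (auto simp: T_cmult[symmetric] intro: T_cong)

lemma Tn_const [simp]: "(T ^^ n) (\<lambda>y. c) x = c"
proof (induction n arbitrary: x)
  case (Suc n)
  have "T ((T ^^ n) (\<lambda>y. c)) x = T (\<lambda>y. c) x" by (rule T_cong) (rule Suc.IH)
  then show ?case by simp
qed simp

lemma Tn_sum: "(T ^^ n) (\<lambda>y. \<Sum>i\<in>I. \<phi> i y) x = (\<Sum>i\<in>I. (T ^^ n) (\<phi> i) x)"
  by (induction n arbitrary: x) (auto simp: T_sum[symmetric] intro: T_cong)

lemma Tn_tendsto: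
  assumes "\<And>y. (\<lambda>n. \<phi> n y) \<longlonglongrightarrow> \<psi> y"
  shows "(\<lambda>n. (T ^^ k) (\<phi> n) x) \<longlonglongrightarrow> (T ^^ k) \<psi> x"
  by (induction k arbitrary: x) (auto intro!: T_tendsto assms)

lemma Tn_nonneg:
  assumes "step_closed S" "\<And>y. y \<in> S \<Longrightarrow> 0 \<le> \<phi> y" "x \<in> S"
  shows "0 \<le> (T ^^ n) \<phi> x"
  using Tn_mono[OF assms(1), of "\<lambda>_. 0" \<phi> x n] assms by simp

lemma Tn_le_const:
  assumes "step_closed S" "\<And>y. y \<in> S \<Longrightarrow> \<phi> y \<le> c" "x \<in> S"
  shows "(T ^^ n) \<phi> x \<le> c"
  using Tn_mono[OF assms(1), of \<phi> "\<lambda>_. c" x n] assms by simp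

lemma Tn_abs_le_const:
  assumes "step_closed S" "\<And>y. y \<in> S \<Longrightarrow> \<bar>\<phi> y\<bar> \<le> c" "x \<in> S"
  shows "\<bar>(T ^^ n) \<phi> x\<bar> \<le> c"
proof -
  have "(T ^^ n) \<phi> x \<le> (T ^^ n) (\<lambda>_. c) x" "(T ^^ n) (\<lambda>_. - c) x \<le> (T ^^ n) \<phi> x"
    by (rule Tn_mono[of S]; use assms in \<open>force simp: abs_le_iff\<close>)+
  then show ?thesis by simp
qed

text \<open>By \<open>q_shift\<close> every positive transition probability already occurs at a word
  of at most two letters, and there are finitely many of these.\<close>

lemma q_bounded_below: "\<exists>\<epsilon>>0. \<epsilon> \<le> 1 \<and> (\<forall>x y. step x y \<longrightarrow> \<epsilon> \<le> q x y)"
proof -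
  \<comment> \<open>The inserted 1 makes the set nonempty and its minimum at most 1.\<close>
  define Q where "Q = insert 1 ((\<lambda>(x, y). q x y) ` {(x, y). length x \<le> 2 \<and> length y \<le> 3 \<and> step x y})"
  have "{(x :: 'a list, y). length x \<le> 2 \<and> length y \<le> 3 \<and> step x y}
      \<subseteq> {x. length x \<le> 2} \<times> {y. length y \<le> 3}" by auto
  then have "finite {(x :: 'a list, y). length x \<le> 2 \<and> length y \<le> 3 \<and> step x y}"
    by (rule finite_subset) (intro finite_SigmaI finite_length_le)
  then have fin: "finite Q"
    unfolding Q_def by (intro finite.insertI finite_imageI)
  have pos: "Min Q > 0"
    using fin by (subst Min_gr_iff) (auto simp: Q_def)
  have "Min Q \<le> q x y" if "step x y" for x y
  proof (cases "length x \<le> 2")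
    case True
    then show ?thesis using fin that step_length[OF that]
      by (intro Min_le) (auto simp: Q_def intro!: image_eqI[of _ _ "(x, y)"])
  next
    case False
    define w where "w = take (length x - 2) x"
    define x' where "x' = drop (length x - 2) x"
    have x: "x = w @ x'" "length x' = 2" using False by (auto simp: w_def x'_def)
    then obtain y' where y: "y = w @ y'" using q_prefix[of x' w y] \<open>step x y\<close> by auto
    have eq: "q x y = q x' y'" using x y q_shift[of x' w y'] by simp
    then have "step x' y'" using that by simp
    then show ?thesis using fin x step_length[of x' y'] unfolding eq
      by (intro Min_le) (auto simp: Q_def intro!: image_eqI[of _ _ "(x', y')"])
  qed
  moreover have "Min Q \<le> 1" using fin by (intro Min_le) (auto simp: Q_def)
  ultimately show ?thesis using pos by blast
qed

definition eps :: real where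
  "eps = (SOME e. 0 < e \<and> e \<le> 1 \<and> (\<forall>x y. step x y \<longrightarrow> e \<le> q x y))"

lemma eps: "0 < eps" "eps \<le> 1" "step x y \<Longrightarrow> eps \<le> q x y"
  using someI_ex[OF q_bounded_below] unfolding eps_def by auto

lemma eps_power: "0 < eps ^ n" "eps ^ n \<le> 1" "m \<le> n \<Longrightarrow> eps ^ n \<le> eps ^ m"
  using eps(1,2) by (auto intro: power_le_one power_decreasing)

lemma Tn_ge_path:
  assumes "step_closed S" "\<And>y. y \<in> S \<Longrightarrow> 0 \<le> \<phi> y" "x \<in> S" "(step ^^ n) x y"
  shows "eps ^ n * \<phi> y \<le> (T ^^ n) \<phi> x"
  using assms(3,4)
proof (induction n arbitrary: x)
  case (Suc n)
  then obtain z where z: "step x z" "(step ^^ n) z y" by (meson relpowp_Suc_D2)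
  have "z \<in> S" by (rule step_closedD[OF assms(1) Suc.prems(1) z(1)])
  have nn: "0 \<le> (T ^^ n) \<phi> u" if "step x u" for u
    using Tn_nonneg[OF assms(1,2) step_closedD[OF assms(1) Suc.prems(1) that]] .
  have "eps ^ Suc n * \<phi> y \<le> eps * (T ^^ n) \<phi> z"
    using Suc.IH[OF \<open>z \<in> S\<close> z(2)] eps by (simp add: mult.assoc)
  also have "\<dots> \<le> q x z * (T ^^ n) \<phi> z"
    using eps(3)[OF z(1)] nn z(1) by (intro mult_right_mono) auto
  also have "\<dots> \<le> (T ^^ Suc n) \<phi> x"
    using T_ge_term[of x "(T ^^ n) \<phi>" z] nn z(1) by simp
  finally show ?case .
qed simp

lemma step_pow_sym: "(step ^^ n) x y \<Longrightarrow> (step ^^ n) y x"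
proof (induction n arbitrary: x y)
  case (Suc n)
  then obtain z where "(step ^^ n) x z" "step z y" by (auto elim: relpowp_Suc_E)
  then show ?case using Suc.IH q_sym by (meson relpowp_Suc_I2)
qed simp

section \<open>Transition probabilities in several steps\<close>

definition ind :: "'a list \<Rightarrow> 'a list \<Rightarrow> real" where
  "ind x y = (if y = x then 1 else 0)"

lemma ind_simps [simp]: "ind x x = 1" "y \<noteq> x \<Longrightarrow> ind x y = 0" "0 \<le> ind x y" "ind x y \<le> 1"
  by (auto simp: ind_def)

definition pn :: "nat \<Rightarrow> 'a list \<Rightarrow> 'a list \<Rightarrow> real" where
  "pn n x y = (T ^^ n) (ind y) x"

lemma pn_0 [simp]: "pn 0 x y = ind y x"
  by (simp add: pn_def)

lemma pn_nonneg [simp]: "0 \<le> pn n x y"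
  unfolding pn_def by (rule Tn_nonneg[of UNIV]) auto

lemma T_ind: "T (ind y) x = q x y"
proof -
  have "T (ind y) x = (\<Sum>z | step x z. if z = y then q x z else 0)"
    unfolding T_def by (intro sum.cong) (auto simp: ind_def)
  also have "\<dots> = q x y" using q_nonneg[of x y] by auto
  finally show ?thesis .
qed

lemma pn_Suc_left: "pn (Suc n) x y = T (\<lambda>z. pn n z y) x"
  by (simp add: pn_def[abs_def])

text \<open>Decomposition by the last step. Summing over the successors of \<open>y\<close> is
  correct because \<open>q_sym\<close> makes every predecessor of \<open>y\<close> a
  successor.\<close>

lemma pn_Suc_right: "pn (Suc n) x y = (\<Sum>z | step y z. pn n x z * q z y)"
proof -
  have "T (ind y) = (\<lambda>u. \<Sum>z | step y z. q z y * ind z u)"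
  proof
    fix u
    have "(\<Sum>z | step y z. q z y * ind z u) = (\<Sum>z | step y z. if z = u then q z y else 0)"
      by (intro sum.cong) (auto simp: ind_def)
    also have "\<dots> = q u y" using q_nonneg[of u y] q_sym[of u y] by (cases "q u y = 0") auto
    finally show "T (ind y) u = (\<Sum>z | step y z. q z y * ind z u)" by (simp add: T_ind)
  qed
  then show ?thesis
    unfolding pn_def funpow_Suc_right o_apply by (simp add: Tn_sum Tn_cmult mult.commute[of _ "q _ y"])
qed

lemma pn_ge_path: "(step ^^ n) x y \<Longrightarrow> eps ^ n \<le> pn n x y"
  unfolding pn_def using Tn_ge_path[of UNIV "ind y" x n y] by simp

lemma pn_path_left: "(step ^^ k) x z \<Longrightarrow> eps ^ k * pn n z y \<le> pn (k + n) x y"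
  unfolding pn_def funpow_add o_apply
  using Tn_ge_path[of UNIV "(T ^^ n) (ind y)" x k z] pn_nonneg[of n _ y] by (simp add: pn_def)

lemma pn_path_right: "(step ^^ k) z y \<Longrightarrow> eps ^ k * pn n x z \<le> pn (n + k) x y"
proof (induction k arbitrary: y)
  case (Suc k)
  then obtain u where u: "(step ^^ k) z u" "step u y" by (auto elim: relpowp_Suc_E)
  have "eps ^ Suc k * pn n x z \<le> eps * pn (n + k) x u"
    using Suc.IH[OF u(1)] eps by (simp add: mult.assoc)
  also have "\<dots> \<le> pn (n + k) x u * q u y"
    using eps(3)[OF u(2)] by (subst mult.commute) (intro mult_left_mono, auto)
  also have "\<dots> \<le> pn (n + Suc k) x y"
    unfolding add_Suc_right pn_Suc_right
    by (rule member_le_sum) (use u q_sym q_nonneg in auto)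
  finally show ?case .
qed simp

lemma pn_pos_path: "pn n x y > 0 \<Longrightarrow> (step ^^ n) x y"
proof (induction n arbitrary: x)
  case (Suc n)
  have "\<exists>z. step x z \<and> pn n z y > 0"
  proof (rule ccontr)
    assume "\<not> ?thesis"
    then have "T (\<lambda>z. pn n z y) x \<le> T (\<lambda>z. 0) x" by (intro T_mono) (use not_less in blast)
    then show False using Suc.prems by (simp add: pn_Suc_left)
  qed
  then show ?case using Suc.IH relpowp_Suc_I2 by metis
qed (auto simp: ind_def split: if_splits)

section \<open>Words accessible from the empty word\<close>

definition lang :: "'a list set" where
  "lang = {x. step\<^sup>*\<^sup>* [] x}"

lemma Nil_lang [simp]: "[] \<in> lang"
  by (simp add: lang_def)

lemma closed_lang: "step_closed lang"
  unfolding step_closed_def lang_def by (auto intro: rtranclp.rtrancl_into_rtrancl)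

lemma lang_step: "x \<in> lang \<Longrightarrow> step x y \<Longrightarrow> y \<in> lang"
  using closed_lang step_closedD by blast

lemma lang_path: "x \<in> lang \<Longrightarrow> (step ^^ n) x y \<Longrightarrow> y \<in> lang"
  unfolding lang_def using relpowp_imp_rtranclp rtranclp_trans by (metis mem_Collect_eq)

lemma lang_obtain_path:
  assumes "x \<in> lang" obtains n where "(step ^^ n) [] x" "(step ^^ n) x []"
proof -
  have "step\<^sup>*\<^sup>* [] x" using assms by (simp add: lang_def)
  then obtain n where "(step ^^ n) [] x" by (blast dest: rtranclp_imp_relpowp)
  then show ?thesis using that step_pow_sym[of n "[]" x] by simp
qed

lemma pn_not_lang: "y \<notin> lang \<Longrightarrow> pn n [] y = 0"
  using pn_pos_path[of n "[]" y] lang_path[OF Nil_lang] pn_nonneg[of n "[]" y] by (metis order_le_less)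

lemma path_length: "(step ^^ n) x y \<Longrightarrow> length y \<le> length x + n"
proof (induction n arbitrary: y)
  case (Suc n)
  then obtain u where u: "(step ^^ n) x u" "step u y" by (auto elim: relpowp_Suc_E)
  then show ?case using Suc.IH[OF u(1)] step_length[OF u(2)] by simp
qed simp

text \<open>One step adds at most one letter, so after \<open>n\<close> steps only finitely many
  words carry mass.\<close>

lemma Tn_expand: "(T ^^ n) \<phi> x = (\<Sum>y | length y \<le> length x + n. pn n x y * \<phi> y)"
proof -
  define A where "A = {y :: 'a list. length y \<le> length x + n}"
  have "finite A" unfolding A_def by (rule finite_length_le)
  have "(T ^^ n) \<phi> x = (T ^^ n) (\<lambda>u. \<Sum>y\<in>A. \<phi> y * ind y u) x"
  proof -
    have "(T ^^ n) \<phi> x = (T ^^ n) \<psi> x"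
      if "\<And>y. length y \<le> length x + n \<Longrightarrow> \<phi> y = \<psi> y" for \<psi>
      using that
    proof (induction n arbitrary: x)
      case (Suc n)
      have "(T ^^ n) \<phi> y = (T ^^ n) \<psi> y" if "step x y" for y
        by (rule Suc.IH) (use Suc.prems step_length[OF that] in auto)
      then show ?case by (auto intro: T_cong)
    qed simp
    moreover have "\<phi> u = (\<Sum>y\<in>A. \<phi> y * ind y u)" if "length u \<le> length x + n" for u
    proof -
      have "(\<Sum>y\<in>A. \<phi> y * ind y u) = (\<Sum>y\<in>A. if y = u then \<phi> y else 0)"
        by (intro sum.cong) (auto simp: ind_def)
      also have "\<dots> = \<phi> u" using that \<open>finite A\<close> by (auto simp: A_def)
      finally show ?thesis by simp
    qed
    ultimately show ?thesis by this
  qed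
  then show ?thesis by (simp add: Tn_sum Tn_cmult pn_def A_def mult.commute)
qed

end

section \<open>Escape from cones\<close>

lemma finite_uniform_bound:
  assumes "finite A" "\<And>x. x \<in> A \<Longrightarrow> \<exists>n :: nat. P x n"
  shows "\<exists>N. \<forall>x\<in>A. \<exists>n\<le>N. P x n"
  using assms
proof (induction A)
  case (insert x A)
  then obtain N where N: "\<forall>x\<in>A. \<exists>n\<le>N. P x n" by auto
  obtain m where m: "P x m" using insert.prems by auto
  show ?case
  proof (rule exI[of _ "max N m"], rule ballI)
    fix y assume "y \<in> insert x A"
    then show "\<exists>n\<le>max N m. P y n"
      using N m by (metis insertE max.coboundedI1 max.cobounded2)
  qed
qed simp

lemma length_2_conv: "length u = 2 \<longleftrightarrow> (\<exists>c d. u = [c, d])"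
  by (auto simp: length_Suc_conv numeral_2_eq_2)

lemma split_last_two:
  assumes "2 \<le> length w" obtains v c d where "w = v @ [c, d]"
proof -
  have "length (drop (length w - 2) w) = 2" using assms by simp
  then obtain c d where "drop (length w - 2) w = [c, d]"
    unfolding length_2_conv by blast
  then show ?thesis using that[of "take (length w - 2) w"] by (metis append_take_drop_id)
qed

section \<open>Cones and the words in them\<close>

context word_kernel
begin

lemma Tn_Tn: "(T ^^ m) ((T ^^ k) \<phi>) = (T ^^ (m + k)) \<phi>"
  by (simp add: funpow_add)

text \<open>As both words keep at least two letters, a path of such steps can be carried out behind
  every prefix \<open>W\<close> without touching it.\<close>

definition cstep :: "'a list \<Rightarrow> 'a list \<Rightarrow> bool" where
  "cstep x y \<longleftrightarrow> step x y \<and> 2 \<le> length x \<and> 2 \<le> length y"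

lemma cpath_shift: "(cstep ^^ n) x y \<Longrightarrow> (step ^^ n) (W @ x) (W @ y)"
proof (induction n arbitrary: y)
  case (Suc n)
  then obtain z where z: "(cstep ^^ n) x z" "cstep z y" by (auto elim: relpowp_Suc_E)
  then have "step (W @ z) (W @ y)" using q_shift by (simp add: cstep_def)
  then show ?case using Suc.IH[OF z(1)] by (auto intro: relpowp_Suc_I)
qed simp

lemma creach_shift: "cstep\<^sup>*\<^sup>* x y \<Longrightarrow> cstep\<^sup>*\<^sup>* (W @ x) (W @ y)"
proof (induction rule: rtranclp_induct)
  case (step y z)
  have "cstep (W @ y) (W @ z)" using step.hyps(2) q_shift by (simp add: cstep_def)
  with step.IH show ?case by simp
qed simp

lemma lang_cpath: "W @ x \<in> lang \<Longrightarrow> cstep\<^sup>*\<^sup>* x y \<Longrightarrow> W @ y \<in> lang"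
  using lang_path cpath_shift rtranclp_imp_relpowp by metis

text \<open>An arbitrary letter, doubled. By suffix-irreducibility every two-letter suffix leads to
  it, so one cone type serves as reference for all.\<close>

definition base :: "'a list" where
  "base = [undefined, undefined]"

lemma length_base [simp]: "length base = 2"
  by (simp add: base_def)

text \<open>The words \<open>W @ V\<close> with \<open>V\<close> in this set are those reachable
  from \<open>W @ base\<close> inside the cone behind \<open>W\<close>. The set does not involve
  \<open>W\<close>, which makes cones with different prefixes comparable.\<close>

definition cone_words :: "'a list set" where
  "cone_words = {V. cstep\<^sup>*\<^sup>* base V}"

lemma cone_words_length: "V \<in> cone_words \<Longrightarrow> 2 \<le> length V"
  unfolding cone_words_def by (auto elim: rtranclp.cases simp: cstep_def)

lemma base_cone_words [simp]: "base \<in> cone_words"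
  by (simp add: cone_words_def)

lemma cone_words_lang: "W @ base \<in> lang \<Longrightarrow> V \<in> cone_words \<Longrightarrow> W @ V \<in> lang"
  unfolding cone_words_def using lang_cpath by blast

lemma cone_words_step:
  assumes "V \<in> cone_words" "2 < length V" "step V U"
  shows "U \<in> cone_words"
proof -
  have "cstep V U" using assms step_length[of V U] by (auto simp: cstep_def)
  then show ?thesis using assms(1) by (auto simp: cone_words_def)
qed

section \<open>Probability of reaching a short word\<close>

definition short :: "'a list \<Rightarrow> real" where
  "short V = (if length V \<le> 2 then 1 else 0)"

text \<open>The probability of reaching a word of at most two letters within \<open>n\<close> steps;
  the recursion stops at the first such word.\<close>

primrec hit :: "nat \<Rightarrow> 'a list \<Rightarrow> real" where
  "hit 0 = short"
| "hit (Suc n) = (\<lambda>V. if length V \<le> 2 then 1 else T (hit n) V)"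

lemma hit_bounds: "0 \<le> hit n V \<and> hit n V \<le> 1"
proof (induction n arbitrary: V)
  case (Suc n)
  show ?case using T_mono[of V "\<lambda>_. 0" "hit n"] T_mono[of V "hit n" "\<lambda>_. 1"] Suc by simp
qed (simp add: short_def)

lemma hit_mono: "incseq (\<lambda>n. hit n V)"
proof (rule incseq_SucI)
  show "hit n V \<le> hit (Suc n) V" for n
  proof (induction n arbitrary: V)
    case 0
    then show ?case using T_mono[of V "\<lambda>_. 0" "hit 0"] hit_bounds[of 0] by (auto simp: short_def)
  next
    case (Suc n)
    show ?case using T_mono[of V, OF Suc.IH] by simp
  qed
qed

definition hitp :: "'a list \<Rightarrow> real" where
  "hitp V = (SUP n. hit n V)"

lemma hit_LIMSEQ: "(\<lambda>n. hit n V) \<longlonglongrightarrow> hitp V"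
  unfolding hitp_def
  by (rule LIMSEQ_incseq_SUP) (use hit_bounds hit_mono in \<open>auto intro!: bdd_aboveI[of _ 1]\<close>)

lemma hit_le_hitp: "hit n V \<le> hitp V"
  by (rule incseq_le[OF hit_mono hit_LIMSEQ])

lemma hitp_bounds: "0 \<le> hitp V" "hitp V \<le> 1"
  using hit_le_hitp[of 0 V] hit_bounds[of 0 V] LIMSEQ_le_const2[OF hit_LIMSEQ, of V 1] hit_bounds
  by force+

lemma hitp_short: "length V \<le> 2 \<Longrightarrow> hitp V = 1"
  using hit_le_hitp[of 0 V] hitp_bounds[of V] by (simp add: short_def)

lemma hitp_harmonic: "2 < length V \<Longrightarrow> T hitp V = hitp V"
proof -
  assume "2 < length V"
  then have "(\<lambda>n. T (hit n) V) \<longlonglongrightarrow> hitp V"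
    using LIMSEQ_Suc[OF hit_LIMSEQ[of V]] by simp
  then show ?thesis using T_tendsto[of V hit hitp] hit_LIMSEQ LIMSEQ_unique by blast
qed

text \<open>Until the suffix started at \<open>V\<close> has shrunk to two letters, both walks move
  alike, so \<open>W @ V\<close> cannot become short any earlier.\<close>

lemma hitp_append:
  assumes "2 \<le> length V" shows "hitp (W @ V) \<le> hitp V"
proof -
  have "hit n (W @ V) \<le> hit n V" for n
    using assms
  proof (induction n arbitrary: V)
    case 0
    then show ?case by (auto simp: short_def)
  next
    case (Suc n)
    show ?case
    proof (cases "length V = 2")
      case True
      then show ?thesis using hit_bounds[of "Suc n" "W @ V"] by simp
    next
      case False
      then have *: "2 < length V" using Suc by simp
      have "T (hit n) (W @ V) = T (\<lambda>U. hit n (W @ U)) V" using * by (intro T_shift) simp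
      also have "\<dots> \<le> T (hit n) V"
        by (rule T_mono, rule Suc.IH) (use * step_length in force)
      finally show ?thesis using * by simp
    qed
  qed
  then show ?thesis by (intro LIMSEQ_le[OF hit_LIMSEQ hit_LIMSEQ]) auto
qed

lemma hit_le_sum: "hit n V \<le> (\<Sum>k\<le>n. (T ^^ k) short V)"
proof (induction n arbitrary: V)
  case (Suc n)
  have nn: "0 \<le> (T ^^ k) short V" for k V
    by (rule Tn_nonneg[of UNIV]) (auto simp: short_def)
  have eq: "(\<Sum>k\<le>Suc n. (T ^^ k) short V) = short V + T (\<lambda>U. \<Sum>k\<le>n. (T ^^ k) short U) V"
    by (simp add: sum.atMost_Suc_shift T_sum del: sum.atMost_Suc)
  show ?case
  proof (cases "length V \<le> 2")
    case True
    then show ?thesis unfolding eq using T_mono[of V "\<lambda>_. 0" "\<lambda>U. \<Sum>k\<le>n. (T ^^ k) short U"] nn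
      by (simp add: short_def sum_nonneg)
  next
    case False
    have "T (hit n) V \<le> T (\<lambda>U. \<Sum>k\<le>n. (T ^^ k) short U) V"
      by (rule T_mono, rule Suc.IH)
    then show ?thesis unfolding eq using False by (simp add: short_def)
  qed
qed simp

text \<open>The function \<open>1 - hitp\<close> is at most \<open>1 - \<eta>\<close> and harmonic off the short words, hence at most
  \<open>(1 - \<eta>)\<close> times itself.\<close>

lemma hitp_zero_one:
  assumes "step_closed S" "0 < \<eta>" "\<And>V. V \<in> S \<Longrightarrow> \<eta> \<le> hitp V" "V \<in> S"
  shows "hitp V = 1"
proof -
  have "1 - hitp V \<le> (1 - \<eta>) * (1 - hit n V)" for n
    using assms(4)
  proof (induction n arbitrary: V)
    case 0
    then show ?case using assms(3)[of V] hitp_short[of V] by (auto simp: short_def)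
  next
    case (Suc n)
    show ?case
    proof (cases "length V \<le> 2")
      case True
      then show ?thesis using hitp_short[of V] by simp
    next
      case False
      have "T (\<lambda>U. 1 - hitp U) V \<le> T (\<lambda>U. (1 - \<eta>) * (1 - hit n U)) V"
        by (rule T_mono, rule Suc.IH) (rule step_closedD[OF assms(1) Suc.prems])
      then show ?thesis using False hitp_harmonic[of V] by (simp add: T_diff T_cmult)
    qed
  qed
  then have "1 - hitp V \<le> (1 - \<eta>) * (1 - hitp V)"
    by (intro LIMSEQ_le_const[OF tendsto_mult_left[OF tendsto_diff[OF tendsto_const hit_LIMSEQ]]]) auto
  then have "\<eta> * (1 - hitp V) \<le> 0" by (simp add: algebra_simps)
  then have "1 \<le> hitp V" using assms(2) by (simp add: mult_le_0_iff)
  then show ?thesis using hitp_bounds[of V] by simp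
qed

end

text \<open>\<open>green_Nil\<close> expresses transience as a finite expected number of visits to
  the empty word. The conclusion of \<open>suffix_irr\<close> does not mention \<open>w\<close>
  because the path never touches that prefix.\<close>

locale transient_kernel = word_kernel +
  assumes green_Nil: "summable (\<lambda>n. pn n [] [])"
    and suffix_irr: "w @ [c, d] \<in> lang \<Longrightarrow> \<exists>w'. cstep\<^sup>*\<^sup>* [c, d] (w' @ [a, b])"
begin

text \<open>Extending paths from \<open>x\<close> to \<open>y\<close> by fixed paths from
  \<open>[]\<close> to \<open>x\<close> and from \<open>y\<close> to \<open>[]\<close> costs a
  constant factor and reduces the claim to \<open>green_Nil\<close>.\<close>

lemma pn_summable:
  assumes "x \<in> lang" "y \<in> lang" shows "summable (\<lambda>n. pn n x y)"
proof -
  obtain i where i: "(step ^^ i) [] x" using lang_obtain_path[OF assms(1)] by blast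
  obtain j where j: "(step ^^ j) y []" using lang_obtain_path[OF assms(2)] by blast
  have "pn n x y \<le> (1 / (eps ^ i * eps ^ j)) * pn (n + (i + j)) [] []" for n
  proof -
    have "eps ^ i * (eps ^ j * pn n x y) \<le> eps ^ i * pn (n + j) x []"
      using pn_path_right[OF j, of n x] eps_power(1)[of i] by simp
    also have "\<dots> \<le> pn (i + (n + j)) [] []" by (rule pn_path_left[OF i])
    finally show ?thesis using eps_power(1)[of i] eps_power(1)[of j]
      by (simp add: field_simps add.assoc add.left_commute)
  qed
  then have *: "norm (pn n x y) \<le> (1 / (eps ^ i * eps ^ j)) * pn (n + (i + j)) [] []" for n
    by simp
  have "summable (\<lambda>n. (1 / (eps ^ i * eps ^ j)) * pn (n + (i + j)) [] [])"
    using summable_mult[OF summable_ignore_initial_segment[OF green_Nil]] .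
  then show ?thesis by (rule summable_comparison_test'[where N = 0]) (rule *)
qed

lemma short_summable: "summable (\<lambda>n. (T ^^ n) short [])"
proof -
  define A where "A = {a :: 'a list. length a \<le> 2}"
  have fin: "finite A" unfolding A_def by (rule finite_length_le)
  have short_eq: "short = (\<lambda>V. \<Sum>a\<in>A. ind a V)"
  proof
    fix V :: "'a list"
    have "(\<Sum>a\<in>A. ind a V) = (\<Sum>a\<in>A. if a = V then 1 else 0)"
      by (intro sum.cong) (auto simp: ind_def)
    then show "short V = (\<Sum>a\<in>A. ind a V)" using fin by (simp add: short_def A_def)
  qed
  have "(T ^^ n) short [] = (\<Sum>a\<in>A. pn n [] a)" for n
    unfolding short_eq Tn_sum pn_def ..
  moreover have "summable (\<lambda>n. pn n [] a)" for a
    using pn_summable[OF Nil_lang, of a] pn_not_lang[of a] by (cases "a \<in> lang") auto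
  ultimately show ?thesis by (auto intro: summable_sum)
qed

text \<open>If all accessible words were short, the walk would be at a short word at every time,
  against \<open>short_summable\<close>.\<close>

lemma exists_long: "\<exists>w\<in>lang. 2 < length w"
proof (rule ccontr)
  assume "\<not> ?thesis"
  then have "(T ^^ n) short [] = (T ^^ n) (\<lambda>_. 1) []" for n
    by (intro Tn_cong[OF closed_lang]) (auto simp: short_def not_less)
  then have "(\<lambda>n. 1 :: real) \<longlonglongrightarrow> 0" using summable_LIMSEQ_zero[OF short_summable] by simp
  then show False using LIMSEQ_unique[OF _ tendsto_const[of "1 :: real"]] by fastforce
qed

lemma reach_base_long:
  assumes "w @ [c, d] \<in> lang"
  obtains w' where "cstep\<^sup>*\<^sup>* [c, d] (w' @ base)" "w @ w' @ base \<in> lang"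
proof -
  obtain w' where w': "cstep\<^sup>*\<^sup>* [c, d] (w' @ base)"
    using suffix_irr[OF assms] unfolding base_def by blast
  then show ?thesis using that[OF w'] lang_cpath[OF assms w'] by simp
qed

lemma exists_base: "\<exists>W. W @ base \<in> lang"
proof -
  obtain w where "w \<in> lang" "2 \<le> length w" using exists_long by fastforce
  then show ?thesis using split_last_two[of w] reach_base_long by (metis append.assoc)
qed

text \<open>The path provided by suffix-irreducibility depends only on the last two letters, for
  which there are finitely many choices; words of at most one letter are finite in number.\<close>

lemma reach_base: "\<exists>s. \<forall>w\<in>lang. \<exists>n\<le>s. \<exists>W. W @ base \<in> lang \<and> (step ^^ n) w (W @ base)"
proof -
  define P where "P w n \<longleftrightarrow> (w \<in> lang \<longrightarrow> (\<exists>W. W @ base \<in> lang \<and> (step ^^ n) w (W @ base)))" for w n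
  have "\<exists>n. \<forall>w. P (w @ u) n" if "length u = 2" for u
  proof (cases "\<exists>w. w @ u \<in> lang")
    case True
    then obtain w0 where w0: "w0 @ u \<in> lang" by blast
    obtain c d where u: "u = [c, d]" using \<open>length u = 2\<close> unfolding length_2_conv by blast
    obtain w' where w': "cstep\<^sup>*\<^sup>* u (w' @ base)" using reach_base_long[of w0 c d] w0 u by blast
    then obtain n where n: "(cstep ^^ n) u (w' @ base)" using rtranclp_imp_relpowp by metis
    have "P (w @ u) n" for w
      unfolding P_def using cpath_shift[OF n, of w] lang_path by (metis append.assoc)
    then show ?thesis by blast
  qed (auto simp: P_def)
  moreover have "finite {u :: 'a list. length u = 2}"
    by (rule finite_subset[OF _ finite_length_le[of 2]]) auto
  ultimately have "\<exists>N. \<forall>u\<in>{u. length u = 2}. \<exists>n\<le>N. \<forall>w. P (w @ u) n"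
    by (intro finite_uniform_bound) auto
  then obtain N1 where N1: "\<And>u. length u = 2 \<Longrightarrow> \<exists>n\<le>N1. \<forall>w. P (w @ u) n" by auto
  have "\<exists>n. P w n" for w
  proof (cases "w \<in> lang")
    case True
    obtain W where W: "W @ base \<in> lang" using exists_base by blast
    obtain i where i: "(step ^^ i) w []" using lang_obtain_path[OF True] by blast
    obtain j where j: "(step ^^ j) [] (W @ base)" using lang_obtain_path[OF W] by blast
    have "(step ^^ (i + j)) w (W @ base)" using i j unfolding relpowp_add by blast
    then show ?thesis using W unfolding P_def by blast
  qed (auto simp: P_def)
  then have "\<exists>N. \<forall>w\<in>{w. length w \<le> 1}. \<exists>n\<le>N. P w n"
    by (intro finite_uniform_bound finite_length_le) auto
  then obtain N2 where N2: "\<And>w. length w \<le> 1 \<Longrightarrow> \<exists>n\<le>N2. P w n" by auto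
  show ?thesis
  proof (rule exI[of _ "max N1 N2"], rule ballI)
    fix w assume "w \<in> lang"
    have "\<exists>n\<le>max N1 N2. P w n"
    proof (cases "length w \<le> 1")
      case True
      then show ?thesis using N2[OF True] by (meson max.coboundedI2)
    next
      case False
      then have "2 \<le> length w" by simp
      then obtain v c d where "w = v @ [c, d]" by (rule split_last_two)
      then show ?thesis using N1[of "[c, d]"] by (metis length_Cons list.size(3) max.coboundedI1 numeral_2_eq_2)
    qed
    then show "\<exists>n\<le>max N1 N2. \<exists>W. W @ base \<in> lang \<and> (step ^^ n) w (W @ base)"
      using \<open>w \<in> lang\<close> unfolding P_def by blast
  qed
qed

text \<open>There are finitely many two-letter words, and a path to one of them can be moved behind
  any prefix and reversed.\<close>

lemma cone_words_short_path: "\<exists>k. \<forall>V\<in>cone_words. length V = 2 \<longrightarrow>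
    (\<exists>n\<le>k. \<forall>W. (step ^^ n) (W @ base) (W @ V) \<and> (step ^^ n) (W @ V) (W @ base))"
proof -
  have "\<exists>n. (cstep ^^ n) base V" if "V \<in> cone_words" for V
    using that rtranclp_imp_relpowp unfolding cone_words_def by (metis mem_Collect_eq)
  moreover have "finite {V \<in> cone_words. length V = 2}"
    by (rule finite_subset[OF _ finite_length_le[of 2]]) auto
  ultimately have "\<exists>N. \<forall>V\<in>{V \<in> cone_words. length V = 2}. \<exists>n\<le>N. (cstep ^^ n) base V"
    by (intro finite_uniform_bound) auto
  then obtain N where "\<forall>V\<in>{V \<in> cone_words. length V = 2}. \<exists>n\<le>N. (cstep ^^ n) base V" by blast
  then show ?thesis using cpath_shift step_pow_sym
    by (intro exI[of _ N]) (metis (mono_tags, lifting) mem_Collect_eq)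
qed

text \<open>Lengths change by at most one per step, so a path from the empty word to a long word has
  a last visit to length two; from then on it stays inside a cone.\<close>

lemma lang_from_short: "x \<in> lang \<Longrightarrow> 2 < length x \<Longrightarrow> \<exists>c d. [c, d] \<in> lang \<and> cstep\<^sup>*\<^sup>* [c, d] x"
proof -
  assume x: "x \<in> lang" "2 < length x"
  have "x \<in> lang \<and> (2 < length x \<longrightarrow> (\<exists>c d. [c, d] \<in> lang \<and> cstep\<^sup>*\<^sup>* [c, d] x))"
    using x(1)[unfolded lang_def mem_Collect_eq]
  proof (induction rule: rtranclp_induct)
    case (step y z)
    have z: "z \<in> lang" using step.IH step.hyps(2) lang_step by blast
    have "\<exists>c d. [c, d] \<in> lang \<and> cstep\<^sup>*\<^sup>* [c, d] z" if "2 < length z"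
    proof -
      have len: "2 \<le> length y" using step_length[OF step.hyps(2)] that by simp
      then have yz: "cstep y z" using step.hyps(2) that by (simp add: cstep_def)
      show ?thesis
      proof (cases "length y = 2")
        case True
        then obtain c d where "y = [c, d]" unfolding length_2_conv by blast
        then show ?thesis using yz step.IH by blast
      next
        case False
        then show ?thesis using len step.IH yz by (metis le_neq_implies_less rtranclp.rtrancl_into_rtrancl)
      qed
    qed
    then show ?case using z by blast
  qed simp
  then show ?thesis using x by blast
qed

text \<open>If short words were reached almost surely from everywhere, a visit after any time
  \<open>m\<close> would be certain; but by summability the expected number of visits from a
  suitable time \<open>m\<close> on is below 1/2.\<close>

lemma hitp_not_one: "\<exists>V\<in>lang. hitp V < 1"
proof (rule ccontr)
  assume "\<not> ?thesis"
  then have one: "hitp V = 1" if "V \<in> lang" for V using that hitp_bounds(2)[of V] by force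
  define a where "a k = (T ^^ k) short []" for k
  have nn: "0 \<le> a k" for k unfolding a_def by (rule Tn_nonneg[of UNIV]) (auto simp: short_def)
  have sa: "summable a" unfolding a_def by (rule short_summable)
  then obtain m where m: "(\<Sum>k. a (k + m)) < 1 / 2"
    using suminf_exist_split[of "1/2" a] by (metis abs_of_nonneg half_gt_zero_iff
        nn order_refl real_norm_def suminf_nonneg summable_ignore_initial_segment zero_less_one)
  have "(T ^^ m) (hit n) [] \<le> 1 / 2" for n
  proof -
    have "(T ^^ m) (hit n) [] \<le> (T ^^ m) (\<lambda>V. \<Sum>k\<le>n. (T ^^ k) short V) []"
      by (rule Tn_mono[OF step_closed_UNIV]) (auto intro: hit_le_sum)
    also have "\<dots> = (\<Sum>k\<le>n. a (k + m))"
      unfolding Tn_sum a_def Tn_Tn by (simp add: add.commute)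
    also have "\<dots> \<le> (\<Sum>k. a (k + m))"
      by (intro sum_le_suminf summable_ignore_initial_segment sa) (auto simp: nn)
    finally show ?thesis using m by simp
  qed
  then have "(T ^^ m) hitp [] \<le> 1 / 2"
    by (intro LIMSEQ_le_const2[OF Tn_tendsto[of hit, OF hit_LIMSEQ]]) auto
  moreover have "(T ^^ m) hitp [] = (T ^^ m) (\<lambda>_. 1) []"
    by (rule Tn_cong[OF closed_lang]) (auto simp: one)
  ultimately show False by simp
qed

text \<open>A long accessible word \<open>V\<close> can be put behind a prefix \<open>w\<close> such
  that \<open>w @ V\<close> is a cone word, and \<open>hitp (w @ V) \<le> hitp V\<close>. A positive
  lower bound on cone words would thus extend to \<open>lang\<close> and force \<open>hitp\<close>
  to be 1 there.\<close>

lemma exists_escaping: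
  assumes "0 < \<eta>" shows "\<exists>v\<in>cone_words. hitp v < \<eta>"
proof (rule ccontr)
  assume "\<not> ?thesis"
  then have bad: "\<eta> \<le> hitp v" if "v \<in> cone_words" for v using that by force
  have "\<eta> \<le> hitp V" if "V \<in> lang" for V
  proof (cases "length V \<le> 2")
    case True
    then show ?thesis using bad[of base] hitp_bounds(2)[of base] hitp_short[of V] by simp
  next
    case False
    then obtain c d where cd: "[c, d] \<in> lang" "cstep\<^sup>*\<^sup>* [c, d] V" using lang_from_short[OF \<open>V \<in> lang\<close>] by auto
    obtain W where "W @ base \<in> lang" using exists_base by blast
    then obtain w where "cstep\<^sup>*\<^sup>* base (w @ [c, d])" unfolding base_def using suffix_irr by blast
    then have "w @ V \<in> cone_words" using creach_shift[OF cd(2), of w] unfolding cone_words_def by simp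
    then show ?thesis using bad hitp_append[of V w] False by fastforce
  qed
  then have "hitp V = 1" if "V \<in> lang" for V using hitp_zero_one[OF closed_lang assms _ that] by blast
  then show False using hitp_not_one by force
qed

end

section \<open>Green's function\<close>

lemma suminf_shift_le:
  fixes f :: "nat \<Rightarrow> real"
  assumes "summable f" "\<And>n. 0 \<le> f n"
  shows "(\<Sum>n. f (n + k)) \<le> suminf f"
  using suminf_split_initial_segment[OF assms(1), of k] assms(2) by (simp add: sum_nonneg)

lemma sqrt_le_tangent:
  assumes "0 < r" "0 \<le> y" shows "sqrt y \<le> sqrt r / 2 + y / (2 * sqrt r)"
proof -
  have "0 \<le> (sqrt r - sqrt y)\<^sup>2" by simp
  then have "2 * sqrt r * sqrt y \<le> r + y" using assms by (simp add: power2_diff)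
  then show ?thesis using assms by (simp add: field_simps)
qed

text \<open>The gap between the tangent at \<open>r\<close> and the root is
  \<open>(sqrt r - sqrt y)\<^sup>2 / (2 * sqrt r)\<close>, and
  \<open>sqrt y \<le> sqrt r / 2\<close> makes it at least \<open>sqrt r / 8\<close>.\<close>

lemma sqrt_le_tangent_quarter:
  assumes "0 < r" "0 \<le> y" "y \<le> r / 4"
  shows "sqrt y \<le> sqrt r / 2 + y / (2 * sqrt r) - sqrt r / 8"
proof -
  have "sqrt y \<le> sqrt (r / 4)" using assms by (intro real_sqrt_le_mono) auto
  then have "sqrt y \<le> sqrt r / 2" by (simp add: real_sqrt_divide)
  then have "(sqrt r / 2)\<^sup>2 \<le> (sqrt r - sqrt y)\<^sup>2" using assms by (intro power_mono) auto
  then have *: "2 * sqrt r * sqrt y \<le> r + y - r / 4" using assms by (simp add: power2_diff power_divide)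
  define t where "t = sqrt r"
  have t: "r = t * t" "0 < t" using assms by (auto simp: t_def)
  have "2 * t * sqrt y \<le> t * t + y - t * t / 4" using * unfolding t_def[symmetric] t(1)[symmetric] .
  then have "sqrt y \<le> t / 2 + y / (2 * t) - t / 8" using t(2) by (simp add: field_simps)
  then show ?thesis by (simp add: t_def)
qed

context word_kernel
begin

lemma Tn_contract:
  assumes "\<And>x. x \<in> lang \<Longrightarrow> T \<phi> x \<le> \<rho> * \<phi> x" "0 \<le> \<rho>" "x \<in> lang"
  shows "(T ^^ n) \<phi> x \<le> \<rho> ^ n * \<phi> x"
  using assms(3)
proof (induction n arbitrary: x)
  case (Suc n)
  have "(T ^^ Suc n) \<phi> x \<le> T (\<lambda>y. \<rho> ^ n * \<phi> y) x"
    unfolding funpow.simps o_apply by (rule T_mono, rule Suc.IH, rule lang_step[OF Suc.prems])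
  also have "\<dots> \<le> \<rho> ^ n * (\<rho> * \<phi> x)"
    unfolding T_cmult using assms(1)[OF Suc.prems] assms(2) by (intro mult_left_mono) auto
  finally show ?case by (simp add: mult_ac)
qed simp

lemma Tn_superharmonic:
  assumes "\<And>x. x \<in> lang \<Longrightarrow> T \<phi> x \<le> \<phi> x" "x \<in> lang" "m \<le> n"
  shows "(T ^^ n) \<phi> x \<le> (T ^^ m) \<phi> x"
proof -
  have "(T ^^ n) \<phi> x = (T ^^ m) ((T ^^ (n - m)) \<phi>) x" using assms(3) by (simp add: Tn_Tn)
  also have "\<dots> \<le> (T ^^ m) \<phi> x"
    by (rule Tn_mono[OF closed_lang _ assms(2)]) (use Tn_contract[of \<phi> 1] assms(1) in auto)
  finally show ?thesis .
qed

text \<open>With \<open>\<tau>\<close> the hitting time of the words of length at most two, \<open>delay n V\<close> is the mean of \<open>\<tau>\<close>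
  on the event \<open>\<tau> \<le> n\<close>, and \<open>kill \<phi> n V\<close> is the mean of \<open>\<phi>\<close> at time \<open>n\<close> on the event \<open>\<tau> > n\<close>.\<close>

primrec delay :: "nat \<Rightarrow> 'a list \<Rightarrow> real" where
  "delay 0 = (\<lambda>V. 0)"
| "delay (Suc n) = (\<lambda>V. if length V \<le> 2 then 0 else T (\<lambda>U. hit n U + delay n U) V)"

primrec kill :: "('a list \<Rightarrow> real) \<Rightarrow> nat \<Rightarrow> 'a list \<Rightarrow> real" where
  "kill \<phi> 0 = (\<lambda>V. if length V \<le> 2 then 0 else \<phi> V)"
| "kill \<phi> (Suc n) = (\<lambda>V. if length V \<le> 2 then 0 else T (kill \<phi> n) V)"

lemma kill_add: "kill (\<lambda>U. \<phi> U + \<psi> U) n V = kill \<phi> n V + kill \<psi> n V"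
proof (induction n arbitrary: V)
  case (Suc n)
  then have "kill (\<lambda>U. \<phi> U + \<psi> U) n = (\<lambda>V. kill \<phi> n V + kill \<psi> n V)" by blast
  then show ?case by (simp add: T_add)
qed simp

lemma kill_const: "kill (\<lambda>U. c) n V = c * (1 - hit n V)"
proof (induction n arbitrary: V)
  case (Suc n)
  then have "kill (\<lambda>U. c) n = (\<lambda>V. c * (1 - hit n V))" by blast
  then show ?case by (simp add: T_cmult T_diff)
qed (simp add: short_def)

lemma kill_abs:
  assumes "V \<in> cone_words" "\<And>U. U \<in> cone_words \<Longrightarrow> \<bar>\<phi> U\<bar> \<le> c"
  shows "\<bar>kill \<phi> n V\<bar> \<le> c * (1 - hit n V)"
  using assms(1)
proof (induction n arbitrary: V)
  case 0
  then show ?case using assms(2) by (simp add: short_def)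
next
  case (Suc n)
  show ?case
  proof (cases "length V \<le> 2")
    case False
    have "\<bar>T (kill \<phi> n) V\<bar> \<le> T (\<lambda>U. \<bar>kill \<phi> n U\<bar>) V" by (rule T_abs)
    also have "\<dots> \<le> T (\<lambda>U. c * (1 - hit n U)) V"
      by (rule T_mono, rule Suc.IH) (rule cone_words_step[OF Suc.prems], use False in auto)
    finally show ?thesis using False by (simp add: T_cmult T_diff)
  qed (use hit_bounds[of "Suc n" V] in simp)
qed

text \<open>The value is meaningful where the series converges, in particular between accessible
  words of a transient kernel.\<close>

definition green :: "'a list \<Rightarrow> 'a list \<Rightarrow> real" where
  "green x y = (\<Sum>n. pn n x y)"

end

section \<open>Estimates for the Green function\<close>

context transient_kernel
begin

lemma lang_connected:
  assumes "x \<in> lang" "y \<in> lang" shows "\<exists>n. (step ^^ n) x y"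
proof -
  obtain i where i: "(step ^^ i) x []" using lang_obtain_path[OF assms(1)] by blast
  obtain j where j: "(step ^^ j) [] y" using lang_obtain_path[OF assms(2)] by blast
  have "(step ^^ (i + j)) x y" using i j unfolding relpowp_add by blast
  then show ?thesis by blast
qed

lemma green_partial_le: "x \<in> lang \<Longrightarrow> y \<in> lang \<Longrightarrow> (\<Sum>i<n. pn i x y) \<le> green x y"
  unfolding green_def by (intro sum_le_suminf pn_summable) auto

lemma pn_le_green: "x \<in> lang \<Longrightarrow> y \<in> lang \<Longrightarrow> pn n x y \<le> green x y"
  using member_le_sum[of n "{..<Suc n}" "\<lambda>i. pn i x y"] green_partial_le[of x y "Suc n"] by simp

lemma green_pos: "x \<in> lang \<Longrightarrow> y \<in> lang \<Longrightarrow> 0 < green x y"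
proof -
  assume xy: "x \<in> lang" "y \<in> lang"
  then obtain n where "(step ^^ n) x y" using lang_connected by blast
  then have "eps ^ n \<le> pn n x y" by (rule pn_ge_path)
  then show ?thesis using pn_le_green[OF xy, of n] eps_power(1)[of n] by linarith
qed

lemma green_path_left:
  assumes "(step ^^ k) x z" "x \<in> lang" "y \<in> lang" shows "eps ^ k * green z y \<le> green x y"
proof -
  have z: "z \<in> lang" using lang_path assms by blast
  have "eps ^ k * green z y = (\<Sum>n. eps ^ k * pn n z y)"
    unfolding green_def by (rule suminf_mult[symmetric, OF pn_summable[OF z assms(3)]])
  also have "\<dots> \<le> (\<Sum>n. pn (n + k) x y)"
    using pn_path_left[OF assms(1), of _ y]
    by (intro suminf_le summable_mult pn_summable z assms summable_ignore_initial_segment)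
      (simp add: add.commute)
  also have "\<dots> \<le> green x y" unfolding green_def
    by (intro suminf_shift_le pn_summable assms) simp
  finally show ?thesis .
qed

lemma green_path_right:
  assumes "(step ^^ k) z y" "x \<in> lang" "z \<in> lang" shows "eps ^ k * green x z \<le> green x y"
proof -
  have y: "y \<in> lang" using lang_path assms by blast
  have "eps ^ k * green x z = (\<Sum>n. eps ^ k * pn n x z)"
    unfolding green_def by (rule suminf_mult[symmetric, OF pn_summable[OF assms(2,3)]])
  also have "\<dots> \<le> (\<Sum>n. pn (n + k) x y)"
    using pn_path_right[OF assms(1), of _ x]
    by (intro suminf_le summable_mult pn_summable y assms summable_ignore_initial_segment)
  also have "\<dots> \<le> green x y" unfolding green_def
    by (intro suminf_shift_le pn_summable assms y) simp
  finally show ?thesis .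
qed

lemma green_tail: "x \<in> lang \<Longrightarrow> y \<in> lang \<Longrightarrow> (\<Sum>n. pn (Suc n) x y) = green x y - ind y x"
  using suminf_split_head[OF pn_summable[of x y]] by (simp add: green_def)

lemma green_left:
  assumes "x \<in> lang" "y \<in> lang" shows "T (\<lambda>z. green z y) x = green x y - ind y x"
proof -
  have "(\<lambda>n. \<Sum>z | step x z. q x z * pn n z y) sums (\<Sum>z | step x z. q x z * green z y)"
    unfolding green_def
    by (intro sums_sum sums_mult summable_sums pn_summable assms) (use assms lang_step in auto)
  then show ?thesis
    using green_tail[OF assms] by (simp add: pn_Suc_left T_def sums_iff)
qed

lemma green_right:
  assumes "x \<in> lang" "y \<in> lang" shows "(\<Sum>z | step y z. green x z * q z y) = green x y - ind y x"
proof -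
  have "(\<lambda>n. \<Sum>z | step y z. pn n x z * q z y) sums (\<Sum>z | step y z. green x z * q z y)"
    unfolding green_def
    by (intro sums_sum sums_mult2 summable_sums pn_summable assms) (use assms lang_step in auto)
  then show ?thesis
    using green_tail[OF assms] by (simp add: pn_Suc_right sums_iff)
qed

lemma green_superharmonic: "x \<in> lang \<Longrightarrow> T (\<lambda>z. green z []) x \<le> green x []"
  using green_left[of x "[]"] by simp

text \<open>To reach \<open>[]\<close> from \<open>W @ V\<close> the suffix must first shrink to two
  letters, which has probability at most \<open>hitp V\<close>; there the Green function is
  comparable to its value at \<open>W @ base\<close>. Partial sums are bounded through
  \<open>hit n\<close> before passing to the limit.\<close>

lemma green_cone_decay:
  assumes k: "\<forall>V\<in>cone_words. length V = 2 \<longrightarrow>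
      (\<exists>n\<le>k. \<forall>W. (step ^^ n) (W @ base) (W @ V) \<and> (step ^^ n) (W @ V) (W @ base))"
    and W: "W @ base \<in> lang" and V: "V \<in> cone_words"
  shows "eps ^ k * green (W @ V) [] \<le> hitp V * green (W @ base) []"
proof -
  define S where "S n x = (\<Sum>i<n. pn i x [])" for n x
  have Sle: "S n x \<le> green x []" if "x \<in> lang" for n x
    unfolding S_def by (rule green_partial_le[OF that]) simp
  have "eps ^ k * S n (W @ V) \<le> hit n V * green (W @ base) []" for n
    using V
  proof (induction n arbitrary: V)
    case 0
    then show ?case using hit_bounds[of 0 V] green_pos[OF W Nil_lang]
      by (auto simp: S_def short_def)
  next
    case (Suc n)
    have WV: "W @ V \<in> lang" by (rule cone_words_lang[OF W Suc.prems])
    show ?case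
    proof (cases "length V = 2")
      case True
      then obtain m where m: "m \<le> k" "(step ^^ m) (W @ base) (W @ V)" using k Suc.prems by blast
      have "eps ^ k * S (Suc n) (W @ V) \<le> eps ^ m * green (W @ V) []"
        using Sle[OF WV] eps_power(3)[OF m(1)] eps_power(1)[of m] green_pos[OF WV Nil_lang]
        by (intro mult_mono) (auto simp: S_def sum_nonneg simp del: sum.lessThan_Suc)
      also have "\<dots> \<le> green (W @ base) []" by (rule green_path_left[OF m(2) W Nil_lang])
      finally show ?thesis using True by simp
    next
      case False
      then have len: "2 < length V" using cone_words_length[OF Suc.prems] by simp
      have "S (Suc n) (W @ V) = T (S n) (W @ V)"
        using len by (auto simp add: S_def[abs_def] sum.lessThan_Suc_shift pn_Suc_left T_sum ind_def
            simp del: sum.lessThan_Suc)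
      also have "\<dots> = T (\<lambda>U. S n (W @ U)) V" using len by (intro T_shift) simp
      finally have "eps ^ k * S (Suc n) (W @ V) = T (\<lambda>U. eps ^ k * S n (W @ U)) V"
        by (simp add: T_cmult)
      also have "\<dots> \<le> T (\<lambda>U. green (W @ base) [] * hit n U) V"
        by (rule T_mono, subst mult.commute[of "green _ _"], rule Suc.IH)
          (rule cone_words_step[OF Suc.prems len])
      finally show ?thesis unfolding T_cmult using len by (simp add: mult.commute)
    qed
  qed
  then show ?thesis
    unfolding S_def green_def
    by (intro LIMSEQ_le[OF tendsto_mult_left[OF summable_LIMSEQ[OF pn_summable]]
          tendsto_mult_right[OF hit_LIMSEQ]]) (auto intro: cone_words_lang[OF W V])
qed

text \<open>From every word a bounded path leads to a word at which \<open>green _ []\<close> is four times smaller;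
  as the square root is strictly concave, it turns this superharmonic function into a strictly
  contracted one.\<close>

lemma sqrt_green_contract:
  "\<exists>S \<kappa>. 0 < \<kappa> \<and> \<kappa> < 1 \<and> 0 < S \<and>
    (\<forall>w\<in>lang. (T ^^ S) (\<lambda>x. sqrt (green x [])) w \<le> (1 - \<kappa>) * sqrt (green w []))"
proof -
  define g where "g x = green x []" for x
  have gpos: "0 < g x" if "x \<in> lang" for x unfolding g_def using green_pos that by simp
  have gT: "T g x \<le> g x" if "x \<in> lang" for x
    unfolding g_def using green_superharmonic[OF that] .
  obtain s where s: "\<forall>w\<in>lang. \<exists>n\<le>s. \<exists>W. W @ base \<in> lang \<and> (step ^^ n) w (W @ base)"
    using reach_base by blast
  obtain k where k: "\<forall>V\<in>cone_words. length V = 2 \<longrightarrow>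
      (\<exists>n\<le>k. \<forall>W. (step ^^ n) (W @ base) (W @ V) \<and> (step ^^ n) (W @ V) (W @ base))"
    using cone_words_short_path by blast
  \<comment> \<open>The factor \<open>eps ^ k\<close> makes up for the loss in
    \<open>green_cone_decay\<close> and \<open>eps ^ s\<close> for the path from \<open>w\<close> to
    \<open>W @ base\<close>; the quarter remains.\<close>
  obtain v where v: "v \<in> cone_words" "hitp v < eps ^ (k + s) / 4"
    using exists_escaping[of "eps ^ (k + s) / 4"] eps_power(1)[of "k + s"] by auto
  obtain l where l: "(cstep ^^ l) base v"
    using v(1) rtranclp_imp_relpowp unfolding cone_words_def by (metis mem_Collect_eq)
  \<comment> \<open>A lower bound for the probability of reaching \<open>W @ v\<close>, times the
    gain 1/8 of \<open>sqrt_le_tangent_quarter\<close>.\<close>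
  define \<kappa> where "\<kappa> = eps ^ (s + l) / 8"
  have sT: "T (\<lambda>x. sqrt (g x)) x \<le> sqrt (g x)" if x: "x \<in> lang" for x
  proof -
    have "T (\<lambda>y. sqrt (g y)) x \<le> T (\<lambda>y. sqrt (g x) / 2 + 1 / (2 * sqrt (g x)) * g y) x"
      by (rule T_mono) (use sqrt_le_tangent[OF gpos[OF x]] gpos lang_step[OF x] in \<open>fastforce intro: less_imp_le\<close>)
    also have "\<dots> = sqrt (g x) / 2 + T g x / (2 * sqrt (g x))"
      unfolding T_add T_cmult by simp
    also have "\<dots> \<le> sqrt (g x) / 2 + g x / (2 * sqrt (g x))"
      using gT[OF x] gpos[OF x] by (simp add: divide_right_mono)
    also have "\<dots> = sqrt (g x)" using gpos[OF x] by (simp add: field_simps)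
    finally show ?thesis .
  qed
  \<comment> \<open>The number of steps to \<open>W @ v\<close> varies with \<open>w\<close>;
    superharmonicity permits a common exponent, and the \<open>+ 1\<close> keeps it
    positive.\<close>
  have "(T ^^ (s + l + 1)) (\<lambda>x. sqrt (g x)) w \<le> (1 - \<kappa>) * sqrt (g w)" if w: "w \<in> lang" for w
  proof -
    obtain n W where n: "n \<le> s" "W @ base \<in> lang" "(step ^^ n) w (W @ base)" using s w by blast
    define N where "N = n + l"
    have path: "(step ^^ N) w (W @ v)"
      unfolding N_def relpowp_add using n(3) cpath_shift[OF l] by blast
    have N: "N \<le> s + l" using n N_def by simp
    define r where "r = g w"
    have r: "0 < r" using gpos[OF w] by (simp add: r_def)
    have "eps ^ k * g (W @ v) \<le> hitp v * g (W @ base)"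
      unfolding g_def by (rule green_cone_decay[OF k n(2) v(1)])
    also have "\<dots> \<le> eps ^ (k + s) / 4 * g (W @ base)"
      using v(2) gpos[OF n(2)] by (intro mult_right_mono) auto
    also have "\<dots> = eps ^ k * (eps ^ s * g (W @ base) / 4)" by (simp add: power_add)
    finally have "g (W @ v) \<le> eps ^ s * g (W @ base) / 4" using eps_power(1)[of k] by simp
    also have "\<dots> \<le> eps ^ n * g (W @ base) / 4"
      using eps_power(3)[OF n(1)] gpos[OF n(2)] by simp
    also have "\<dots> \<le> r / 4"
      using green_path_left[OF n(3) w Nil_lang] by (simp add: g_def r_def)
    finally have quarter: "g (W @ v) \<le> r / 4" .
    have "(T ^^ N) (\<lambda>x. sqrt (g x)) w \<le>
        (T ^^ N) (\<lambda>y. (sqrt r / 2 + 1 / (2 * sqrt r) * g y) - sqrt r / 8 * ind (W @ v) y) w"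
    proof (rule Tn_mono[OF closed_lang _ w])
      fix y assume "y \<in> lang"
      then have "0 \<le> g y" using gpos by (simp add: less_imp_le)
      then show "sqrt (g y) \<le> (sqrt r / 2 + 1 / (2 * sqrt r) * g y) - sqrt r / 8 * ind (W @ v) y"
        using sqrt_le_tangent[OF r, of "g y"] sqrt_le_tangent_quarter[OF r, of "g y"] quarter
        by (cases "y = W @ v") auto
    qed
    also have "\<dots> = sqrt r / 2 + 1 / (2 * sqrt r) * (T ^^ N) g w - sqrt r / 8 * pn N w (W @ v)"
      unfolding Tn_diff Tn_add Tn_cmult by (simp add: pn_def)
    also have "\<dots> \<le> sqrt r / 2 + 1 / (2 * sqrt r) * r - sqrt r / 8 * eps ^ (s + l)"
    proof (intro diff_mono add_left_mono mult_left_mono)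
      show "(T ^^ N) g w \<le> r" using Tn_superharmonic[OF gT w, of 0 N] by (simp add: r_def)
      show "eps ^ (s + l) \<le> pn N w (W @ v)"
        using pn_ge_path[OF path] eps_power(3)[OF N] by simp
    qed (use r in auto)
    also have "\<dots> = (1 - \<kappa>) * sqrt r" using r by (simp add: \<kappa>_def field_simps)
    finally have "(T ^^ N) (\<lambda>x. sqrt (g x)) w \<le> (1 - \<kappa>) * sqrt (g w)" by (simp add: r_def)
    moreover have "(T ^^ (s + l + 1)) (\<lambda>x. sqrt (g x)) w \<le> (T ^^ N) (\<lambda>x. sqrt (g x)) w"
      using N by (intro Tn_superharmonic[OF sT w]) auto
    ultimately show ?thesis by simp
  qed
  moreover have "0 < \<kappa>" "\<kappa> < 1"
    using eps_power(1,2)[of "s + l"] by (auto simp: \<kappa>_def)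
  ultimately show ?thesis unfolding g_def
    by (intro exI[of _ "s + l + 1"] exI[of _ \<kappa>]) simp
qed

text \<open>A weighted sum of the first \<open>S\<close> iterates turns contraction over
  \<open>S\<close> steps into contraction at every single step.\<close>

lemma exists_contracted:
  "\<exists>\<phi> \<rho>. 0 < \<rho> \<and> \<rho> < 1 \<and> (\<forall>x\<in>lang. 0 < \<phi> x \<and> T \<phi> x \<le> \<rho> * \<phi> x)"
proof -
  obtain S \<kappa> where \<kappa>: "0 < \<kappa>" "\<kappa> < 1" and S: "0 < S"
    and con: "\<forall>w\<in>lang. (T ^^ S) (\<lambda>x. sqrt (green x [])) w \<le> (1 - \<kappa>) * sqrt (green w [])"
    using sqrt_green_contract by blast
  define h where "h x = sqrt (green x [])" for x
  have hpos: "0 < h x" if "x \<in> lang" for x using green_pos[OF that Nil_lang] by (simp add: h_def)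
  have con: "(T ^^ S) h w \<le> (1 - \<kappa>) * h w" if "w \<in> lang" for w
    using con that unfolding h_def[abs_def] by blast
  \<comment> \<open>Chosen so that Bernoulli's inequality gives
    \<open>1 - \<kappa> \<le> \<rho> ^ S\<close>.\<close>
  define \<rho> where "\<rho> = 1 - \<kappa> / real S"
  have "\<kappa> / real S \<le> \<kappa> / 1" using \<kappa> S by (intro divide_left_mono) auto
  then have \<rho>: "0 < \<rho>" "\<rho> < 1" using \<kappa> S by (auto simp: \<rho>_def)
  have pw: "1 - \<kappa> \<le> \<rho> ^ S"
    using Bernoulli_inequality[of "- \<kappa> / real S" S] \<rho> S by (simp add: \<rho>_def)
  define \<phi> where "\<phi> x = (\<Sum>i<S. (1 / \<rho> ^ i) * (T ^^ i) h x)" for x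
  have "0 < \<phi> x \<and> T \<phi> x \<le> \<rho> * \<phi> x" if x: "x \<in> lang" for x
  proof
    have nn: "0 \<le> (T ^^ i) h x" for i
      by (rule Tn_nonneg[OF closed_lang _ x]) (use hpos in \<open>auto intro: less_imp_le\<close>)
    have "h x = (1 / \<rho> ^ 0) * (T ^^ 0) h x" by simp
    also have "\<dots> \<le> \<phi> x"
      unfolding \<phi>_def by (rule member_le_sum) (use nn \<rho> S in auto)
    finally show "0 < \<phi> x" using hpos[OF x] by simp
    \<comment> \<open>Applying \<open>T\<close> shifts the weighted sum by one index; the new last
      term is at most the lost first one, by contraction over \<open>S\<close> steps.\<close>
    have "T \<phi> x = \<rho> * (\<Sum>i<S. (1 / \<rho> ^ Suc i) * (T ^^ Suc i) h x)"
      unfolding \<phi>_def[abs_def] T_sum T_cmult using \<rho> by (simp add: sum_distrib_left)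
    also have "(\<Sum>i<S. (1 / \<rho> ^ Suc i) * (T ^^ Suc i) h x)
        = (\<Sum>i<Suc S. (1 / \<rho> ^ i) * (T ^^ i) h x) - h x"
      by (subst sum.lessThan_Suc_shift) simp
    also have "\<dots> = \<phi> x + (1 / \<rho> ^ S) * (T ^^ S) h x - h x" by (simp add: \<phi>_def)
    also have "\<dots> \<le> \<phi> x"
    proof -
      have "(T ^^ S) h x \<le> \<rho> ^ S * h x"
        using con[OF x] pw hpos[OF x] by (meson mult_right_mono less_imp_le order_trans)
      then show ?thesis using \<rho> by (simp add: field_simps)
    qed
    finally show "T \<phi> x \<le> \<rho> * \<phi> x" using \<rho> by simp
  qed
  then show ?thesis using \<rho> by blast
qed

text \<open>A contracted function, transported to the cone and normalised to be at least 1 on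
  two-letter words, dominates \<open>hit\<close>; contraction then controls the recursion of
  \<open>delay\<close>.\<close>

lemma delay_bounded:
  assumes "v \<in> cone_words" shows "\<exists>C\<ge>0. \<forall>n. delay n v \<le> C"
proof -
  obtain \<phi> \<rho> where \<rho>: "0 < \<rho>" "\<rho> < 1" and \<phi>: "\<And>x. x \<in> lang \<Longrightarrow> 0 < \<phi> x \<and> T \<phi> x \<le> \<rho> * \<phi> x"
    using exists_contracted by blast
  obtain W where W: "W @ base \<in> lang" using exists_base by blast
  define M where "M = (\<lambda>V. \<phi> (W @ V)) ` {V \<in> cone_words. length V = 2}"
  have M: "finite M" "M \<noteq> {}"
    unfolding M_def by (rule finite_imageI, rule finite_subset[OF _ finite_length_le[of 2]])
      (auto intro: exI[of _ base])
  define m where "m = Min M"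
  have m: "0 < m" unfolding m_def using M \<phi> cone_words_lang[OF W] by (auto simp: M_def)
  define \<Lambda> where "\<Lambda> V = (1 / m) * \<phi> (W @ V)" for V
  have pos: "0 < \<Lambda> V" if "V \<in> cone_words" for V using \<phi> cone_words_lang[OF W that] m by (simp add: \<Lambda>_def)
  have one: "1 \<le> \<Lambda> V" if "V \<in> cone_words" "length V = 2" for V
  proof -
    have "m \<le> \<phi> (W @ V)" unfolding m_def using that M(1) by (intro Min_le) (auto simp: M_def)
    then show ?thesis using m by (simp add: \<Lambda>_def)
  qed
  have con: "T \<Lambda> V \<le> \<rho> * \<Lambda> V" if "V \<in> cone_words" for V
  proof -
    have "T \<Lambda> V = (1 / m) * T \<phi> (W @ V)"
      unfolding \<Lambda>_def[abs_def] T_cmult using T_shift[OF cone_words_length[OF that]] by simp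
    then show ?thesis using \<phi> cone_words_lang[OF W that] m by (simp add: \<Lambda>_def field_simps)
  qed
  have hit: "hit n V \<le> \<Lambda> V" if "V \<in> cone_words" for n V
    using that
  proof (induction n arbitrary: V)
    case 0
    then show ?case using one[of V] pos[of V] cone_words_length[of V] by (auto simp: short_def)
  next
    case (Suc n)
    show ?case
    proof (cases "length V \<le> 2")
      case True
      then show ?thesis using one[OF Suc.prems] cone_words_length[OF Suc.prems] by simp
    next
      case False
      have "T (hit n) V \<le> T \<Lambda> V"
        by (rule T_mono, rule Suc.IH, rule cone_words_step[OF Suc.prems]) (use False in auto)
      also have "\<dots> \<le> \<rho> * \<Lambda> V" by (rule con[OF Suc.prems])
      also have "\<dots> \<le> 1 * \<Lambda> V" using pos[OF Suc.prems] \<rho> by (intro mult_right_mono) auto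
      finally show ?thesis using False by simp
    qed
  qed
  \<comment> \<open>The solution of \<open>(1 + c) * \<rho> = c\<close>, for which the bound
    \<open>c * \<Lambda>\<close> is preserved by the recursion of \<open>delay\<close>.\<close>
  define c where "c = \<rho> / (1 - \<rho>)"
  have c: "0 \<le> c" "(1 + c) * \<rho> = c" using \<rho> by (auto simp: c_def field_simps)
  have "delay n V \<le> c * \<Lambda> V" if "V \<in> cone_words" for n V
    using that
  proof (induction n arbitrary: V)
    case 0
    then show ?case using c pos[of V] by simp
  next
    case (Suc n)
    show ?case
    proof (cases "length V \<le> 2")
      case True
      then show ?thesis using c pos[OF Suc.prems] by simp
    next
      case False
      have "T (\<lambda>U. hit n U + delay n U) V \<le> T (\<lambda>U. (1 + c) * \<Lambda> U) V"
      proof (rule T_mono)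
        fix U assume "step V U"
        then have "U \<in> cone_words" using cone_words_step[OF Suc.prems] False by simp
        then show "hit n U + delay n U \<le> (1 + c) * \<Lambda> U"
          using hit[of U n] Suc.IH[of U] by (simp add: algebra_simps)
      qed
      also have "\<dots> \<le> (1 + c) * (\<rho> * \<Lambda> V)"
        unfolding T_cmult using con[OF Suc.prems] c by (intro mult_left_mono) auto
      also have "\<dots> = c * \<Lambda> V" using c(2) by (metis mult.assoc)
      finally show ?thesis using False by simp
    qed
  qed
  then show ?thesis using assms c pos[OF assms] by (intro exI[of _ "c * \<Lambda> v"]) auto
qed

end

section \<open>Drift of the Green distance\<close>

text \<open>Fekete's argument on both sides: \<open>a n + c\<close> is subadditive and
  \<open>a n - c\<close> superadditive, so every \<open>(a m - c) / m\<close> lies below every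
  \<open>(a n + c) / n\<close>, and \<open>h\<close> separates the two families.\<close>

lemma quasi_additive_linear:
  fixes a :: "nat \<Rightarrow> real"
  assumes add: "\<And>m n. \<bar>a (m + n) - a m - a n\<bar> \<le> c"
  shows "\<exists>h. \<forall>n. \<bar>a n - real n * h\<bar> \<le> c"
proof -
  have a0: "\<bar>a 0\<bar> \<le> c" using add[of 0 0] by simp
  then have c: "0 \<le> c" by simp
  have mult: "\<bar>a (k * m) - real k * a m\<bar> \<le> real k * c" if "0 < k" for k m
    using that
  proof (induction k)
    case (Suc k)
    show ?case
    proof (cases "k = 0")
      case False
      then have "\<bar>a (k * m) - real k * a m\<bar> \<le> real k * c" using Suc by simp
      then show ?thesis using add[of m "k * m"] by (simp add: algebra_simps abs_le_iff)
    qed (use c in simp)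
  qed simp
  have cross: "(a m - c) / real m \<le> (a n + c) / real n" if "0 < m" "0 < n" for m n
  proof -
    have "real n * (a m - c) \<le> a (n * m)" "a (m * n) \<le> real m * (a n + c)"
      using mult[of n m] mult[of m n] that by (auto simp: algebra_simps abs_le_iff)
    then have "real n * (a m - c) \<le> real m * (a n + c)" by (simp add: mult.commute)
    then show ?thesis using that by (simp add: field_simps)
  qed
  define h where "h = (INF n\<in>{0<..}. (a n + c) / real n)"
  have "\<bar>a n - real n * h\<bar> \<le> c" for n
  proof (cases "n = 0")
    case False
    then have n: "0 < n" by simp
    have "(a n - c) / real n \<le> h"
      unfolding h_def by (rule cINF_greatest) (use cross[OF n] in auto)
    moreover have "h \<le> (a n + c) / real n"
      unfolding h_def by (rule cINF_lower) (use n cross[of 1] in \<open>auto intro!: bdd_belowI\<close>)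
    ultimately show ?thesis using n by (simp add: field_simps abs_le_iff)
  qed (use a0 in simp)
  then show ?thesis by blast
qed

section \<open>The Green distance and its increments\<close>

context transient_kernel
begin

definition green_dist :: "'a list \<Rightarrow> real" where
  "green_dist x = - ln (green [] x)"

text \<open>The Lipschitz constant of \<open>green_dist\<close> along possible steps between
  accessible words.\<close>

definition lam :: real where
  "lam = - ln eps"

lemma lam_nonneg: "0 \<le> lam"
  using eps by (simp add: lam_def)

lemma green_dist_path:
  assumes "x \<in> lang" "(step ^^ n) x y"
  shows "\<bar>green_dist x - green_dist y\<bar> \<le> real n * lam"
proof -
  have y: "y \<in> lang" using lang_path assms by blast
  have pos: "0 < green [] x" "0 < green [] y" using green_pos assms y by auto
  have "green_dist b \<le> green_dist a + real n * lam" if "eps ^ n * green [] a \<le> green [] b" "0 < green [] a" for a b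
  proof -
    have "0 < eps ^ n * green [] a" using that(2) eps_power(1)[of n] by simp
    then have "ln (eps ^ n * green [] a) \<le> ln (green [] b)" using that(1) by simp
    then show ?thesis using that(2) eps by (simp add: green_dist_def lam_def ln_mult ln_realpow)
  qed
  from this[of x y] this[of y x] show ?thesis
    using pos green_path_right[OF assms(2) Nil_lang assms(1)]
      green_path_right[OF step_pow_sym[OF assms(2)] Nil_lang y] by (simp add: abs_le_iff)
qed

lemma green_dist_step: "x \<in> lang \<Longrightarrow> step x y \<Longrightarrow> \<bar>green_dist x - green_dist y\<bar> \<le> lam"
  using green_dist_path[of x 1 y, unfolded relpowp_1] by simp

lemma Tn_green_dist: 
  assumes "x \<in> lang" shows "\<bar>(T ^^ n) green_dist x - green_dist x\<bar> \<le> real n * lam"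
  using assms
proof (induction n arbitrary: x)
  case (Suc n)
  have "\<bar>T (\<lambda>y. (T ^^ n) green_dist y - green_dist x) x\<bar> \<le> T (\<lambda>y. \<bar>(T ^^ n) green_dist y - green_dist x\<bar>) x" by (rule T_abs)
  also have "\<dots> \<le> T (\<lambda>y. real n * lam + lam) x"
  proof (rule T_mono)
    fix y assume "step x y"
    then show "\<bar>(T ^^ n) green_dist y - green_dist x\<bar> \<le> real n * lam + lam"
      using Suc.IH[of y] green_dist_step[OF Suc.prems] lang_step[OF Suc.prems] by fastforce
  qed
  finally show ?case by (simp add: T_diff algebra_simps)
qed simp

lemma Tn_green_dist_diff:
  assumes "x \<in> lang" shows "\<bar>(T ^^ (n + m)) green_dist x - (T ^^ m) green_dist x\<bar> \<le> real n * lam"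
proof -
  have "\<bar>(T ^^ m) (\<lambda>y. (T ^^ n) green_dist y - green_dist y) x\<bar> \<le> real n * lam"
    by (rule Tn_abs_le_const[OF closed_lang _ assms]) (rule Tn_green_dist)
  then show ?thesis by (simp add: Tn_diff Tn_Tn add.commute)
qed

text \<open>As functions of \<open>V\<close>, the Green functions behind \<open>W\<close> and
  \<open>W'\<close> satisfy the same last-step equation while \<open>V\<close> has more than two
  letters, and at two letters both are comparable to their values at \<open>base\<close>. Induction
  over partial sums on the side of \<open>W\<close> carries the comparison through the cone.\<close>

lemma green_cone_ratio:
  "\<exists>A\<ge>1. \<forall>W W' V. W @ base \<in> lang \<longrightarrow> W' @ base \<in> lang \<longrightarrow> V \<in> cone_words \<longrightarrow>
    green [] (W @ V) * green [] (W' @ base) \<le> A * (green [] (W @ base) * green [] (W' @ V))"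
proof -
  obtain k where k: "\<forall>V\<in>cone_words. length V = 2 \<longrightarrow>
      (\<exists>n\<le>k. \<forall>W. (step ^^ n) (W @ base) (W @ V) \<and> (step ^^ n) (W @ V) (W @ base))"
    using cone_words_short_path by blast
  have short_le: "eps ^ k * green [] (W @ V) \<le> green [] (W @ base)"
      "eps ^ k * green [] (W @ base) \<le> green [] (W @ V)"
    if W: "W @ base \<in> lang" and V: "V \<in> cone_words" "length V = 2" for W V
  proof -
    obtain n where n: "n \<le> k" "(step ^^ n) (W @ base) (W @ V)" "(step ^^ n) (W @ V) (W @ base)"
      using k[rule_format, OF V] by blast
    have WV: "W @ V \<in> lang" by (rule cone_words_lang[OF W V(1)])
    have "eps ^ k * green [] u \<le> eps ^ n * green [] u" if "u \<in> lang" for u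
      using eps_power(3)[OF n(1)] green_pos[OF Nil_lang that] by simp
    from this[OF WV] this[OF W]
    show "eps ^ k * green [] (W @ V) \<le> green [] (W @ base)"
      "eps ^ k * green [] (W @ base) \<le> green [] (W @ V)"
      using green_path_right[OF n(2) Nil_lang W] green_path_right[OF n(3) Nil_lang WV] by linarith+
  qed
  have main: "green [] (W @ V) * green [] (W' @ base) * eps ^ (2 * k)
      \<le> green [] (W @ base) * green [] (W' @ V)"
    if W: "W @ base \<in> lang" and W': "W' @ base \<in> lang" and V: "V \<in> cone_words" for W W' V
  proof -
    define S where "S n x = (\<Sum>i<n. pn i [] x)" for n x
    \<comment> \<open>One factor \<open>eps ^ k\<close> is spent for each of the two
      prefixes.\<close>
    define c where "c = green [] (W' @ base) * eps ^ (2 * k)"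
    have c: "0 < c" unfolding c_def using green_pos[OF Nil_lang W'] eps_power(1)[of "2 * k"] by simp
    have "S n (W @ V) * c \<le> green [] (W @ base) * green [] (W' @ V)" for n
      using V
    proof (induction n arbitrary: V)
      case 0
      then show ?case using green_pos[OF Nil_lang W] green_pos[OF Nil_lang cone_words_lang[OF W' "0.prems"]] by (simp add: S_def)
    next
      case (Suc n)
      have WV: "W @ V \<in> lang" "W' @ V \<in> lang" using cone_words_lang[OF W Suc.prems] cone_words_lang[OF W' Suc.prems] by auto
      show ?case
      proof (cases "length V = 2")
        case True
        have "S (Suc n) (W @ V) * c \<le> green [] (W @ V) * c"
          unfolding S_def using c by (intro mult_right_mono green_partial_le Nil_lang WV) simp
        also have "\<dots> = (eps ^ k * green [] (W @ V)) * (eps ^ k * green [] (W' @ base))"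
          by (simp add: c_def power_add mult_2)
        also have "\<dots> \<le> green [] (W @ base) * green [] (W' @ V)"
          using short_le[OF W Suc.prems True] short_le[OF W' Suc.prems True]
            green_pos[OF Nil_lang W] green_pos[OF Nil_lang W'] eps_power(1)[of k]
          by (intro mult_mono) auto
        finally show ?thesis .
      next
        case False
        then have len: "2 < length V" using cone_words_length[OF Suc.prems] by simp
        then have len2: "2 \<le> length V" by simp
        \<comment> \<open>Successors of \<open>V\<close> still have at least two letters, so
          \<open>q_shift\<close> applies to the reversed step from \<open>Z\<close> to
          \<open>V\<close>.\<close>
        have qq: "q (U @ Z) (U @ V) = q Z V" if "step V Z" for U Z
          using q_shift step_length[OF that] len by (intro q_shift) auto
        have reidx: "(\<Sum>z | step (U @ V) z. F z * q z (U @ V)) = (\<Sum>Z | step V Z. F (U @ Z) * q Z V)"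
          for F :: "'a list \<Rightarrow> real" and U
          unfolding step_shift[OF len2] using qq by (subst sum.reindex) (auto simp: inj_on_def)
        have "S (Suc n) (W @ V) = (\<Sum>z | step (W @ V) z. S n z * q z (W @ V))"
        proof -
          have "S (Suc n) (W @ V) = (\<Sum>i<n. \<Sum>z | step (W @ V) z. pn i [] z * q z (W @ V))"
            using len by (auto simp: S_def sum.lessThan_Suc_shift pn_Suc_right ind_def
                simp del: sum.lessThan_Suc)
          also have "\<dots> = (\<Sum>z | step (W @ V) z. S n z * q z (W @ V))"
            by (subst sum.swap) (simp add: S_def sum_distrib_right)
          finally show ?thesis .
        qed
        also have "\<dots> = (\<Sum>Z | step V Z. S n (W @ Z) * q Z V)" by (rule reidx)
        finally have "S (Suc n) (W @ V) * c = (\<Sum>Z | step V Z. (S n (W @ Z) * c) * q Z V)"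
          by (simp add: sum_distrib_left mult_ac)
        also have "\<dots> \<le> (\<Sum>Z | step V Z. (green [] (W @ base) * green [] (W' @ Z)) * q Z V)"
          by (intro sum_mono mult_right_mono Suc.IH q_nonneg) (use cone_words_step[OF Suc.prems len] in auto)
        also have "\<dots> = green [] (W @ base) * (\<Sum>Z | step V Z. green [] (W' @ Z) * q Z V)"
          by (simp add: sum_distrib_left mult_ac)
        also have "(\<Sum>Z | step V Z. green [] (W' @ Z) * q Z V)
            = (\<Sum>z | step (W' @ V) z. green [] z * q z (W' @ V))" by (rule reidx[symmetric])
        also have "\<dots> = green [] (W' @ V)"
          using green_right[OF Nil_lang WV(2)] len by (auto simp: ind_def)
        finally show ?thesis .
      qed
    qed
    then have "green [] (W @ V) * c \<le> green [] (W @ base) * green [] (W' @ V)"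
      unfolding S_def green_def[of "[]" "W @ V"]
      by (intro LIMSEQ_le_const2[OF tendsto_mult_right[OF summable_LIMSEQ[OF pn_summable]]])
        (auto intro: cone_words_lang[OF W V])
    then show ?thesis by (simp add: c_def mult.assoc)
  qed
  have "green [] (W @ V) * green [] (W' @ base)
      \<le> 1 / eps ^ (2 * k) * (green [] (W @ base) * green [] (W' @ V))"
    if "W @ base \<in> lang" "W' @ base \<in> lang" "V \<in> cone_words" for W W' V
    using main[OF that] eps_power(1)[of "2 * k"] by (simp add: field_simps)
  moreover have "1 \<le> 1 / eps ^ (2 * k)" using eps_power(1,2)[of "2 * k"] by simp
  ultimately show ?thesis by blast
qed

lemma green_dist_cone_ratio:
  "\<exists>C\<ge>0. \<forall>W W' V. W @ base \<in> lang \<longrightarrow> W' @ base \<in> lang \<longrightarrow> V \<in> cone_words \<longrightarrow>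
    \<bar>(green_dist (W @ V) - green_dist (W @ base)) - (green_dist (W' @ V) - green_dist (W' @ base))\<bar> \<le> C"
proof -
  obtain A where A: "1 \<le> A" and le: "\<forall>W W' V. W @ base \<in> lang \<longrightarrow> W' @ base \<in> lang \<longrightarrow> V \<in> cone_words \<longrightarrow>
      green [] (W @ V) * green [] (W' @ base) \<le> A * (green [] (W @ base) * green [] (W' @ V))"
    using green_cone_ratio by blast
  have "(green_dist (W' @ V) - green_dist (W' @ base)) - (green_dist (W @ V) - green_dist (W @ base)) \<le> ln A"
    if W: "W @ base \<in> lang" "W' @ base \<in> lang" "V \<in> cone_words" for W W' V
  proof -
    have pos: "0 < green [] (W @ V)" "0 < green [] (W' @ base)" "0 < green [] (W @ base)"
        "0 < green [] (W' @ V)"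
      using green_pos[OF Nil_lang] W cone_words_lang by blast+
    have "ln (green [] (W @ V) * green [] (W' @ base))
        \<le> ln (A * (green [] (W @ base) * green [] (W' @ V)))"
      using le W pos A by (subst ln_le_cancel_iff) auto
    then show ?thesis using pos A by (simp add: ln_mult green_dist_def)
  qed
  from this[of W W' V for W W' V] this[of W' W V for W W' V]
  have "\<bar>(green_dist (W @ V) - green_dist (W @ base)) - (green_dist (W' @ V) - green_dist (W' @ base))\<bar> \<le> ln A"
    if "W @ base \<in> lang" "W' @ base \<in> lang" "V \<in> cone_words" for W W' V
    using that unfolding abs_le_iff by fastforce
  then show ?thesis using A by (intro exI[of _ "ln A"]) auto
qed

text \<open>The increment of \<open>green_dist\<close> over \<open>M\<close> steps is compared with \<open>\<psi>\<close>: as long as the walk started at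
  \<open>W @ V\<close> has not hit \<open>{W @ U | length U = 2}\<close>, it does not depend on \<open>W\<close>; afterwards the bound \<open>b\<close>
  applies, at the cost of \<open>lam\<close> for each step already taken.\<close>

lemma stopped_increment:
  assumes W: "W @ base \<in> lang" and V: "V \<in> cone_words" and jM: "j \<le> M" and b: "0 \<le> b"
    and incr: "\<And>w. w \<in> lang \<Longrightarrow> \<bar>(T ^^ M) green_dist w - green_dist w - \<psi>\<bar> \<le> b"
    and C: "0 \<le> C" "\<And>U. U \<in> cone_words \<Longrightarrow> length U = 2 \<Longrightarrow> \<bar>green_dist (W @ U) - a\<bar> \<le> C"
  shows "\<bar>(T ^^ j) green_dist (W @ V) - a - \<psi> - kill (\<lambda>U. green_dist (W @ U) - a - \<psi>) j V\<bar>
    \<le> (b + C + lam * (real M - real j)) * hit j V + lam * delay j V"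
  using V jM
proof (induction j arbitrary: V)
  \<comment> \<open>The case of a two-letter suffix is settled for every \<open>j\<close> at once:
    the increment over \<open>M\<close> steps is known up to \<open>b\<close>, and each of the
    \<open>M - j\<close> missing steps costs \<open>lam\<close>.\<close>
  have two: "\<bar>(T ^^ j) green_dist (W @ V) - a - \<psi>\<bar> \<le> b + C + lam * (real M - real j)"
    if "V \<in> cone_words" "length V = 2" "j \<le> M" for j V
  proof -
    have WV: "W @ V \<in> lang" by (rule cone_words_lang[OF W that(1)])
    have "\<bar>(T ^^ M) green_dist (W @ V) - (T ^^ j) green_dist (W @ V)\<bar> \<le> lam * (real M - real j)"
      using Tn_green_dist_diff[OF WV, of "M - j" j] that(3) by (simp add: of_nat_diff mult.commute)
    then show ?thesis using incr[OF WV] C(2)[OF that(1,2)] by linarith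
  qed
  {
    case 0
    then show ?case using two[of V 0] cone_words_length[OF "0.prems"(1)] by (auto simp: short_def)
  next
    case (Suc j)
    show ?case
    proof (cases "length V = 2")
      case True
      then show ?thesis using two[OF Suc.prems(1) True Suc.prems(2)] by simp
    next
      case False
      then have len: "2 < length V" using cone_words_length[OF Suc.prems(1)] by simp
      let ?k = "kill (\<lambda>U. green_dist (W @ U) - a - \<psi>) j"
      let ?c = "b + C + lam * (real M - real (Suc j))"
      have "(T ^^ Suc j) green_dist (W @ V) = T (\<lambda>U. (T ^^ j) green_dist (W @ U)) V"
        using T_shift[of V "(T ^^ j) green_dist" W] len by simp
      then have eq: "(T ^^ Suc j) green_dist (W @ V) - a - \<psi> - kill (\<lambda>U. green_dist (W @ U) - a - \<psi>) (Suc j) V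
          = T (\<lambda>U. (T ^^ j) green_dist (W @ U) - a - \<psi> - ?k U) V"
        using len by (simp add: T_diff)
      have "\<bar>(T ^^ Suc j) green_dist (W @ V) - a - \<psi> - kill (\<lambda>U. green_dist (W @ U) - a - \<psi>) (Suc j) V\<bar>
          \<le> T (\<lambda>U. \<bar>(T ^^ j) green_dist (W @ U) - a - \<psi> - ?k U\<bar>) V"
        unfolding eq by (rule T_abs)
      also have "\<dots> \<le> T (\<lambda>U. ?c * hit j U + lam * (hit j U + delay j U)) V"
      proof (rule T_mono)
        fix U assume "step V U"
        then have U: "U \<in> cone_words" by (rule cone_words_step[OF Suc.prems(1) len])
        \<comment> \<open>The coefficient for the remaining time drops by \<open>lam\<close> at each
          step; the lost \<open>lam * hit j U\<close> is what the recursion of \<open>delay\<close>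
          collects.\<close>
        have eq: "?c * hit j U + lam * (hit j U + delay j U)
            = (b + C + lam * (real M - real j)) * hit j U + lam * delay j U"
          by (simp add: algebra_simps)
        show "\<bar>(T ^^ j) green_dist (W @ U) - a - \<psi> - ?k U\<bar>
            \<le> ?c * hit j U + lam * (hit j U + delay j U)"
          unfolding eq by (rule Suc.IH[OF U Suc_leD[OF Suc.prems(2)]])
      qed
      also have "\<dots> = ?c * hit (Suc j) V + lam * delay (Suc j) V"
        using len by (simp add: T_add T_cmult)
      finally show ?thesis .
    qed
  }
qed

text \<open>A bound \<open>b\<close> on the deviations at all accessible words improves to
  \<open>(1 - \<theta> / 2) * b + H\<close>, with \<open>\<theta>\<close> and \<open>H\<close>
  independent of \<open>M\<close>. Taking the supremum for \<open>b\<close> gives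
  \<open>b \<le> 2 * H / \<theta>\<close>.\<close>

lemma increments_uniform: "\<exists>B. \<forall>M. \<exists>\<psi>. \<forall>w\<in>lang. \<bar>(T ^^ M) green_dist w - green_dist w - \<psi>\<bar> \<le> B"
proof -
  obtain s where s: "\<forall>w\<in>lang. \<exists>n\<le>s. \<exists>W. W @ base \<in> lang \<and> (step ^^ n) w (W @ base)"
    using reach_base by blast
  obtain k where k: "\<forall>V\<in>cone_words. length V = 2 \<longrightarrow>
      (\<exists>n\<le>k. \<forall>W. (step ^^ n) (W @ base) (W @ V) \<and> (step ^^ n) (W @ V) (W @ base))"
    using cone_words_short_path by blast
  obtain v where v: "v \<in> cone_words" "hitp v < 1 / 2" using exists_escaping[of "1 / 2"] by auto
  obtain l where l: "(cstep ^^ l) base v"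
    using v(1) rtranclp_imp_relpowp unfolding cone_words_def by (metis mem_Collect_eq)
  obtain D where D: "0 \<le> D" "\<And>n. delay n v \<le> D" using delay_bounded[OF v(1)] by blast
  obtain C where C: "0 \<le> C" "\<And>W W' V. W @ base \<in> lang \<Longrightarrow> W' @ base \<in> lang \<Longrightarrow> V \<in> cone_words \<Longrightarrow>
      \<bar>(green_dist (W @ V) - green_dist (W @ base)) - (green_dist (W' @ V) - green_dist (W' @ base))\<bar> \<le> C"
    using green_dist_cone_ratio by blast
  obtain W0 where W0: "W0 @ base \<in> lang" using exists_base by blast
  define E where "E = real k * lam + real l * lam"
  have E: "0 \<le> E" "\<bar>green_dist (W @ U) - green_dist (W @ v)\<bar> \<le> E"
    if W: "W @ base \<in> lang" and U: "U \<in> cone_words" "length U = 2" for W U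
  proof -
    show "0 \<le> E" using lam_nonneg by (simp add: E_def)
    obtain n where n: "n \<le> k" "(step ^^ n) (W @ base) (W @ U)"
      using k[rule_format, OF U] by blast
    have "\<bar>green_dist (W @ base) - green_dist (W @ U)\<bar> \<le> real n * lam" by (rule green_dist_path[OF W n(2)])
    also have "\<dots> \<le> real k * lam" using n(1) lam_nonneg by (intro mult_right_mono) auto
    finally show "\<bar>green_dist (W @ U) - green_dist (W @ v)\<bar> \<le> E"
      using green_dist_path[OF W cpath_shift[OF l]] by (simp add: E_def)
  qed
  have hv: "hit M v < 1 / 2" for M using hit_le_hitp[of M v] v(2) by simp
  define \<theta> where "\<theta> = eps ^ (s + l)"
  have \<theta>: "0 < \<theta>" "\<theta> \<le> 1" using eps_power by (auto simp: \<theta>_def)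
  define G where "G = 2 * C + E + lam * D"
  define H where "H = \<theta> * G + 2 * real (s + l) * lam"
  have "\<exists>\<psi>. \<forall>w\<in>lang. \<bar>(T ^^ M) green_dist w - green_dist w - \<psi>\<bar> \<le> 2 * H / \<theta>" for M
  proof -
    \<comment> \<open>The mean increment behind the reference prefix \<open>W0\<close>, conditioned
      on not leaving the cone within \<open>M\<close> steps; it makes the killed part vanish
      there.\<close>
    define \<psi> where "\<psi> = kill (\<lambda>U. green_dist (W0 @ U) - green_dist (W0 @ v)) M v / (1 - hit M v)"
    define \<Delta> where "\<Delta> w = (T ^^ M) green_dist w - green_dist w - \<psi>" for w
    have kill_diff: "kill (\<lambda>U. \<phi> U - \<psi>) M v = kill \<phi> M v - \<psi> * (1 - hit M v)" for \<phi>
      using kill_add[of \<phi> "\<lambda>_. - \<psi>" M v] kill_const[of "- \<psi>" M v] by simp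
    have kill0: "kill (\<lambda>U. green_dist (W0 @ U) - green_dist (W0 @ v) - \<psi>) M v = 0"
      unfolding kill_diff using hv[of M] by (simp add: \<psi>_def)
    \<comment> \<open>If the cone is left, which has probability below 1/2, the bound
      \<open>b\<close> applies; otherwise the increment is compared with the one behind
      \<open>W0\<close>, at cost \<open>2 * C\<close>.\<close>
    have at_v: "\<bar>\<Delta> (W @ v)\<bar> \<le> b / 2 + G"
      if W: "W @ base \<in> lang" and b: "0 \<le> b" "\<And>w. w \<in> lang \<Longrightarrow> \<bar>\<Delta> w\<bar> \<le> b" for W b
    proof -
      let ?u = "\<lambda>W U. green_dist (W @ U) - green_dist (W @ v) - \<psi>"
      have "\<bar>\<Delta> (W @ v) - kill (?u W) M v\<bar> \<le> (b + E + lam * (real M - real M)) * hit M v + lam * delay M v"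
        unfolding \<Delta>_def using b E[OF W] E(1)[OF W, of base]
        by (intro stopped_increment[OF W v(1)]) (auto simp: \<Delta>_def)
      also have "\<dots> \<le> (b + E) * (1 / 2) + lam * D"
      proof (rule add_mono)
        show "(b + E + lam * (real M - real M)) * hit M v \<le> (b + E) * (1 / 2)"
          using hv[of M] b(1) E(1)[OF W, of base] mult_left_mono[of "hit M v" "1 / 2" "b + E"] by simp
      qed (use D lam_nonneg in \<open>auto intro: mult_left_mono\<close>)
      also have "\<dots> \<le> b / 2 + E + lam * D" using E(1)[OF W, of base] by simp
      finally have 1: "\<bar>\<Delta> (W @ v) - kill (?u W) M v\<bar> \<le> b / 2 + E + lam * D" .
      have eq: "kill (?u W) M v = kill (\<lambda>U. ?u W U - ?u W0 U) M v"
        using kill_add[of "\<lambda>U. ?u W U - ?u W0 U" "?u W0" M v] kill0 by (simp only: diff_add_cancel add_0_right)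
      have "\<bar>kill (?u W) M v\<bar> \<le> 2 * C * (1 - hit M v)"
        unfolding eq
      proof (rule kill_abs[OF v(1)])
        fix U assume "U \<in> cone_words"
        then show "\<bar>?u W U - ?u W0 U\<bar> \<le> 2 * C"
          using C(2)[OF W W0, of U] C(2)[OF W W0 v(1)] by linarith
      qed
      also have "\<dots> \<le> 2 * C * 1" using C(1) hit_bounds[of M v] by (intro mult_left_mono) auto
      finally show ?thesis using 1 unfolding G_def by linarith
    qed
    have improve: "\<bar>\<Delta> w\<bar> \<le> (1 - \<theta> / 2) * b + H"
      if w: "w \<in> lang" and b: "0 \<le> b" "\<And>w. w \<in> lang \<Longrightarrow> \<bar>\<Delta> w\<bar> \<le> b" for w b
    proof -
      obtain n W where n: "n \<le> s" "W @ base \<in> lang" "(step ^^ n) w (W @ base)" using s w by blast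
      define N where "N = n + l"
      have path: "(step ^^ N) w (W @ v)"
        unfolding N_def relpowp_add using n(3) cpath_shift[OF l] by blast
      have N: "N \<le> s + l" using n N_def by simp
      have vL: "W @ v \<in> lang" using cone_words_lang n v by blast
      define b' where "b' = \<bar>\<Delta> (W @ v)\<bar>"
      have b': "b' \<le> b / 2 + G" "b' \<le> b" unfolding b'_def using at_v[OF n(2) b] b(2)[OF vL] by auto
      have "\<bar>(T ^^ N) \<Delta> w\<bar> \<le> b - \<theta> * (b - b')"
      proof -
        \<comment> \<open>The improved bound \<open>b'\<close> enters only at the single word
          \<open>W @ v\<close>, which is reached with probability at least
          \<open>\<theta>\<close>.\<close>
        have le: "\<bar>\<Delta> y\<bar> \<le> b - (b - b') * ind (W @ v) y" if "y \<in> lang" for y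
          using b(2)[OF that] b' by (cases "y = W @ v") (auto simp: b'_def)
        have "(T ^^ N) (\<lambda>y. b - (b - b') * ind (W @ v) y) w = b - (b - b') * pn N w (W @ v)"
          unfolding Tn_diff Tn_cmult by (simp add: pn_def)
        moreover have "(T ^^ N) \<Delta> w \<le> (T ^^ N) (\<lambda>y. b - (b - b') * ind (W @ v) y) w"
          by (rule Tn_mono[OF closed_lang _ w]) (use le abs_le_D1 in blast)
        moreover have "(T ^^ N) (\<lambda>y. (- 1) * \<Delta> y) w \<le> (T ^^ N) (\<lambda>y. b - (b - b') * ind (W @ v) y) w"
          by (rule Tn_mono[OF closed_lang _ w]) (use le abs_le_D2 in fastforce)
        then have "- (T ^^ N) \<Delta> w \<le> (T ^^ N) (\<lambda>y. b - (b - b') * ind (W @ v) y) w"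
          unfolding Tn_cmult by simp
        moreover have "\<theta> * (b - b') \<le> (b - b') * pn N w (W @ v)"
          using pn_ge_path[OF path] eps_power(3)[OF N] b'(2)
          by (subst mult.commute) (intro mult_left_mono, auto simp: \<theta>_def)
        ultimately show ?thesis by (simp add: abs_le_iff)
      qed
      moreover have "\<bar>\<Delta> w - (T ^^ N) \<Delta> w\<bar> \<le> 2 * real (s + l) * lam"
      proof -
        have "(T ^^ N) \<Delta> w = (T ^^ (N + M)) green_dist w - (T ^^ N) green_dist w - \<psi>"
          unfolding \<Delta>_def[abs_def] Tn_diff Tn_Tn by simp
        then have "\<bar>\<Delta> w - (T ^^ N) \<Delta> w\<bar> \<le> 2 * (real N * lam)"
          using Tn_green_dist_diff[OF w, of N M] Tn_green_dist[OF w, of N] unfolding \<Delta>_def by linarith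
        also have "\<dots> \<le> 2 * (real (s + l) * lam)"
          using N lam_nonneg by (intro mult_left_mono mult_right_mono) auto
        finally show ?thesis by (simp only: mult.assoc)
      qed
      moreover have "b - \<theta> * (b - b') \<le> (1 - \<theta> / 2) * b + \<theta> * G"
        using mult_left_mono[OF b'(1), of \<theta>] \<theta> by (simp add: algebra_simps)
      ultimately show ?thesis unfolding H_def by linarith
    qed
    define b where "b = (SUP w\<in>lang. \<bar>\<Delta> w\<bar>)"
    \<comment> \<open>The bound depends on \<open>M\<close>, but serves only to make the supremum
      finite.\<close>
    have bdd: "bdd_above ((\<lambda>w. \<bar>\<Delta> w\<bar>) ` lang)"
    proof (rule bdd_aboveI2)
      fix w assume "w \<in> lang"
      then show "\<bar>\<Delta> w\<bar> \<le> real M * lam + \<bar>\<psi>\<bar>" using Tn_green_dist[of w M] unfolding \<Delta>_def by linarith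
    qed
    have le_b: "\<bar>\<Delta> w\<bar> \<le> b" if "w \<in> lang" for w unfolding b_def by (rule cSUP_upper[OF that bdd])
    have "0 \<le> b" using le_b[OF Nil_lang] by linarith
    have "(SUP w\<in>lang. \<bar>\<Delta> w\<bar>) \<le> (1 - \<theta> / 2) * b + H"
    proof (rule cSUP_least)
      show "\<bar>\<Delta> w\<bar> \<le> (1 - \<theta> / 2) * b + H" if "w \<in> lang" for w
        by (rule improve[OF that \<open>0 \<le> b\<close> le_b])
    qed (use Nil_lang in blast)
    then have "b \<le> (1 - \<theta> / 2) * b + H" unfolding b_def[symmetric] .
    then have "b \<le> 2 * H / \<theta>" using \<theta> by (simp add: field_simps)
    then show ?thesis using le_b unfolding \<Delta>_def by (intro exI[of _ \<psi>]) force
  qed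
  then show ?thesis by blast
qed

text \<open>Averaging the estimate for \<open>n\<close> steps over the position after
  \<open>m\<close> steps shows that the mean increments from \<open>[]\<close> are additive up to
  \<open>2 * B\<close>.\<close>

lemma increments_linear:
  "\<exists>h C. 0 \<le> C \<and> (\<forall>m. \<forall>w\<in>lang. \<bar>(T ^^ m) green_dist w - green_dist w - real m * h\<bar> \<le> C)"
proof -
  obtain B \<psi> where B: "\<And>m w. w \<in> lang \<Longrightarrow> \<bar>(T ^^ m) green_dist w - green_dist w - \<psi> m\<bar> \<le> B"
    using increments_uniform by metis
  define a where "a m = (T ^^ m) green_dist [] - green_dist []" for m
  have a: "\<bar>a m - \<psi> m\<bar> \<le> B" for m unfolding a_def by (rule B) simp
  have "\<bar>a (m + n) - a m - a n\<bar> \<le> 2 * B" for m n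
  proof -
    have "\<bar>(T ^^ m) (\<lambda>w. (T ^^ n) green_dist w - green_dist w - \<psi> n) []\<bar> \<le> B"
      by (rule Tn_abs_le_const[OF closed_lang _ Nil_lang]) (rule B)
    then have "\<bar>a (m + n) - a m - \<psi> n\<bar> \<le> B" by (simp add: Tn_diff Tn_Tn a_def)
    then show ?thesis using a[of n] by linarith
  qed
  then obtain h where h: "\<And>n. \<bar>a n - real n * h\<bar> \<le> 2 * B"
    using quasi_additive_linear[of a "2 * B"] by blast
  \<comment> \<open>The errors are \<open>B\<close> at \<open>w\<close>, \<open>B\<close> at
    \<open>[]\<close> and \<open>2 * B\<close> from the linear approximation.\<close>
  have "\<bar>(T ^^ m) green_dist w - green_dist w - real m * h\<bar> \<le> 4 * B" if "w \<in> lang" for m w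
    using B[OF that, of m] a[of m] h[of m] by linarith
  moreover have "0 \<le> 4 * B" using a[of 0] by linarith
  ultimately show ?thesis by blast
qed

end

section \<open>Return probability and finiteness of the Green function\<close>

context word_kernel
begin

text \<open>The probability of being at \<open>[]\<close> at some time up to \<open>n\<close>; hence
  \<open>T (visit n) []\<close> is that of a return at a time between 1 and
  \<open>n + 1\<close>.\<close>

primrec visit :: "nat \<Rightarrow> 'a list \<Rightarrow> real" where
  "visit 0 = ind []"
| "visit (Suc n) = (\<lambda>x. if x = [] then 1 else T (visit n) x)"

lemma visit_bounds: "0 \<le> visit n x \<and> visit n x \<le> 1"
proof (induction n arbitrary: x)
  case (Suc n)
  show ?case using T_mono[of x "\<lambda>_. 0" "visit n"] T_mono[of x "visit n" "\<lambda>_. 1"] Suc by simp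
qed simp

text \<open>The expected number of visits from \<open>x\<close> is at most the chance of a visit
  times the expected number from \<open>[]\<close>. One step from \<open>[]\<close> then gives
  \<open>S N [] \<le> 1 + r * S N []\<close>.\<close>

lemma summable_if_return_less_one:
  assumes r: "\<And>n. T (visit n) [] \<le> r" "r < 1"
  shows "summable (\<lambda>n. pn n [] [])"
proof -
  define S where "S n x = (\<Sum>i<n. pn i x [])" for n x
  have S_nonneg: "0 \<le> S n x" for n x by (simp add: S_def sum_nonneg)
  have S_mono: "m \<le> n \<Longrightarrow> S m x \<le> S n x" for m n x
    unfolding S_def by (intro sum_mono2) auto
  have S_Suc: "S (Suc n) x = ind [] x + T (S n) x" for n x
    by (simp add: S_def[abs_def] sum.lessThan_Suc_shift pn_Suc_left T_sum del: sum.lessThan_Suc)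
  have le: "S n x \<le> S N [] * visit n x" if "n \<le> N" for n N x
    using that
  proof (induction n arbitrary: x)
    case 0
    then show ?case using S_nonneg[of N "[]"] visit_bounds[of 0 x]
      by (simp add: S_def[of 0])
  next
    case (Suc n)
    show ?case
    proof (cases "x = []")
      case True
      then show ?thesis using S_mono[OF Suc.prems, of "[]"] by simp
    next
      case False
      have "T (S n) x \<le> T (\<lambda>y. S N [] * visit n y) x"
        by (rule T_mono, rule Suc.IH) (use Suc.prems in simp)
      then show ?thesis unfolding T_cmult S_Suc using False by simp
    qed
  qed
  have "S N [] \<le> 1 / (1 - r)" for N
  proof -
    have "S N [] \<le> S (Suc N) []" by (rule S_mono) simp
    also have "\<dots> = 1 + T (S N) []" by (simp add: S_Suc)
    also have "\<dots> \<le> 1 + T (\<lambda>y. S N [] * visit N y) []"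
      by (intro add_left_mono T_mono le) simp
    also have "\<dots> \<le> 1 + S N [] * r"
      unfolding T_cmult using r(1)[of N] S_nonneg by (intro add_left_mono mult_left_mono)
    finally show ?thesis using r(2) by (simp add: field_simps)
  qed
  then show ?thesis unfolding S_def by (intro summableI_nonneg_bounded) auto
qed

end

section \<open>Second moments and truncated Green sums\<close>

context transient_kernel
begin

text \<open>The average of \<open>(T ^^ i) green_dist - i * h\<close> over \<open>i < N\<close> differs from \<open>green_dist\<close> by a bounded amount, but
  its one-step drift is \<open>h\<close> up to an error of order \<open>1 / N\<close>, so that it is almost a martingale
  after centering.\<close>

lemma second_moment:
  assumes C: "0 \<le> C" "\<And>m w. w \<in> lang \<Longrightarrow> \<bar>(T ^^ m) green_dist w - green_dist w - real m * h\<bar> \<le> C"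
  shows "\<exists>K. \<forall>N. (T ^^ N) (\<lambda>x. (green_dist x - real N * h)\<^sup>2) [] \<le> K * (real N + 1)"
proof -
  define D where "D = C + (lam + 2 * C + \<bar>h\<bar>)\<^sup>2"
  define K where "K = 4 * D * exp C + 16 * C\<^sup>2 + 2 * (green_dist [])\<^sup>2"
  have D: "0 \<le> D" using C(1) by (simp add: D_def)
  have "(T ^^ N) (\<lambda>x. (green_dist x - real N * h)\<^sup>2) [] \<le> K * (real N + 1)" for N
  proof (cases "N = 0")
    case True
    have "(green_dist [])\<^sup>2 \<le> K" using C(1) D by (simp add: K_def)
    then show ?thesis using True by simp
  next
    case False
    then have N: "0 < real N" by simp
    define g where "g w = (1 / real N) * (\<Sum>i<N. (T ^^ i) green_dist w - real i * h)" for w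
    have gf: "\<bar>g w - green_dist w\<bar> \<le> C" if "w \<in> lang" for w
    proof -
      have "real N * (g w - green_dist w) = (\<Sum>i<N. (T ^^ i) green_dist w - green_dist w - real i * h)"
        using N by (simp add: g_def algebra_simps sum.distrib sum_subtractf)
      also have "\<bar>\<dots>\<bar> \<le> (\<Sum>i<N. C)"
        by (rule order.trans[OF sum_abs sum_mono]) (rule C(2)[OF that])
      finally show ?thesis using N by (simp add: abs_mult)
    qed
    have drift: "\<bar>T g w - g w - h\<bar> \<le> C / real N" if "w \<in> lang" for w
    proof -
      have "T g w = (1 / real N) * (\<Sum>i<N. (T ^^ Suc i) green_dist w - real i * h)"
        unfolding g_def[abs_def] T_cmult T_sum T_diff by simp
      then have "real N * (T g w - g w - h) = (\<Sum>i<N. (T ^^ Suc i) green_dist w - (T ^^ i) green_dist w) - real N * h"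
        using N by (simp add: g_def algebra_simps sum_subtractf)
      also have "(\<Sum>i<N. (T ^^ Suc i) green_dist w - (T ^^ i) green_dist w) = (T ^^ N) green_dist w - green_dist w"
        using sum_lessThan_telescope[of "\<lambda>i. (T ^^ i) green_dist w" N] by simp
      finally have "\<bar>real N * (T g w - g w - h)\<bar> \<le> C" using C(2)[OF that, of N] by simp
      then have "\<bar>T g w - g w - h\<bar> * real N \<le> C" using N by (simp only: abs_mult) (simp add: mult.commute)
      then show ?thesis using N by (simp only: pos_le_divide_eq)
    qed
    define z where "z k x = g x - g [] - real k * h" for k x
    have step_z: "T (\<lambda>y. (z (Suc k) y)\<^sup>2) x \<le> (1 + C / real N) * (z k x)\<^sup>2 + D" if x: "x \<in> lang" for k x
    proof -
      define d where "d y = g y - g x - h" for y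
      have Td: "T d x = T g x - g x - h" unfolding d_def[abs_def] T_diff by simp
      have "T (\<lambda>y. (z (Suc k) y)\<^sup>2) x = T (\<lambda>y. ((z k x)\<^sup>2 + 2 * z k x * d y) + (d y)\<^sup>2) x"
        by (intro T_cong) (simp add: z_def d_def power2_eq_square algebra_simps)
      also have "\<dots> = (z k x)\<^sup>2 + 2 * z k x * T d x + T (\<lambda>y. (d y)\<^sup>2) x"
        unfolding T_add T_cmult by simp
      also have "\<dots> \<le> (z k x)\<^sup>2 + ((z k x)\<^sup>2 + 1) * (C / real N) + (lam + 2 * C + \<bar>h\<bar>)\<^sup>2"
      proof (intro add_mono order.refl)
        have "2 * z k x * T d x \<le> \<bar>2 * z k x\<bar> * \<bar>T d x\<bar>" by (simp flip: abs_mult)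
        also have "\<dots> \<le> ((z k x)\<^sup>2 + 1) * (C / real N)"
        proof (rule mult_mono)
          have "0 \<le> (\<bar>z k x\<bar> - 1)\<^sup>2" by simp
          then show "\<bar>2 * z k x\<bar> \<le> (z k x)\<^sup>2 + 1" by (simp add: power2_diff abs_mult)
        qed (use drift[OF x] Td in auto)
        finally show "2 * z k x * T d x \<le> ((z k x)\<^sup>2 + 1) * (C / real N)" .
        have "T (\<lambda>y. (d y)\<^sup>2) x \<le> T (\<lambda>y. (lam + 2 * C + \<bar>h\<bar>)\<^sup>2) x"
        proof (rule T_mono)
          fix y assume xy: "step x y"
          have "\<bar>d y\<bar> \<le> lam + 2 * C + \<bar>h\<bar>"
            using gf[OF x] gf[OF lang_step[OF x xy]] green_dist_step[OF x xy] unfolding d_def by linarith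
          then show "(d y)\<^sup>2 \<le> (lam + 2 * C + \<bar>h\<bar>)\<^sup>2" by (rule power2_le_iff_abs_le[THEN iffD2, rotated]) (use C lam_nonneg in auto)
        qed
        then show "T (\<lambda>y. (d y)\<^sup>2) x \<le> (lam + 2 * C + \<bar>h\<bar>)\<^sup>2" by simp
      qed
      also have "\<dots> \<le> (1 + C / real N) * (z k x)\<^sup>2 + D"
      proof -
        have "C / real N \<le> C" using False C(1) by (simp add: field_simps mult_le_cancel_left1)
        then show ?thesis by (simp add: D_def algebra_simps)
      qed
      finally show ?thesis .
    qed
    define M where "M k = (T ^^ k) (\<lambda>x. (z k x)\<^sup>2) []" for k
    have M_Suc: "M (Suc k) \<le> (1 + C / real N) * M k + D" for k
    proof -
      have "M (Suc k) = (T ^^ k) (T (\<lambda>x. (z (Suc k) x)\<^sup>2)) []"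
        unfolding M_def funpow_Suc_right by simp
      also have "\<dots> \<le> (T ^^ k) (\<lambda>x. (1 + C / real N) * (z k x)\<^sup>2 + D) []"
        by (rule Tn_mono[OF closed_lang _ Nil_lang]) (rule step_z)
      finally show ?thesis unfolding Tn_add Tn_cmult M_def by simp
    qed
    \<comment> \<open>The drift error per step is of order \<open>1 / N\<close>, so over
      \<open>N\<close> steps this factor compounds to at most \<open>exp C\<close>.\<close>
    define a where "a = 1 + C / real N"
    have a: "1 \<le> a" using C(1) by (simp add: a_def)
    have "M k \<le> real k * D * a ^ k" for k
    proof (induction k)
      case 0
      show ?case by (simp add: M_def z_def)
    next
      case (Suc k)
      have "M (Suc k) \<le> a * M k + D" using M_Suc[of k] by (simp add: a_def)
      also have "\<dots> \<le> a * (real k * D * a ^ k) + D * a ^ Suc k"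
        using Suc a D mult_left_mono[OF one_le_power[OF a, of "Suc k"] D]
        by (intro add_mono mult_left_mono) auto
      finally show ?case by (simp add: algebra_simps)
    qed
    then have "M N \<le> real N * D * a ^ N" .
    also have "\<dots> \<le> real N * D * exp C"
      using exp_ge_one_plus_x_over_n_power_n[of N C] False C(1) D unfolding a_def
      by (intro mult_left_mono) auto
    finally have MN: "M N \<le> real N * D * exp C" .
    have "(T ^^ N) (\<lambda>x. (green_dist x - real N * h)\<^sup>2) []
        \<le> (T ^^ N) (\<lambda>x. 4 * (z N x)\<^sup>2 + (16 * C\<^sup>2 + 2 * (green_dist [])\<^sup>2)) []"
    proof (rule Tn_mono[OF closed_lang _ Nil_lang])
      fix x assume x: "x \<in> lang"
      define u where "u = green_dist x - real N * h - green_dist []"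
      have sq: "(p + r)\<^sup>2 \<le> 2 * p\<^sup>2 + 2 * r\<^sup>2" for p r :: real
        using zero_le_power2[of "p - r"] by (simp add: power2_eq_square algebra_simps)
      have "\<bar>u - z N x\<bar> \<le> \<bar>2 * C\<bar>"
        using gf[OF x] gf[OF Nil_lang] C(1) unfolding u_def z_def by linarith
      then have "(u - z N x)\<^sup>2 \<le> (2 * C)\<^sup>2" by (simp only: abs_le_square_iff)
      then have "u\<^sup>2 \<le> 2 * (z N x)\<^sup>2 + 8 * C\<^sup>2"
        using sq[of "z N x" "u - z N x"] by (simp add: power_mult_distrib)
      then show "(green_dist x - real N * h)\<^sup>2 \<le> 4 * (z N x)\<^sup>2 + (16 * C\<^sup>2 + 2 * (green_dist [])\<^sup>2)"
        using sq[of u "green_dist []"] by (simp add: u_def)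
    qed
    also have "\<dots> = 4 * M N + (16 * C\<^sup>2 + 2 * (green_dist [])\<^sup>2)"
      unfolding Tn_add Tn_cmult by (simp add: M_def)
    also have "\<dots> \<le> 4 * (real N * D * exp C) + (16 * C\<^sup>2 + 2 * (green_dist [])\<^sup>2)" using MN by simp
    also have "\<dots> \<le> K * (real N + 1)"
      using D N by (simp add: K_def algebra_simps)
    finally show ?thesis .
  qed
  then show ?thesis by blast
qed

text \<open>Contraction gives \<open>pn k [] x \<le> \<rho> ^ k / eps ^ n\<close>, while a path of
  length \<open>n\<close> gives \<open>green [] x \<ge> eps ^ n\<close>; for large \<open>K\<close>
  the tail beyond \<open>K * n\<close> is at most half of the Green function.\<close>

lemma green_le_truncated:
  "\<exists>K. \<forall>n\<ge>1. \<forall>x. 0 < pn n [] x \<longrightarrow> green [] x \<le> 2 * (\<Sum>k\<le>K * n. pn k [] x)"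
proof -
  obtain \<phi> \<rho> where \<rho>: "0 < \<rho>" "\<rho> < 1" and \<phi>: "\<And>x. x \<in> lang \<Longrightarrow> 0 < \<phi> x \<and> T \<phi> x \<le> \<rho> * \<phi> x"
    using exists_contracted by blast
  \<comment> \<open>The factor \<open>1 - \<rho>\<close> cancels the sum of the geometric series and
    the 2 leaves the half.\<close>
  define \<delta> where "\<delta> = (1 - \<rho>) / 2"
  have \<delta>: "0 < \<delta>" "\<delta> < 1" using \<rho> by (auto simp: \<delta>_def)
  have "0 < eps * eps * \<delta>" using eps \<delta> by simp
  \<comment> \<open>One \<open>eps\<close> per step offsets the denominator in the upper bound, the
    other matches the lower bound of the Green function.\<close>
  then obtain K where K: "\<rho> ^ K < eps * eps * \<delta>" using real_arch_pow_inv[OF _ \<rho>(2)] by blast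
  have "green [] x \<le> 2 * (\<Sum>k\<le>K * n. pn k [] x)" if n: "1 \<le> n" and pos: "0 < pn n [] x" for n x
  proof -
    have path: "(step ^^ n) [] x" by (rule pn_pos_path[OF pos])
    have x: "x \<in> lang" by (rule lang_path[OF Nil_lang path])
    have en: "0 < eps ^ n" by (rule eps_power)
    have \<phi>0: "0 < \<phi> []" and \<phi>x: "0 < \<phi> x" using \<phi> x by auto
    have "eps ^ n * \<phi> [] \<le> (T ^^ n) \<phi> x"
      by (rule Tn_ge_path[OF closed_lang _ x step_pow_sym[OF path]]) (use \<phi> in \<open>auto intro: less_imp_le\<close>)
    also have "\<dots> \<le> \<rho> ^ n * \<phi> x" by (rule Tn_contract[OF _ _ x]) (use \<phi> \<rho> in auto)
    also have "\<dots> \<le> 1 * \<phi> x" using \<rho> \<phi>x by (intro mult_right_mono power_le_one) auto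
    finally have lower: "eps ^ n * \<phi> [] \<le> \<phi> x" by simp
    have bound: "pn k [] x \<le> \<rho> ^ k / eps ^ n" for k
    proof -
      have "\<phi> x * pn k [] x = (T ^^ k) (\<lambda>y. \<phi> x * ind x y) []" by (simp add: Tn_cmult pn_def)
      also have "\<dots> \<le> (T ^^ k) \<phi> []"
      proof (rule Tn_mono[OF closed_lang _ Nil_lang])
        fix y assume "y \<in> lang"
        then show "\<phi> x * ind x y \<le> \<phi> y" using \<phi>[of y] by (cases "y = x") auto
      qed
      also have "\<dots> \<le> \<rho> ^ k * \<phi> []" by (rule Tn_contract) (use \<phi> \<rho> in auto)
      finally have "eps ^ n * \<phi> [] * pn k [] x \<le> \<rho> ^ k * \<phi> []"
        using lower mult_right_mono[OF lower, of "pn k [] x"] by simp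
      then have "\<phi> [] * (pn k [] x * eps ^ n) \<le> \<phi> [] * \<rho> ^ k" by (simp add: mult_ac)
      then show ?thesis using \<phi>0 en by (simp add: field_simps)
    qed
    define m where "m = Suc (K * n)"
    have tail: "(\<Sum>k. pn (k + m) [] x) \<le> \<rho> ^ m / eps ^ n * (1 / (1 - \<rho>))"
    proof -
      have "(\<Sum>k. pn (k + m) [] x) \<le> (\<Sum>k. \<rho> ^ m / eps ^ n * \<rho> ^ k)"
      proof (rule suminf_le)
        show "pn (k + m) [] x \<le> \<rho> ^ m / eps ^ n * \<rho> ^ k" for k
          using bound[of "k + m"] by (simp add: power_add mult.commute)
        show "summable (\<lambda>k. pn (k + m) [] x)"
          by (rule summable_ignore_initial_segment[OF pn_summable[OF Nil_lang x]])
        show "summable (\<lambda>k. \<rho> ^ m / eps ^ n * \<rho> ^ k)"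
          using \<rho> by (intro summable_mult summable_geometric) simp
      qed
      also have "\<dots> = \<rho> ^ m / eps ^ n * (1 / (1 - \<rho>))"
        using suminf_mult[OF summable_geometric[of \<rho>], of "\<rho> ^ m / eps ^ n"]
          suminf_geometric[of \<rho>] \<rho> by simp
      finally show ?thesis .
    qed
    have "\<rho> ^ m \<le> (\<rho> ^ K) ^ n" using \<rho> unfolding m_def by (simp add: power_mult mult_left_le_one_le)
    also have "\<dots> \<le> (eps * eps * \<delta>) ^ n" using K \<rho> by (intro power_mono) auto
    also have "\<dots> = eps ^ n * eps ^ n * \<delta> ^ n" by (simp add: power_mult_distrib)
    also have "\<dots> \<le> eps ^ n * eps ^ n * \<delta> ^ 1"
      using n \<delta> en by (intro mult_left_mono power_decreasing) auto
    finally have "\<rho> ^ m / eps ^ n * (1 / (1 - \<rho>)) \<le> eps ^ n / 2"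
      using en \<rho> by (simp add: \<delta>_def field_simps)
    also have "\<dots> \<le> green [] x / 2"
      using pn_ge_path[OF path] pn_le_green[OF Nil_lang x, of n] by simp
    finally have "(\<Sum>k. pn (k + m) [] x) \<le> green [] x / 2" by (rule order.trans[OF tail])
    moreover have "green [] x = (\<Sum>k. pn (k + m) [] x) + (\<Sum>k<m. pn k [] x)"
      unfolding green_def by (rule suminf_split_initial_segment[OF pn_summable[OF Nil_lang x]])
    moreover have "(\<Sum>k<m. pn k [] x) = (\<Sum>k\<le>K * n. pn k [] x)"
      unfolding m_def by (simp only: lessThan_Suc_atMost)
    ultimately show ?thesis by simp
  qed
  then show ?thesis by blast
qed

end

section \<open>Markov chains and their kernels\<close>

locale markov = prob_space M for M :: "'b measure" +
  fixes X :: "nat \<Rightarrow> 'b \<Rightarrow> 's :: countable" and q :: "'s \<Rightarrow> 's \<Rightarrow> real" and s :: 's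
  assumes X_measurable [measurable]: "X n \<in> M \<rightarrow>\<^sub>M count_space UNIV"
    and X_init: "prob {\<omega>\<in>space M. X 0 \<omega> = s} = 1"
    and X_step: "prob {\<omega>\<in>space M. (\<forall>i\<le>n. X i \<omega> = x i) \<and> X (Suc n) \<omega> = v}
      = prob {\<omega>\<in>space M. \<forall>i\<le>n. X i \<omega> = x i} * q (x n) v"
begin

text \<open>Functional form of an event determined by the first \<open>n + 1\<close> positions;
  since \<open>Q\<close> accepts any sequence, a finite history can be inserted as
  \<open>(!) l\<close>.\<close>

definition past :: "nat \<Rightarrow> ((nat \<Rightarrow> 's) \<Rightarrow> bool) \<Rightarrow> bool" where
  "past n Q \<longleftrightarrow> (\<forall>x y. (\<forall>i\<le>n. x i = y i) \<longrightarrow> Q x = Q y)"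

lemma pastD: "past n Q \<Longrightarrow> (\<And>i. i \<le> n \<Longrightarrow> x i = y i) \<Longrightarrow> Q x = Q y"
  unfolding past_def by simp

lemma past_Suc:
  assumes "past n Q" shows "past (Suc n) (\<lambda>x. Q x \<and> x n = u)"
  unfolding past_def
proof (intro allI impI)
  fix x y :: "nat \<Rightarrow> 's" assume eq: "\<forall>i\<le>Suc n. x i = y i"
  have "Q x = Q y" by (rule pastD[OF assms]) (use eq in simp)
  then show "(Q x \<and> x n = u) = (Q y \<and> y n = u)" using eq by simp
qed

text \<open>The decomposition into countably many histories yields both measurability and, from
  \<open>X_step\<close>, the Markov property for general past events.\<close>

lemma past_event:
  assumes "past n Q"
  shows "{\<omega>\<in>space M. Q (\<lambda>i. X i \<omega>) \<and> X n \<omega> = u \<and> B \<omega>} =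
    (\<Union>l\<in>{l. length l = Suc n \<and> Q ((!) l) \<and> l ! n = u}. {\<omega>\<in>space M. (\<forall>i\<le>n. X i \<omega> = l ! i) \<and> B \<omega>})"
proof (intro set_eqI iffI)
  fix \<omega> assume \<omega>: "\<omega> \<in> {\<omega>\<in>space M. Q (\<lambda>i. X i \<omega>) \<and> X n \<omega> = u \<and> B \<omega>}"
  define l where "l = map (\<lambda>i. X i \<omega>) [0..<Suc n]"
  have l: "length l = Suc n" "\<And>i. i \<le> n \<Longrightarrow> l ! i = X i \<omega>"
    by (auto simp: l_def nth_map simp del: upt_Suc)
  have "Q ((!) l) = Q (\<lambda>i. X i \<omega>)" by (rule pastD[OF assms l(2)])
  then show "\<omega> \<in> (\<Union>l\<in>{l. length l = Suc n \<and> Q ((!) l) \<and> l ! n = u}.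
      {\<omega>\<in>space M. (\<forall>i\<le>n. X i \<omega> = l ! i) \<and> B \<omega>})"
    using \<omega> l by (intro UN_I[of l]) auto
next
  fix \<omega> assume "\<omega> \<in> (\<Union>l\<in>{l. length l = Suc n \<and> Q ((!) l) \<and> l ! n = u}.
      {\<omega>\<in>space M. (\<forall>i\<le>n. X i \<omega> = l ! i) \<and> B \<omega>})"
  then obtain l where l: "Q ((!) l)" "l ! n = u" "\<omega> \<in> space M" "\<forall>i\<le>n. X i \<omega> = l ! i" "B \<omega>" by auto
  have "Q (\<lambda>i. X i \<omega>) = Q ((!) l)" by (rule pastD[OF assms]) (use l(4) in simp)
  then show "\<omega> \<in> {\<omega>\<in>space M. Q (\<lambda>i. X i \<omega>) \<and> X n \<omega> = u \<and> B \<omega>}" using l by auto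
qed

lemma past_sets:
  assumes "past n Q" and [measurable]: "Measurable.pred M B"
  shows "{\<omega>\<in>space M. Q (\<lambda>i. X i \<omega>) \<and> X n \<omega> = u \<and> B \<omega>} \<in> sets M"
  unfolding past_event[OF assms(1)]
proof (rule sets.countable_UN'[OF countableI_type], safe)
  show "{\<omega>\<in>space M. (\<forall>i\<le>n. X i \<omega> = l ! i) \<and> B \<omega>} \<in> sets M" for l
    by measurable
qed

lemma markov_past:
  assumes "past n Q" and q: "0 \<le> q u v"
  shows "prob {\<omega>\<in>space M. Q (\<lambda>i. X i \<omega>) \<and> X n \<omega> = u \<and> X (Suc n) \<omega> = v}
    = prob {\<omega>\<in>space M. Q (\<lambda>i. X i \<omega>) \<and> X n \<omega> = u} * q u v"
proof -
  let ?I = "{l. length l = Suc n \<and> Q ((!) l) \<and> l ! n = u}"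
  have disj: "disjoint_family_on (\<lambda>l. {\<omega>\<in>space M. (\<forall>i\<le>n. X i \<omega> = l ! i) \<and> B \<omega>}) ?I" for B
    unfolding disjoint_family_on_def
  proof safe
    fix l l' \<omega> assume *: "length l = Suc n" "length l' = Suc n" "\<forall>i\<le>n. X i \<omega> = l ! i" "\<forall>i\<le>n. X i \<omega> = l' ! i"
      "l \<noteq> l'"
    have "l = l'" by (rule nth_equalityI) (use * in \<open>auto simp: less_Suc_eq_le\<close>)
    then show "\<omega> \<in> {}" using * by simp
  qed
  have sum: "emeasure M {\<omega>\<in>space M. Q (\<lambda>i. X i \<omega>) \<and> X n \<omega> = u \<and> B \<omega>}
      = (\<integral>\<^sup>+ l. emeasure M {\<omega>\<in>space M. (\<forall>i\<le>n. X i \<omega> = l ! i) \<and> B \<omega>} \<partial>count_space ?I)"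
    if [measurable]: "Measurable.pred M B" for B
    unfolding past_event[OF assms(1)]
    by (rule emeasure_UN_countable[OF _ _ disj]) (auto intro: countableI_type)
  have "emeasure M {\<omega>\<in>space M. Q (\<lambda>i. X i \<omega>) \<and> X n \<omega> = u \<and> X (Suc n) \<omega> = v}
      = (\<integral>\<^sup>+ l. emeasure M {\<omega>\<in>space M. (\<forall>i\<le>n. X i \<omega> = l ! i) \<and> X (Suc n) \<omega> = v} \<partial>count_space ?I)"
    by (rule sum) measurable
  also have "\<dots> = (\<integral>\<^sup>+ l. emeasure M {\<omega>\<in>space M. (\<forall>i\<le>n. X i \<omega> = l ! i) \<and> True} * ennreal (q u v) \<partial>count_space ?I)"
    by (intro nn_integral_cong) (use X_step q in \<open>simp add: emeasure_eq_measure ennreal_mult\<close>)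
  also have "\<dots> = emeasure M {\<omega>\<in>space M. Q (\<lambda>i. X i \<omega>) \<and> X n \<omega> = u \<and> True} * ennreal (q u v)"
    by (subst sum) (auto simp: nn_integral_multc)
  finally show ?thesis using q by (simp add: emeasure_eq_measure flip: ennreal_mult)
qed

lemma markov_step:
  "0 \<le> q u v \<Longrightarrow> prob {\<omega>\<in>space M. X n \<omega> = u \<and> X (Suc n) \<omega> = v} = prob {\<omega>\<in>space M. X n \<omega> = u} * q u v"
  using markov_past[of n "\<lambda>_. True" u v] by (simp add: past_def)

lemma AE_init: "AE \<omega> in M. X 0 \<omega> = s"
  using X_init by (subst (asm) prob_Collect_eq_1) auto

text \<open>The state space is countable, so the impossible transitions form a countable union of
  null events.\<close>

lemma AE_steps:
  assumes q: "\<And>u v. 0 \<le> q u v"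
  shows "AE \<omega> in M. \<forall>n. 0 < q (X n \<omega>) (X (Suc n) \<omega>)"
proof -
  have "AE \<omega> in M. \<not> (X n \<omega> = u \<and> X (Suc n) \<omega> = v)" if "q u v = 0" for n u v
    using markov_step[OF q, of n u v] that prob_Collect_eq_0[of "\<lambda>\<omega>. X n \<omega> = u \<and> X (Suc n) \<omega> = v"] by simp
  then have "AE \<omega> in M. \<forall>n u v. q u v = 0 \<longrightarrow> \<not> (X n \<omega> = u \<and> X (Suc n) \<omega> = v)"
    unfolding AE_all_countable by (auto simp: AE_impI)
  then show ?thesis
    by eventually_elim (use q in \<open>metis order_le_less\<close>)
qed

end

section \<open>The walk on words as a process\<close>

locale walk = word_kernel q + markov M X q s
  for q :: "'a::finite list \<Rightarrow> 'a list \<Rightarrow> real" and M :: "'b measure" and X s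
begin

lemma AE_path: "AE \<omega> in M. \<forall>n. step (X n \<omega>) (X (Suc n) \<omega>)"
  by (rule AE_steps) (rule q_nonneg)

lemma AE_walk: "AE \<omega> in M. X 0 \<omega> = s \<and> (\<forall>n. step (X n \<omega>) (X (Suc n) \<omega>))"
  using AE_init AE_path by eventually_elim auto

lemma prob_split_next:
  assumes "finite A" and sets: "\<And>y. {\<omega>\<in>space M. B \<omega> \<and> X m \<omega> = y} \<in> sets M"
    and AE: "AE \<omega> in M. B \<omega> \<longrightarrow> X m \<omega> \<in> A"
  shows "prob {\<omega>\<in>space M. B \<omega>} = (\<Sum>y\<in>A. prob {\<omega>\<in>space M. B \<omega> \<and> X m \<omega> = y})"
proof -
  have B: "{\<omega>\<in>space M. B \<omega>} \<in> sets M"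
  proof -
    have "{\<omega>\<in>space M. B \<omega>} = (\<Union>y. {\<omega>\<in>space M. B \<omega> \<and> X m \<omega> = y})" by auto
    then show ?thesis using sets by (auto intro: sets.countable_UN' countableI_type)
  qed
  have "prob {\<omega>\<in>space M. B \<omega>} = prob (\<Union>y\<in>A. {\<omega>\<in>space M. B \<omega> \<and> X m \<omega> = y})"
    by (rule finite_measure_eq_AE) (use AE B sets assms(1) in auto)
  also have "\<dots> = (\<Sum>y\<in>A. prob {\<omega>\<in>space M. B \<omega> \<and> X m \<omega> = y})"
    by (rule finite_measure_finite_Union) (use assms in \<open>auto simp: disjoint_family_on_def\<close>)
  finally show ?thesis .
qed

lemma prob_eq_pn: "prob {\<omega>\<in>space M. X n \<omega> = x} = pn n s x"
proof (induction n arbitrary: x)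
  case 0
  have "prob {\<omega>\<in>space M. X 0 \<omega> = x} = prob {\<omega>\<in>space M. s = x}"
    by (rule finite_measure_eq_AE) (use AE_init in auto)
  then show ?case using prob_space by (auto simp: ind_def)
next
  case (Suc n)
  have "prob {\<omega>\<in>space M. X (Suc n) \<omega> = x}
      = (\<Sum>z | step x z. prob {\<omega>\<in>space M. X (Suc n) \<omega> = x \<and> X n \<omega> = z})"
    by (rule prob_split_next) (use AE_path q_sym in auto)
  also have "\<dots> = (\<Sum>z | step x z. pn n s z * q z x)"
    using markov_step[OF q_nonneg, of n _ x] Suc by (intro sum.cong) (auto simp: conj_commute)
  finally show ?case by (simp add: pn_Suc_right)
qed

text \<open>Carrying an arbitrary past event \<open>Q\<close> lets the induction absorb the current
  position into the past and restart at time \<open>Suc j\<close>.\<close>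

lemma prob_visit:
  assumes "past j Q"
  shows "prob {\<omega>\<in>space M. (Q (\<lambda>i. X i \<omega>) \<and> X j \<omega> = x) \<and> (\<exists>k\<in>{Suc j..Suc j + n}. X k \<omega> = [])}
    = prob {\<omega>\<in>space M. Q (\<lambda>i. X i \<omega>) \<and> X j \<omega> = x} * T (visit n) x"
  using assms
proof (induction n arbitrary: j Q x)
  have split: "prob {\<omega>\<in>space M. (Q (\<lambda>i. X i \<omega>) \<and> X j \<omega> = x) \<and> (\<exists>k\<in>{Suc j..Suc j + n}. X k \<omega> = [])}
      = (\<Sum>y | step x y. prob {\<omega>\<in>space M. ((Q (\<lambda>i. X i \<omega>) \<and> X j \<omega> = x) \<and>
          (\<exists>k\<in>{Suc j..Suc j + n}. X k \<omega> = [])) \<and> X (Suc j) \<omega> = y})"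
    if "past j Q" for j Q x n
  proof (rule prob_split_next)
    show "{\<omega>\<in>space M. ((Q (\<lambda>i. X i \<omega>) \<and> X j \<omega> = x) \<and> (\<exists>k\<in>{Suc j..Suc j + n}. X k \<omega> = [])) \<and>
        X (Suc j) \<omega> = y} \<in> sets M" for y
      using past_sets[OF that, of "\<lambda>\<omega>. (\<exists>k\<in>{Suc j..Suc j + n}. X k \<omega> = []) \<and> X (Suc j) \<omega> = y" x]
      by (simp add: conj_assoc)
  qed (use AE_path in auto)
  have next_prob: "prob {\<omega>\<in>space M. (Q (\<lambda>i. X i \<omega>) \<and> X j \<omega> = x) \<and> X (Suc j) \<omega> = y}
      = prob {\<omega>\<in>space M. Q (\<lambda>i. X i \<omega>) \<and> X j \<omega> = x} * q x y" if "past j Q" for j Q x y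
    using markov_past[OF that q_nonneg, of x y] by (simp add: conj_assoc)
  {
    case 0
    have "prob {\<omega>\<in>space M. ((Q (\<lambda>i. X i \<omega>) \<and> X j \<omega> = x) \<and>
          (\<exists>k\<in>{Suc j..Suc j + 0}. X k \<omega> = [])) \<and> X (Suc j) \<omega> = y}
        = prob {\<omega>\<in>space M. Q (\<lambda>i. X i \<omega>) \<and> X j \<omega> = x} * q x y * visit 0 y" for y
    proof (cases "y = []")
      case True
      then show ?thesis using next_prob[OF 0, of x y] by (simp add: conj_ac cong: conj_cong)
    next
      case False
      then have eq: "{\<omega>\<in>space M. ((Q (\<lambda>i. X i \<omega>) \<and> X j \<omega> = x) \<and>
          (\<exists>k\<in>{Suc j..Suc j + 0}. X k \<omega> = [])) \<and> X (Suc j) \<omega> = y} = {}" by auto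
      show ?thesis unfolding eq using False by simp
    qed
    then show ?case unfolding split[OF 0] T_def by (simp add: sum_distrib_left mult.assoc)
  next
    case (Suc n)
    have "prob {\<omega>\<in>space M. ((Q (\<lambda>i. X i \<omega>) \<and> X j \<omega> = x) \<and>
          (\<exists>k\<in>{Suc j..Suc j + Suc n}. X k \<omega> = [])) \<and> X (Suc j) \<omega> = y}
        = prob {\<omega>\<in>space M. Q (\<lambda>i. X i \<omega>) \<and> X j \<omega> = x} * q x y * visit (Suc n) y" for y
    proof (cases "y = []")
      case True
      have "{\<omega>\<in>space M. ((Q (\<lambda>i. X i \<omega>) \<and> X j \<omega> = x) \<and>
          (\<exists>k\<in>{Suc j..Suc j + Suc n}. X k \<omega> = [])) \<and> X (Suc j) \<omega> = y}
        = {\<omega>\<in>space M. (Q (\<lambda>i. X i \<omega>) \<and> X j \<omega> = x) \<and> X (Suc j) \<omega> = y}"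
        using True by (auto intro!: bexI[of _ "Suc j"])
      then show ?thesis using next_prob[OF Suc.prems, of x y] True by simp
    next
      case False
      have "{\<omega>\<in>space M. ((Q (\<lambda>i. X i \<omega>) \<and> X j \<omega> = x) \<and>
          (\<exists>k\<in>{Suc j..Suc j + Suc n}. X k \<omega> = [])) \<and> X (Suc j) \<omega> = y}
        = {\<omega>\<in>space M. ((Q (\<lambda>i. X i \<omega>) \<and> X j \<omega> = x) \<and> X (Suc j) \<omega> = y) \<and>
          (\<exists>k\<in>{Suc (Suc j)..Suc (Suc j) + n}. X k \<omega> = [])}"
      proof -
        have "(\<exists>k\<in>{Suc j..Suc j + Suc n}. X k \<omega> = []) \<longleftrightarrow>
            (\<exists>k\<in>{Suc (Suc j)..Suc (Suc j) + n}. X k \<omega> = [])" if "X (Suc j) \<omega> = y" for \<omega>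
          using that False by (simp add: atLeastAtMost_insertL[of "Suc j", symmetric])
        then show ?thesis by auto
      qed
      then have "prob {\<omega>\<in>space M. ((Q (\<lambda>i. X i \<omega>) \<and> X j \<omega> = x) \<and>
          (\<exists>k\<in>{Suc j..Suc j + Suc n}. X k \<omega> = [])) \<and> X (Suc j) \<omega> = y}
          = prob {\<omega>\<in>space M. (Q (\<lambda>i. X i \<omega>) \<and> X j \<omega> = x) \<and> X (Suc j) \<omega> = y} * T (visit n) y"
        using Suc.IH[OF past_Suc[OF Suc.prems], of x y] by simp
      then show ?thesis using next_prob[OF Suc.prems, of x y] False by simp
    qed
    then show ?case unfolding split[OF Suc.prems] T_def[of "visit (Suc n)"]
      by (simp add: sum_distrib_left mult.assoc)
  }
qed

lemma return_prob:
  assumes "s = []"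
  shows "T (visit n) [] \<le> prob {\<omega>\<in>space M. \<exists>n\<ge>1. X n \<omega> = []}"
proof -
  have "T (visit n) [] = prob {\<omega>\<in>space M. (True \<and> X 0 \<omega> = []) \<and> (\<exists>k\<in>{Suc 0..Suc 0 + n}. X k \<omega> = [])}"
    using prob_visit[of 0 "\<lambda>_. True" "[]" n] X_init assms by (simp add: past_def)
  also have "\<dots> \<le> prob {\<omega>\<in>space M. \<exists>n\<ge>1. X n \<omega> = []}"
    by (rule finite_measure_mono) auto
  finally show ?thesis .
qed

text \<open>Turns an event of positive probability into a single trajectory with only possible
  steps. Measurability of the event is automatic, since \<open>measure\<close> vanishes on
  non-measurable sets.\<close>

lemma obtain_path:
  assumes "0 < prob {\<omega>\<in>space M. B \<omega>}"
  obtains \<omega> where "B \<omega>" "X 0 \<omega> = s" "\<And>n. step (X n \<omega>) (X (Suc n) \<omega>)"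
proof -
  have "\<not> (AE \<omega> in M. \<not> B \<omega>)"
  proof
    assume *: "AE \<omega> in M. \<not> B \<omega>"
    have "{\<omega>\<in>space M. B \<omega>} \<in> sets M" using assms by (metis measure_notin_sets order_less_irrefl)
    then have "prob {\<omega>\<in>space M. B \<omega>} = 0" using * by (subst prob_Collect_eq_0)
    then show False using assms by simp
  qed
  then show ?thesis using AE_walk that by (metis (mono_tags, lifting) AE_mp AE_I2)
qed

end

section \<open>From the random walk to its kernel\<close>

lemma markov_chain_iff: "markov_chain M X q s \<longleftrightarrow> markov M X q s"
  unfolding markov_chain_def markov_def markov_axioms_def by auto

text \<open>The kernel is recovered as the law of the position after one step, so nonnegativity,
  total mass one and symmetry come from the measures \<open>P x\<close>; the rules on prefixes and
  lengths come from the definition of \<open>step_prob\<close>.\<close>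

lemma regular_language_walk_kernel:
  fixes P :: "'a::finite list \<Rightarrow> 'b measure"
  assumes rw: "regular_language_walk P X p" and ws: "weakly_symmetric P X"
  shows "word_kernel (step_prob p)"
    and "step_prob p x y = measure (P x) {\<omega>\<in>space (P x). X 1 \<omega> = y}"
proof -
  have mc: "markov (P x) X (step_prob p) x" for x
    using rw unfolding regular_language_walk_def markov_chain_iff by blast
  show eq: "step_prob p x y = measure (P x) {\<omega>\<in>space (P x). X 1 \<omega> = y}" for x y
  proof -
    interpret markov "P x" X "step_prob p" x by (rule mc)
    have "step_prob p x y = prob {\<omega>\<in>space (P x). X 0 \<omega> = x \<and> X 1 \<omega> = y}"
      using X_step[of 0 "\<lambda>_. x" y] X_init by simp
    also have "\<dots> = prob {\<omega>\<in>space (P x). X 1 \<omega> = y}"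
      by (rule finite_measure_eq_AE) (use AE_init in auto)
    finally show ?thesis .
  qed
  have nn: "0 \<le> step_prob p x y" for x y unfolding eq by simp
  have len: "length y \<le> Suc (length x)" if "step_prob p x y > 0" for x y
    using that by (auto simp: step_prob_def Let_def split: if_splits)
  show "word_kernel (step_prob p)"
  proof
    show "0 \<le> step_prob p x y" for x y by (rule nn)
    show "length y \<le> Suc (length x)" if "step_prob p x y > 0" for x y by (rule len[OF that])
    show "(\<Sum>y | step_prob p x y > 0. step_prob p x y) = 1" for x
    proof -
      interpret markov "P x" X "step_prob p" x by (rule mc)
      have fin: "finite {y. step_prob p x y > 0}"
        by (rule finite_subset[OF _ finite_lists_length_le[of UNIV "Suc (length x)"]]) (auto dest: len)
      have "(\<Sum>y | step_prob p x y > 0. step_prob p x y)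
          = (\<Sum>y | step_prob p x y > 0. prob {\<omega>\<in>space (P x). X 1 \<omega> = y})" by (simp add: eq)
      also have "\<dots> = prob (\<Union>y\<in>{y. step_prob p x y > 0}. {\<omega>\<in>space (P x). X 1 \<omega> = y})"
        by (rule finite_measure_finite_Union[symmetric])
          (use fin in \<open>auto simp: disjoint_family_on_def\<close>)
      also have "\<dots> = prob (space (P x))"
      proof (rule finite_measure_eq_AE)
        show "AE \<omega> in P x. \<omega> \<in> (\<Union>y\<in>{y. step_prob p x y > 0}. {\<omega>\<in>space (P x). X 1 \<omega> = y})
            \<longleftrightarrow> \<omega> \<in> space (P x)"
          using AE_init AE_steps[OF nn] by eventually_elim (auto dest: spec[of _ 0])
      qed (use fin in auto)
      finally show ?thesis by (simp add: prob_space)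
    qed
    show "step_prob p (w @ x) (w @ y) = step_prob p x y" if "2 \<le> length x" for w x y
      using that by (auto simp: step_prob_def Let_def)
    show "\<exists>y. z = w @ y" if "2 \<le> length x" "step_prob p (w @ x) z > 0" for w x z
    proof -
      let ?m = "length (w @ x) - 2"
      have "take ?m z = take ?m (w @ x)"
        using that(2) by (auto simp: step_prob_def Let_def split: if_splits)
      then have "take (length w) (take ?m z) = take (length w) (take ?m (w @ x))" by simp
      moreover have "length w \<le> ?m" using that(1) by simp
      ultimately have "take (length w) z = w" by (simp add: min_def)
      then show ?thesis by (metis append_take_drop_id)
    qed
    show "step_prob p y x > 0" if "step_prob p x y > 0" for x y
      using that ws unfolding eq weakly_symmetric_def by blast
  qed
qed

lemma regular_language_walk_transient_kernel:
  fixes P :: "'a::finite list \<Rightarrow> 'b measure"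
  assumes rw: "regular_language_walk P X p" and ws: "weakly_symmetric P X"
    and tr: "transient P X" and si: "suffix_irreducible P X"
  shows "transient_kernel (step_prob p)"
proof -
  interpret word_kernel "step_prob p" by (rule regular_language_walk_kernel[OF rw ws])
  have walk: "walk (step_prob p) (P x) X x" for x
    using rw unfolding regular_language_walk_def markov_chain_iff walk_def
    by (auto intro: word_kernel_axioms)
  interpret o: walk "step_prob p" "P []" X "[]" by (rule walk)
  have acc: "x \<in> accessible_words P X" if x: "x \<in> lang" for x
  proof -
    obtain n where "(step ^^ n) [] x" using lang_obtain_path[OF x] by blast
    then have "0 < pn n [] x" using pn_ge_path eps_power(1)[of n] by (metis order_less_le_trans)
    then show ?thesis unfolding accessible_words_def using o.prob_eq_pn[of n x] by (auto intro!: exI[of _ n])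
  qed
  show ?thesis
  proof
    have "measure (P []) {\<omega>\<in>space (P []). \<exists>n\<ge>1. X n \<omega> = []} < 1"
      using tr acc[OF Nil_lang] unfolding transient_def by blast
    then show "summable (\<lambda>n. pn n [] [])"
      using summable_if_return_less_one[OF o.return_prob[OF refl]] by blast
    show "\<exists>w'. cstep\<^sup>*\<^sup>* [c, d] (w' @ [a, b])" if w: "w @ [c, d] \<in> lang" for w c d a b
    proof -
      obtain n w' where n: "0 < measure (P (w @ [c, d])) {\<omega>\<in>space (P (w @ [c, d])).
          X n \<omega> = w @ w' @ [a, b] \<and> (\<forall>k\<le>n. length (w @ [c, d]) \<le> length (X k \<omega>))}"
        using si acc[OF w] unfolding suffix_irreducible_def by blast
      interpret w: walk "step_prob p" "P (w @ [c, d])" X "w @ [c, d]" by (rule walk)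
      obtain \<omega> where \<omega>: "X n \<omega> = w @ w' @ [a, b]" "\<forall>k\<le>n. length (w @ [c, d]) \<le> length (X k \<omega>)"
          "X 0 \<omega> = w @ [c, d]" and st: "\<And>n. step (X n \<omega>) (X (Suc n) \<omega>)"
        using w.obtain_path[OF n] by metis
      \<comment> \<open>All words up to time \<open>n\<close> are at least as long as
        \<open>w @ [c, d]\<close>, so the prefix \<open>w\<close> stays untouched and can be
        stripped off.\<close>
      have "\<exists>u. X k \<omega> = w @ u \<and> cstep\<^sup>*\<^sup>* [c, d] u" if "k \<le> n" for k
        using that
      proof (induction k)
        case 0
        then show ?case using \<omega>(3) by auto
      next
        case (Suc k)
        then obtain u where u: "X k \<omega> = w @ u" "cstep\<^sup>*\<^sup>* [c, d] u" by auto
        have lu: "2 \<le> length u" using \<omega>(2)[rule_format, of k] Suc.prems u(1) by simp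
        obtain u' where u': "X (Suc k) \<omega> = w @ u'" using q_prefix[OF lu] st[of k] u(1) by metis
        have "cstep u u'" using st[of k] \<omega>(2)[rule_format, OF Suc.prems] lu u(1) u' q_shift[OF lu, of w u']
          by (simp add: cstep_def)
        then show ?case using u u' by auto
      qed
      from this[OF order.refl] show ?thesis using \<omega>(1) by auto
    qed
  qed
qed

section \<open>Convergence of the information rates\<close>

text \<open>Between \<open>k\<^sup>2\<close> and the next square \<open>v\<close> moves by at most
  \<open>2 * k * c\<close>, which is small compared with \<open>k\<^sup>2\<close>.\<close>

lemma linear_interpolation_squares:
  fixes v :: "nat \<Rightarrow> real"
  assumes incr: "\<And>n. \<bar>v (Suc n) - v n\<bar> \<le> c"
    and sq: "(\<lambda>k. v ((Suc k)\<^sup>2) / real ((Suc k)\<^sup>2)) \<longlonglongrightarrow> 0"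
  shows "(\<lambda>n. v n / real n) \<longlonglongrightarrow> 0"
proof -
  have c: "0 \<le> c" using incr[of 0] by simp
  have diff: "\<bar>v (n + d) - v n\<bar> \<le> real d * c" for n d
  proof (induction d)
    case (Suc d)
    then show ?case using incr[of "n + d"] by (simp add: algebra_simps)
  qed simp
  define g where "g k = \<bar>v (k\<^sup>2) / real (k\<^sup>2)\<bar> + 2 * c / real k" for k
  have "(\<lambda>k. v (k\<^sup>2) / real (k\<^sup>2)) \<longlonglongrightarrow> 0" by (rule LIMSEQ_imp_Suc) (rule sq)
  then have "g \<longlonglongrightarrow> \<bar>0\<bar> + 0"
    unfolding g_def[abs_def] by (intro tendsto_add tendsto_rabs lim_const_over_n)
  then have g: "g \<longlonglongrightarrow> 0" by simp
  have "filterlim floor_sqrt at_top sequentially"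
    unfolding filterlim_at_top eventually_sequentially
    by (intro allI exI[of _ "_\<^sup>2"]) (auto intro: le_floor_sqrtI)
  then have lim: "(\<lambda>n. g (floor_sqrt n)) \<longlonglongrightarrow> 0" by (rule filterlim_compose[OF g])
  have "norm (v n / real n) \<le> g (floor_sqrt n)" if "1 \<le> n" for n
  proof -
    define k where "k = floor_sqrt n"
    have k: "0 < k" "k\<^sup>2 \<le> n" "n < (Suc k)\<^sup>2"
      using that Suc_floor_sqrt_power2_gt[of n] by (auto simp: k_def)
    have n: "0 < real n" using that by simp
    have k2: "0 < real (k\<^sup>2)" using k by simp
    have "(Suc k)\<^sup>2 = k\<^sup>2 + 2 * k + 1" by (simp add: power2_eq_square)
    then have "n - k\<^sup>2 \<le> 2 * k" using k by linarith
    then have le: "real (n - k\<^sup>2) \<le> 2 * real k" by linarith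
    have "\<bar>v n\<bar> \<le> \<bar>v (k\<^sup>2)\<bar> + real (n - k\<^sup>2) * c" using diff[of "k\<^sup>2" "n - k\<^sup>2"] k by simp
    also have "\<dots> \<le> \<bar>v (k\<^sup>2)\<bar> + 2 * real k * c"
      using mult_right_mono[OF le c] by simp
    finally have "\<bar>v n\<bar> / real n \<le> (\<bar>v (k\<^sup>2)\<bar> + 2 * real k * c) / real n"
      using n by (intro divide_right_mono) auto
    also have "\<dots> \<le> (\<bar>v (k\<^sup>2)\<bar> + 2 * real k * c) / real (k\<^sup>2)"
      using k k2 c n by (intro divide_left_mono) (simp_all only: of_nat_le_iff, auto)
    also have "\<dots> = g k" using k by (simp add: g_def add_divide_distrib power2_eq_square)
    finally show ?thesis by (simp add: k_def)
  qed
  then show ?thesis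
    by (intro Lim_null_comparison[OF _ lim]) (auto simp: eventually_sequentially)
qed

section \<open>Convergence criteria in a probability space\<close>

context prob_space
begin

text \<open>The sum of all \<open>u k\<close> has finite expectation, hence is finite almost surely,
  and then its terms tend to zero.\<close>

lemma AE_tendsto_zero_if_summable:
  fixes u :: "nat \<Rightarrow> 'a \<Rightarrow> real"
  assumes int: "\<And>k. integrable M (u k)" and nn: "\<And>k \<omega>. 0 \<le> u k \<omega>"
    and sum: "summable (\<lambda>k. expectation (u k))"
  shows "AE \<omega> in M. (\<lambda>k. u k \<omega>) \<longlonglongrightarrow> 0"
proof -
  have [measurable]: "u k \<in> borel_measurable M" for k using int by auto
  have "(\<integral>\<^sup>+ \<omega>. (\<Sum>k. ennreal (u k \<omega>)) \<partial>M) = (\<Sum>k. \<integral>\<^sup>+ \<omega>. ennreal (u k \<omega>) \<partial>M)"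
    by (rule nn_integral_suminf) measurable
  also have "\<dots> = (\<Sum>k. ennreal (expectation (u k)))"
    using nn by (simp add: nn_integral_eq_integral[OF int])
  also have "\<dots> = ennreal (\<Sum>k. expectation (u k))"
    by (rule suminf_ennreal2[OF _ sum]) (simp add: nn)
  finally have "(\<integral>\<^sup>+ \<omega>. (\<Sum>k. ennreal (u k \<omega>)) \<partial>M) \<noteq> \<infinity>" by simp
  then have "AE \<omega> in M. (\<Sum>k. ennreal (u k \<omega>)) \<noteq> \<infinity>"
    by (intro nn_integral_PInf_AE) measurable
  then show ?thesis
  proof eventually_elim
    case (elim \<omega>)
    have "summable (\<lambda>k. u k \<omega>)"
      by (rule summable_suminf_not_top) (use nn elim in auto)
    then show ?case by (rule summable_LIMSEQ_zero)
  qed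
qed

text \<open>As \<open>F\<close> lies below \<open>Y\<close>, their mean distance is the gap of
  expectations, which gives convergence in mean. The lower limit is bounded below through
  \<open>F\<close> and above through a subsequence of \<open>Y\<close> that converges almost
  surely.\<close>

lemma sandwich_convergence:
  fixes Y F :: "nat \<Rightarrow> 'a \<Rightarrow> real"
  assumes Y: "\<And>n. integrable M (Y n)" and F: "\<And>n. integrable M (F n)"
    and le: "AE \<omega> in M. \<forall>n\<ge>1. F n \<omega> \<le> Y n \<omega>"
    and gap: "(\<lambda>n. expectation (Y n) - expectation (F n)) \<longlonglongrightarrow> 0"
    and F_lim: "AE \<omega> in M. (\<lambda>n. F n \<omega>) \<longlonglongrightarrow> h"
    and F_L1: "(\<lambda>n. expectation (\<lambda>\<omega>. \<bar>F n \<omega> - h\<bar>)) \<longlonglongrightarrow> 0"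
  shows "(AE \<omega> in M. ereal h = liminf (\<lambda>n. ereal (Y n \<omega>)))
    \<and> converges_in_probability M Y h \<and> converges_in_L1 M Y h"
proof -
  have [measurable]: "Y n \<in> borel_measurable M" "F n \<in> borel_measurable M" for n
    using Y F by auto
  have intY: "integrable M (\<lambda>\<omega>. \<bar>Y n \<omega> - h\<bar>)" and intF: "integrable M (\<lambda>\<omega>. \<bar>F n \<omega> - h\<bar>)" for n
    using Y F by auto
  have bound: "expectation (\<lambda>\<omega>. \<bar>Y n \<omega> - h\<bar>)
      \<le> (expectation (Y n) - expectation (F n)) + expectation (\<lambda>\<omega>. \<bar>F n \<omega> - h\<bar>)" if "1 \<le> n" for n
  proof -
    have "expectation (\<lambda>\<omega>. \<bar>Y n \<omega> - h\<bar>) \<le> expectation (\<lambda>\<omega>. (Y n \<omega> - F n \<omega>) + \<bar>F n \<omega> - h\<bar>)"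
    proof (rule integral_mono_AE)
      show "AE \<omega> in M. \<bar>Y n \<omega> - h\<bar> \<le> (Y n \<omega> - F n \<omega>) + \<bar>F n \<omega> - h\<bar>"
        using le
      proof eventually_elim
        case (elim \<omega>)
        then have "F n \<omega> \<le> Y n \<omega>" using that by blast
        then show ?case by linarith
      qed
    qed (use intY intF Y F in auto)
    then show ?thesis using intF Y F by simp
  qed
  have L1: "(\<lambda>n. expectation (\<lambda>\<omega>. \<bar>Y n \<omega> - h\<bar>)) \<longlonglongrightarrow> 0"
  proof (rule tendsto_sandwich[OF _ _ tendsto_const])
    show "(\<lambda>n. (expectation (Y n) - expectation (F n)) + expectation (\<lambda>\<omega>. \<bar>F n \<omega> - h\<bar>)) \<longlonglongrightarrow> 0"
      using tendsto_add[OF gap F_L1] by simp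
  qed (use bound in \<open>auto simp: eventually_sequentially\<close>)
  have "(\<lambda>n. prob {\<omega>\<in>space M. \<epsilon> < \<bar>Y n \<omega> - h\<bar>}) \<longlonglongrightarrow> 0" if "0 < \<epsilon>" for \<epsilon>
  proof (rule tendsto_sandwich[OF _ _ tendsto_const])
    have "prob {\<omega>\<in>space M. \<epsilon> < \<bar>Y n \<omega> - h\<bar>} \<le> expectation (\<lambda>\<omega>. \<bar>Y n \<omega> - h\<bar>) / \<epsilon>" for n
    proof -
      have "prob {\<omega>\<in>space M. \<epsilon> < \<bar>Y n \<omega> - h\<bar>} \<le> prob {\<omega>\<in>space M. \<epsilon> \<le> \<bar>Y n \<omega> - h\<bar>}"
        by (rule finite_measure_mono) auto
      also have "\<dots> \<le> expectation (\<lambda>\<omega>. \<bar>Y n \<omega> - h\<bar>) / \<epsilon>"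
        by (rule integral_Markov_inequality_measure[OF intY, of "{}"]) (use that in auto)
      finally show ?thesis .
    qed
    then show "\<forall>\<^sub>F n in sequentially. prob {\<omega>\<in>space M. \<epsilon> < \<bar>Y n \<omega> - h\<bar>}
        \<le> expectation (\<lambda>\<omega>. \<bar>Y n \<omega> - h\<bar>) / \<epsilon>" by simp
    show "(\<lambda>n. expectation (\<lambda>\<omega>. \<bar>Y n \<omega> - h\<bar>) / \<epsilon>) \<longlonglongrightarrow> 0"
      using tendsto_divide[OF L1 tendsto_const[of \<epsilon>]] that by simp
  qed simp
  then have conv: "converges_in_probability M Y h" unfolding converges_in_probability_def by blast
  obtain r :: "nat \<Rightarrow> nat" where r: "strict_mono r" "AE \<omega> in M. (\<lambda>n. Y (r n) \<omega> - h) \<longlonglongrightarrow> 0"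
    using tendsto_L1_AE_subseq[of M "\<lambda>n \<omega>. Y n \<omega> - h"] Y L1 by (auto simp: real_norm_def)
  have "AE \<omega> in M. ereal h = liminf (\<lambda>n. ereal (Y n \<omega>))"
    using r(2) F_lim le
  proof eventually_elim
    case (elim \<omega>)
    have "(\<lambda>n. ereal (Y (r n) \<omega>)) \<longlonglongrightarrow> ereal h"
      using tendsto_add[OF elim(1) tendsto_const[of h]] by (intro tendsto_ereal) simp
    then have "liminf (\<lambda>n. ereal (Y (r n) \<omega>)) = ereal h" by (intro lim_imp_Liminf) auto
    moreover have "liminf (\<lambda>n. ereal (Y n \<omega>)) \<le> liminf ((\<lambda>n. ereal (Y n \<omega>)) \<circ> r)"
      by (rule liminf_subseq_mono[OF r(1)])
    ultimately have 1: "liminf (\<lambda>n. ereal (Y n \<omega>)) \<le> ereal h" by (simp add: o_def)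
    have "liminf (\<lambda>n. ereal (F n \<omega>)) = ereal h"
      using elim(2) by (intro lim_imp_Liminf tendsto_ereal) auto
    moreover have "liminf (\<lambda>n. ereal (F n \<omega>)) \<le> liminf (\<lambda>n. ereal (Y n \<omega>))"
      by (rule Liminf_mono) (use elim(3) in \<open>auto simp: eventually_sequentially\<close>)
    ultimately show ?case using 1 by (simp add: antisym)
  qed
  then show ?thesis using conv L1 Y unfolding converges_in_L1_def by blast
qed

end

section \<open>Entropy of the transient walk\<close>

locale transient_walk = transient_kernel q + walk q M X "[]"
  for q :: "'a::finite list \<Rightarrow> 'a list \<Rightarrow> real" and M :: "'b measure" and X
begin

lemma AE_paths: "AE \<omega> in M. \<forall>n. (step ^^ n) [] (X n \<omega>)"
  using AE_walk
proof eventually_elim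
  case (elim \<omega>)
  have "(step ^^ n) [] (X n \<omega>)" for n
  proof (induction n)
    case (Suc n)
    then show ?case using elim by (meson relpowp_Suc_I)
  qed (use elim in simp)
  then show ?case by blast
qed

text \<open>Up to a null set \<open>X n\<close> takes values in the finite set \<open>A\<close>, so
  integrability holds for every function of it.\<close>

lemma
  fixes \<phi> :: "'a list \<Rightarrow> real"
  shows integrable_walk: "integrable M (\<lambda>\<omega>. \<phi> (X n \<omega>))"
    and expectation_walk: "expectation (\<lambda>\<omega>. \<phi> (X n \<omega>)) = (T ^^ n) \<phi> []"
proof -
  define A where "A = {y :: 'a list. length y \<le> length ([] :: 'a list) + n}"
  have fin: "finite A" unfolding A_def by (rule finite_length_le)
  let ?S = "\<lambda>\<omega>. \<Sum>y\<in>A. \<phi> y * indicator {\<omega>\<in>space M. X n \<omega> = y} \<omega>"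
  have meas: "(\<lambda>\<omega>. \<phi> (X n \<omega>)) \<in> borel_measurable M"
    by (rule measurable_compose[OF X_measurable]) simp
  have AE: "AE \<omega> in M. ?S \<omega> = \<phi> (X n \<omega>)"
    using AE_paths AE_space
  proof eventually_elim
    case (elim \<omega>)
    have "X n \<omega> \<in> A" using path_length[of n "[]" "X n \<omega>"] elim by (simp add: A_def)
    moreover have "?S \<omega> = (\<Sum>y\<in>A. if y = X n \<omega> then \<phi> y else 0)"
      using elim by (intro sum.cong) (auto simp: indicator_def)
    ultimately show ?case using fin by simp
  qed
  have int: "integrable M ?S" by (intro Bochner_Integration.integrable_sum integrable_mult_right)
      (auto simp: emeasure_eq_measure)
  show "integrable M (\<lambda>\<omega>. \<phi> (X n \<omega>))"
    by (rule integrable_cong_AE_imp[OF int meas]) (use AE in auto)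
  have "expectation (\<lambda>\<omega>. \<phi> (X n \<omega>)) = expectation ?S"
    by (rule integral_cong_AE) (use AE meas in auto)
  also have "\<dots> = (\<Sum>y\<in>A. \<phi> y * prob {\<omega>\<in>space M. X n \<omega> = y})"
    by (subst Bochner_Integration.integral_sum) (auto simp: emeasure_eq_measure intro!: sum.cong)
  also have "\<dots> = (T ^^ n) \<phi> []"
    unfolding prob_eq_pn Tn_expand A_def by (simp add: mult.commute)
  finally show "expectation (\<lambda>\<omega>. \<phi> (X n \<omega>)) = (T ^^ n) \<phi> []" .
qed

text \<open>Gibbs' inequality against the average of \<open>pn k []\<close> over \<open>k \<le> K * n\<close>.\<close>

lemma entropy_le:
  assumes K: "\<forall>n\<ge>1. \<forall>x. 0 < pn n [] x \<longrightarrow> green [] x \<le> 2 * (\<Sum>k\<le>K * n. pn k [] x)"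
    and n: "1 \<le> n"
  shows "(T ^^ n) (\<lambda>x. - ln (pn n [] x)) [] \<le> (T ^^ n) green_dist [] + ln (2 * (real (K * n) + 1))"
proof -
  define A where "A = {y :: 'a list. length y \<le> length ([] :: 'a list) + n}"
  have fin: "finite A" unfolding A_def by (rule finite_length_le)
  define N where "N = real (K * n) + 1"
  have N: "0 < N" unfolding N_def by (rule add_nonneg_pos) simp_all
  define \<nu> where "\<nu> x = (\<Sum>k\<le>K * n. pn k [] x) / N" for x
  have \<nu>_nonneg: "0 \<le> \<nu> x" for x using N by (simp add: \<nu>_def sum_nonneg)
  \<comment> \<open>From \<open>ln t \<le> t - 1\<close> with \<open>t\<close> the ratio of
    \<open>\<nu> y\<close> to \<open>pn n [] y\<close>. Summed over \<open>A\<close>, the last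
    bracket contributes at most 0.\<close>
  have term_le: "pn n [] y * - ln (pn n [] y)
      \<le> pn n [] y * (green_dist y + ln (2 * N)) + (\<nu> y - pn n [] y)" for y
  proof (cases "pn n [] y = 0")
    case True
    then show ?thesis using \<nu>_nonneg by simp
  next
    case False
    then have p: "0 < pn n [] y" using pn_nonneg[of n "[]" y] by linarith
    have y: "y \<in> lang" by (rule lang_path[OF Nil_lang pn_pos_path[OF p]])
    have G: "0 < green [] y" by (rule green_pos[OF Nil_lang y])
    have "green [] y \<le> 2 * (\<Sum>k\<le>K * n. pn k [] y)" using K n p by blast
    then have le: "green [] y / (2 * N) \<le> \<nu> y" using N by (simp add: \<nu>_def field_simps)
    then have \<nu>: "0 < \<nu> y" using G N by (meson divide_pos_pos less_le_trans mult_pos_pos zero_less_numeral)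
    have "ln (green [] y / (2 * N)) \<le> ln (\<nu> y)" using le G N \<nu> by (subst ln_le_cancel_iff) auto
    then have "- ln (\<nu> y) \<le> green_dist y + ln (2 * N)" using G N by (simp add: ln_div green_dist_def)
    moreover have "ln (\<nu> y / pn n [] y) \<le> \<nu> y / pn n [] y - 1"
      using \<nu> p by (intro ln_le_minus_one) simp
    ultimately have "- ln (pn n [] y) \<le> green_dist y + ln (2 * N) + (\<nu> y / pn n [] y - 1)"
      using \<nu> p by (simp add: ln_div)
    then have "pn n [] y * - ln (pn n [] y) \<le> pn n [] y * (green_dist y + ln (2 * N) + (\<nu> y / pn n [] y - 1))"
      using p by (intro mult_left_mono) auto
    also have "\<dots> = pn n [] y * (green_dist y + ln (2 * N)) + (\<nu> y - pn n [] y)"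
      using p by (simp add: field_simps)
    finally show ?thesis .
  qed
  have total: "(\<Sum>y\<in>A. pn k [] y) \<le> 1" for k
  proof -
    have "(\<Sum>y\<in>A. pn k [] y) = (T ^^ k) (\<lambda>u. \<Sum>y\<in>A. ind y u) []"
      unfolding Tn_sum pn_def ..
    also have "\<dots> \<le> 1"
    proof (rule Tn_le_const[OF step_closed_UNIV])
      fix u :: "'a list"
      have "(\<Sum>y\<in>A. ind y u) = (\<Sum>y\<in>A. if y = u then 1 else 0)"
        by (intro sum.cong) (auto simp: ind_def)
      then show "(\<Sum>y\<in>A. ind y u) \<le> 1" using fin by simp
    qed simp
    finally show ?thesis .
  qed
  have "(\<Sum>y\<in>A. \<nu> y) = (\<Sum>k\<le>K * n. \<Sum>y\<in>A. pn k [] y) / N"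
    unfolding \<nu>_def sum_divide_distrib[symmetric] by (subst sum.swap) simp
  also have "\<dots> \<le> (\<Sum>k\<le>K * n. 1) / N"
    using N total by (intro divide_right_mono sum_mono) auto
  also have "\<dots> = 1" using N by (simp add: N_def)
  finally have \<nu>_total: "(\<Sum>y\<in>A. \<nu> y) \<le> 1" .
  have pn_total: "(\<Sum>y\<in>A. pn n [] y) = 1"
    using Tn_expand[of n "\<lambda>_. 1" "[]"] by (simp add: A_def)
  have "(T ^^ n) (\<lambda>x. - ln (pn n [] x)) [] = (\<Sum>y\<in>A. pn n [] y * - ln (pn n [] y))"
    unfolding Tn_expand A_def ..
  also have "\<dots> \<le> (\<Sum>y\<in>A. pn n [] y * (green_dist y + ln (2 * N)) + (\<nu> y - pn n [] y))"
    by (intro sum_mono term_le)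
  also have "\<dots> = (\<Sum>y\<in>A. pn n [] y * (green_dist y + ln (2 * N))) + ((\<Sum>y\<in>A. \<nu> y) - 1)"
    by (simp add: sum.distrib sum_subtractf pn_total)
  also have "\<dots> \<le> (\<Sum>y\<in>A. pn n [] y * (green_dist y + ln (2 * N)))" using \<nu>_total by simp
  also have "\<dots> = (T ^^ n) (\<lambda>y. green_dist y + ln (2 * N)) []" unfolding Tn_expand A_def ..
  also have "\<dots> = (T ^^ n) green_dist [] + ln (2 * N)" by (simp add: Tn_add)
  finally show ?thesis by (simp add: N_def)
qed

text \<open>The rate \<open>F\<close> of the Green distance is the lower function for
  \<open>sandwich_convergence\<close>; its mean square error of order \<open>1 / n\<close> gives
  both \<open>F_L1\<close> and \<open>F_lim\<close>.\<close>

lemma entropy_convergence: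
  defines "Y \<equiv> \<lambda>n \<omega>. - (1 / real n) * ln (pn n [] (X n \<omega>))"
  shows "\<exists>h. (\<lambda>n. expectation (Y n)) \<longlonglongrightarrow> h \<and> (AE \<omega> in M. ereal h = liminf (\<lambda>n. ereal (Y n \<omega>)))
    \<and> converges_in_probability M Y h \<and> converges_in_L1 M Y h"
proof -
  obtain h C where C: "0 \<le> C" "\<And>m w. w \<in> lang \<Longrightarrow> \<bar>(T ^^ m) green_dist w - green_dist w - real m * h\<bar> \<le> C"
    using increments_linear by blast
  obtain D' where D': "\<forall>N. (T ^^ N) (\<lambda>x. (green_dist x - real N * h)\<^sup>2) [] \<le> D' * (real N + 1)"
    using second_moment[OF C] by blast
  define D where "D = \<bar>D'\<bar>"
  have D0: "0 \<le> D" by (simp add: D_def)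
  have D: "(T ^^ N) (\<lambda>x. (green_dist x - real N * h)\<^sup>2) [] \<le> D * (real N + 1)" for N
    by (rule order.trans[OF D'[rule_format] mult_right_mono]) (auto simp: D_def)
  obtain K where K: "\<forall>n\<ge>1. \<forall>x. 0 < pn n [] x \<longrightarrow> green [] x \<le> 2 * (\<Sum>k\<le>K * n. pn k [] x)"
    using green_le_truncated by blast
  define F where "F n \<omega> = green_dist (X n \<omega>) / real n" for n \<omega>
  have Y_int: "integrable M (Y n)" for n
    unfolding Y_def by (rule integrable_walk)
  have F_int: "integrable M (F n)" for n
    unfolding F_def by (rule integrable_walk)
  have EF: "expectation (F n) = (T ^^ n) green_dist [] / real n" for n
    unfolding F_def by (simp add: expectation_walk)
  have EY: "expectation (Y n) = (T ^^ n) (\<lambda>x. - ln (pn n [] x)) [] / real n" for n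
  proof -
    have "expectation (Y n) = expectation (\<lambda>\<omega>. - ln (pn n [] (X n \<omega>)) / real n)"
      unfolding Y_def by simp
    then show ?thesis
      by (simp only: integral_divide_zero expectation_walk[of "\<lambda>x. - ln (pn n [] x)" n])
  qed
  have Y_ge: "AE \<omega> in M. \<forall>n\<ge>1. F n \<omega> \<le> Y n \<omega>"
    using AE_paths
  proof eventually_elim
    case (elim \<omega>)
    have "F n \<omega> \<le> Y n \<omega>" for n
    proof -
      have path: "(step ^^ n) [] (X n \<omega>)" using elim by blast
      have "0 < pn n [] (X n \<omega>)" using pn_ge_path[OF path] eps_power(1)[of n] by linarith
      moreover have "pn n [] (X n \<omega>) \<le> green [] (X n \<omega>)"
        by (rule pn_le_green[OF Nil_lang lang_path[OF Nil_lang path]])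
      ultimately have "green_dist (X n \<omega>) \<le> - ln (pn n [] (X n \<omega>))" by (simp add: green_dist_def)
      then have "green_dist (X n \<omega>) / real n \<le> - ln (pn n [] (X n \<omega>)) / real n" by (rule divide_right_mono) simp
      then show ?thesis by (simp add: F_def Y_def)
    qed
    then show ?case by blast
  qed
  have gap: "(\<lambda>n. expectation (Y n) - expectation (F n)) \<longlonglongrightarrow> 0"
  proof (rule tendsto_sandwich[OF _ _ tendsto_const])
    have "(\<lambda>n. ln (2 * (real K + 1)) / real n + ln (real n) / real n) \<longlonglongrightarrow> 0 + 0"
      by (intro tendsto_add lim_const_over_n lim_ln_over_n)
    then show "(\<lambda>n. ln (2 * (real K + 1)) / real n + ln (real n) / real n) \<longlonglongrightarrow> 0" by simp
    have "expectation (Y n) - expectation (F n) \<le> ln (2 * (real K + 1)) / real n + ln (real n) / real n"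
      if n: "1 \<le> n" for n
    proof -
      have "2 * (real (K * n) + 1) \<le> 2 * (real K + 1) * real n" using n by (simp add: algebra_simps)
      then have "ln (2 * (real (K * n) + 1)) \<le> ln (2 * (real K + 1) * real n)"
        using n by (subst ln_le_cancel_iff) (auto intro: add_nonneg_pos mult_pos_pos)
      also have "\<dots> = ln (2 * (real K + 1)) + ln (real n)" using n by (subst ln_mult) auto
      finally have "(T ^^ n) (\<lambda>x. - ln (pn n [] x)) [] - (T ^^ n) green_dist []
          \<le> ln (2 * (real K + 1)) + ln (real n)" using entropy_le[OF K n] by linarith
      then have "((T ^^ n) (\<lambda>x. - ln (pn n [] x)) [] - (T ^^ n) green_dist []) / real n
          \<le> (ln (2 * (real K + 1)) + ln (real n)) / real n" by (rule divide_right_mono) simp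
      then show ?thesis unfolding EY EF by (simp add: diff_divide_distrib add_divide_distrib)
    qed
    then show "\<forall>\<^sub>F n in sequentially. expectation (Y n) - expectation (F n)
        \<le> ln (2 * (real K + 1)) / real n + ln (real n) / real n"
      by (auto simp: eventually_sequentially)
    have "0 \<le> expectation (Y n) - expectation (F n)" if "1 \<le> n" for n
    proof -
      have "AE \<omega> in M. F n \<omega> \<le> Y n \<omega>" using Y_ge by eventually_elim (use that in blast)
      then show ?thesis using integral_mono_AE[OF F_int Y_int, of n n] by simp
    qed
    then show "\<forall>\<^sub>F n in sequentially. 0 \<le> expectation (Y n) - expectation (F n)"
      by (auto simp: eventually_sequentially)
  qed
  have sq_int: "integrable M (\<lambda>\<omega>. (F n \<omega> - h)\<^sup>2)" for n
    unfolding F_def by (rule integrable_walk)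
  have sq: "expectation (\<lambda>\<omega>. (F n \<omega> - h)\<^sup>2) \<le> 2 * D / real n" if n: "1 \<le> n" for n
  proof -
    have "F n \<omega> - h = (green_dist (X n \<omega>) - real n * h) / real n" for \<omega>
      using n by (simp add: F_def diff_divide_distrib)
    then have "expectation (\<lambda>\<omega>. (F n \<omega> - h)\<^sup>2) = expectation (\<lambda>\<omega>. (green_dist (X n \<omega>) - real n * h)\<^sup>2 / (real n)\<^sup>2)"
      by (simp only: power_divide)
    also have "\<dots> = (T ^^ n) (\<lambda>x. (green_dist x - real n * h)\<^sup>2) [] / (real n)\<^sup>2"
      by (simp only: integral_divide_zero expectation_walk[of "\<lambda>x. (green_dist x - real n * h)\<^sup>2" n])
    also have "\<dots> \<le> D * (real n + 1) / (real n)\<^sup>2" by (rule divide_right_mono[OF D]) simp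
    also have "\<dots> \<le> D * (2 * real n) / (real n)\<^sup>2"
      using n D0 by (intro divide_right_mono mult_left_mono) auto
    also have "\<dots> = 2 * D / real n" using n by (simp add: power2_eq_square)
    finally show ?thesis .
  qed
  \<comment> \<open>Nonnegativity of the variance bounds the first absolute moment by the root of
    the second.\<close>
  have F_L1: "(\<lambda>n. expectation (\<lambda>\<omega>. \<bar>F n \<omega> - h\<bar>)) \<longlonglongrightarrow> 0"
  proof (rule tendsto_sandwich[OF _ _ tendsto_const])
    have "(\<lambda>n. sqrt (2 * D / real n)) \<longlonglongrightarrow> sqrt 0"
      by (intro tendsto_real_sqrt lim_const_over_n)
    then show "(\<lambda>n. sqrt (2 * D / real n)) \<longlonglongrightarrow> 0" by simp
    have "expectation (\<lambda>\<omega>. \<bar>F n \<omega> - h\<bar>) \<le> sqrt (2 * D / real n)" if n: "1 \<le> n" for n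
    proof (rule real_le_rsqrt)
      have "0 \<le> variance (\<lambda>\<omega>. \<bar>F n \<omega> - h\<bar>)" by (rule variance_positive)
      also have "\<dots> = expectation (\<lambda>\<omega>. \<bar>F n \<omega> - h\<bar>\<^sup>2) - (expectation (\<lambda>\<omega>. \<bar>F n \<omega> - h\<bar>))\<^sup>2"
        by (rule variance_eq) (use F_int sq_int[of n] in auto)
      finally show "(expectation (\<lambda>\<omega>. \<bar>F n \<omega> - h\<bar>))\<^sup>2 \<le> 2 * D / real n" using sq[OF n] by simp
    qed
    then show "\<forall>\<^sub>F n in sequentially. expectation (\<lambda>\<omega>. \<bar>F n \<omega> - h\<bar>) \<le> sqrt (2 * D / real n)"
      by (auto simp: eventually_sequentially)
  qed simp
  \<comment> \<open>Along the squares the mean square errors are of order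
    \<open>1 / k\<^sup>2\<close>, hence summable; bounded increments fill the times in
    between.\<close>
  have "AE \<omega> in M. (\<lambda>k. (F ((Suc k)\<^sup>2) \<omega> - h)\<^sup>2) \<longlonglongrightarrow> 0"
  proof (rule AE_tendsto_zero_if_summable)
    have "summable (\<lambda>k. inverse (real (Suc k) ^ 2))"
      using inverse_power_summable[of 2, where 'a = real] by (subst summable_Suc_iff) simp
    then have "summable (\<lambda>k. 2 * D * inverse (real (Suc k) ^ 2))" by (rule summable_mult)
    then show "summable (\<lambda>k. expectation (\<lambda>\<omega>. (F ((Suc k)\<^sup>2) \<omega> - h)\<^sup>2))"
    proof (rule summable_comparison_test'[where N = 0])
      fix k :: nat
      show "norm (expectation (\<lambda>\<omega>. (F ((Suc k)\<^sup>2) \<omega> - h)\<^sup>2)) \<le> 2 * D * inverse (real (Suc k) ^ 2)"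
        using sq[of "(Suc k)\<^sup>2"] by (simp add: divide_inverse)
    qed
  qed (use sq_int in auto)
  then have F_lim: "AE \<omega> in M. (\<lambda>n. F n \<omega>) \<longlonglongrightarrow> h"
    using AE_paths AE_path
  proof eventually_elim
    case (elim \<omega>)
    define v where "v n = green_dist (X n \<omega>) - real n * h" for n
    have vF: "v n / real n = F n \<omega> - h" if "1 \<le> n" for n
      using that by (simp add: v_def F_def field_simps)
    have "(\<lambda>n. v n / real n) \<longlonglongrightarrow> 0"
    proof (rule linear_interpolation_squares)
      show "\<bar>v (Suc n) - v n\<bar> \<le> lam + \<bar>h\<bar>" for n
      proof -
        have "X n \<omega> \<in> lang" using elim(2) lang_path[OF Nil_lang] by blast
        then have "\<bar>green_dist (X n \<omega>) - green_dist (X (Suc n) \<omega>)\<bar> \<le> lam" using green_dist_step elim(3) by blast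
        moreover have "v (Suc n) - v n = green_dist (X (Suc n) \<omega>) - green_dist (X n \<omega>) - h"
          by (simp add: v_def algebra_simps)
        ultimately show ?thesis by linarith
      qed
      have "(\<lambda>k. sqrt ((F ((Suc k)\<^sup>2) \<omega> - h)\<^sup>2)) \<longlonglongrightarrow> sqrt 0" using elim(1) by (rule tendsto_real_sqrt)
      then have "(\<lambda>k. F ((Suc k)\<^sup>2) \<omega> - h) \<longlonglongrightarrow> 0" by (simp add: tendsto_rabs_zero_iff)
      then show "(\<lambda>k. v ((Suc k)\<^sup>2) / real ((Suc k)\<^sup>2)) \<longlonglongrightarrow> 0"
        using vF[of "(Suc k)\<^sup>2" for k] by simp
    qed
    then have "(\<lambda>n. F n \<omega> - h) \<longlonglongrightarrow> 0"
      by (rule Lim_transform_eventually) (use vF in \<open>auto simp: eventually_sequentially\<close>)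
    then show ?case by (simp add: LIM_zero_iff)
  qed
  note conv = sandwich_convergence[OF Y_int F_int Y_ge gap F_lim F_L1]
  \<comment> \<open>Convergence in mean passes to the expectations, which identifies
    \<open>h\<close> as the limit defining the entropy.\<close>
  have "(\<lambda>n. expectation (Y n) - h) \<longlonglongrightarrow> 0"
  proof (rule Lim_null_comparison)
    show "(\<lambda>n. expectation (\<lambda>\<omega>. \<bar>Y n \<omega> - h\<bar>)) \<longlonglongrightarrow> 0"
      using conv unfolding converges_in_L1_def by blast
    have "\<bar>expectation (Y n) - h\<bar> \<le> expectation (\<lambda>\<omega>. \<bar>Y n \<omega> - h\<bar>)" for n
    proof -
      have "expectation (Y n) - h = expectation (\<lambda>\<omega>. Y n \<omega> - h)"
        using Y_int[of n] by (simp add: prob_space)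
      then show ?thesis using integral_abs_bound[of M "\<lambda>\<omega>. Y n \<omega> - h"] by simp
    qed
    then show "\<forall>\<^sub>F n in sequentially. norm (expectation (Y n) - h) \<le> expectation (\<lambda>\<omega>. \<bar>Y n \<omega> - h\<bar>)"
      by simp
  qed
  then have "(\<lambda>n. expectation (Y n)) \<longlonglongrightarrow> h" by (simp add: LIM_zero_iff)
  then show ?thesis using conv by blast
qed

end

theorem corollary2p7:
  fixes P :: "'a::finite list \<Rightarrow> 'b measure"
    and X :: "nat \<Rightarrow> 'b \<Rightarrow> 'a list"
    and p :: "'a list \<Rightarrow> 'a list \<Rightarrow> real"
    and h :: real
  assumes "regular_language_walk P X p"
    and "transient P X"
    and "weakly_symmetric P X"
    and "suffix_irreducible P X"
  defines "h \<equiv> asymptotic_entropy P X"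
  shows "(AE \<omega> in P []. ereal h = liminf (\<lambda>n. ereal (information_rate P X n \<omega>)))
    \<and> converges_in_probability (P []) (information_rate P X) h
    \<and> converges_in_L1 (P []) (information_rate P X) h"
proof -
  interpret transient_kernel "step_prob p"
    by (rule regular_language_walk_transient_kernel[OF assms(1,3,2,4)])
  interpret transient_walk "step_prob p" "P []" X
    using assms(1) unfolding regular_language_walk_def markov_chain_iff transient_walk_def walk_def
    by (auto intro: transient_kernel_axioms word_kernel_axioms)
  have distr: "walk_distr P X n w = pn n [] w" for n w
    by (simp add: walk_distr_def prob_eq_pn)
  then have rate: "information_rate P X = (\<lambda>n \<omega>. - (1 / real n) * ln (pn n [] (X n \<omega>)))"
    by (intro ext) (simp add: information_rate_def)
  obtain h' where h': "(\<lambda>n. expectation (information_rate P X n)) \<longlonglongrightarrow> h'"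
      "(AE \<omega> in P []. ereal h' = liminf (\<lambda>n. ereal (information_rate P X n \<omega>)))
        \<and> converges_in_probability (P []) (information_rate P X) h'
        \<and> converges_in_L1 (P []) (information_rate P X) h'"
    using entropy_convergence unfolding rate by blast
  have "expectation (information_rate P X n)
      = - (1 / real n) * (\<integral>\<omega>. ln (walk_distr P X n (X n \<omega>)) \<partial>P [])" for n
    unfolding information_rate_def by (rule integral_mult_right_zero)
  \<comment> \<open>The value of \<open>lim\<close> is known to be \<open>h'\<close> because
    convergence of the expectations has been established.\<close>
  then have "h' = h" using h'(1) limI unfolding h_def asymptotic_entropy_def by fastforce
  then show ?thesis using h'(2) by simp
qed

end
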